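(* Let $(s_n)$ stand for the Kolmogorov numbers $(d_n)$ or for the dyadic entropy numbers $(e_n)$. Let $0<\tau\le\frac12$, $\beta,\gamma\in\mathbb R$, $c_0>0$, and let $$k(x)=x^{-\tau}(c_0-\ln x)^{-\beta}(c_0+\ln(c_0-\ln x))^{-\gamma},\quad x\in(0,1],$$ where it is assumed that $k:(0,1]\to\mathbb R$ is a well-defined non-negative, continuous, strictly decreasing function with $\lim_{x\to0}k(x)=\infty$ and $k\in L_2[0,1]$. Let $(T_Kf)(t)=\int_0^1K(t,x)f(x)\,dx$, $t\in[0,1]$, with kernel $K$ given either by (WS) $K(t,x)=k(|t-x|)$, or by (VO) $K(t,x)=k(t-x)$ for $x<t$ and $K(t,x)=0$ for $x\ge t$. Then in both cases (WS) and (VO) $$s_n(T_K:L_2[0,1]\to C[0,1])\preccurlyeq f(n,\tau,\beta,\gamma),$$ where $f(n,\tau,\beta,\gamma)=$ $$\begin{cases}n^{\tau-1}(\log(n+1))^{-\beta}(\log\log(n+3))^{-\gamma},&0<\tau<1/2,\ \beta\in\mathbb R,\ \gamma\in\mathbb R,\\ n^{1/2-\beta}(\log(n+1))^{-\gamma},&\tau=1/2,\ 1/2<\beta<1,\ \gamma\in\mathbb R,\\ n^{-1/2}(\log(n+1))^{1-\beta}(\log\log(n+3))^{-\gamma},&\tau=1/2,\ 1<\beta<\infty,\ \gamma\in\mathbb R,\\ n^{-1/2}(\log(n+1))^{1-\gamma},&\tau=1/2,\ \beta=1,\ -\infty<\gamma<1,\\ n^{-1/2}\log\log(n+3),&\tau=1/2,\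 \beta=1,\ \gamma=1,\\ n^{-1/2}(\log\log(n+3))^{1-\gamma},&\tau=1/2,\ \beta=1,\ 1<\gamma<\infty,\\ (\log(n+1))^{1/2-\gamma},&\tau=\beta=1/2,\ 1/2<\gamma<\infty.\end{cases}$$
   Context: $\log$ is the logarithm to base 2 and $\ln$ the natural logarithm. For positive sequences, $x_n\preccurlyeq y_n$ means that there is a constant $c>0$ with $x_n\le c\,y_n$ for all $n\in\mathbb N$. Entropy numbers: for a bounded subset $A$ of a metric space $M$, $\varepsilon_n(A)=\inf\{\varepsilon\ge0:\exists x_1,\dots,x_n\in M,\ A\subset\bigcup_{i=1}^n B_M(x_i,\varepsilon)\}$ with closed balls, $e_n(A)=\varepsilon_{2^{n-1}}(A)$; for a bounded linear operator $T:X\to Y$ between Banach spaces, $e_n(T)=e_n(T(B_X))$ with $B_X$ the closed unit ball of $X$. The $n$-th Kolmogorov number of $T$ is $d_n(T)=\inf\{\|Q_F^YT\|:F\text{ subspace of }Y,\ \dim F<n\}$, where $Q_F^Y:Y\to Y/F$ is the quotient map. *)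

theory Defs
  imports "HOL-Analysis.Analysis"
begin

section \<open>Entropy and Kolmogorov numbers\<close>

definition entropy_eps :: "nat \<Rightarrow> 'a::metric_space set \<Rightarrow> real" where
  "entropy_eps n A =
     Inf {\<epsilon>. 0 \<le> \<epsilon> \<and> (\<exists>x :: nat \<Rightarrow> 'a. A \<subseteq> (\<Union>i\<in>{1..n}. cball (x i) \<epsilon>))}"

definition dyadic_entropy_number ::
    "nat \<Rightarrow> ('a::real_normed_vector \<Rightarrow> 'b::real_normed_vector) \<Rightarrow> real" where
  "dyadic_entropy_number n T = entropy_eps (2 ^ (n - 1)) (T ` cball 0 1)"

text \<open>The quotient \<open>Y / F\<close> is represented by the cosets of \<open>F\<close>; the norm of a coset is the
  infimum of the norms of its elements.\<close>

definition quotient_map :: "'b::real_normed_vector set \<Rightarrow> 'b \<Rightarrow> 'b set" where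
  "quotient_map F y = {y + z |z. z \<in> F}"

definition quotient_norm :: "'b::real_normed_vector set \<Rightarrow> real" where
  "quotient_norm C = (INF y\<in>C. norm y)"

definition quotient_onorm ::
    "'b set \<Rightarrow> ('a::real_normed_vector \<Rightarrow> 'b::real_normed_vector) \<Rightarrow> real" where
  "quotient_onorm F T = (SUP x\<in>cball 0 1. quotient_norm (quotient_map F (T x)))"

text \<open>Since \<^const>\<open>dim\<close> is \<open>0\<close> on infinite-dimensional subspaces, finite dimension has to be
  required separately.\<close>

definition kolmogorov_number ::
    "nat \<Rightarrow> ('a::real_normed_vector \<Rightarrow> 'b::real_normed_vector) \<Rightarrow> real" where
  "kolmogorov_number n T =
     Inf {quotient_onorm F T |F. subspace F \<and> (\<exists>B. finite B \<and> span B = F) \<and> dim F < n}"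

text \<open>Domination up to a constant, for sequences indexed from \<open>1\<close>.\<close>

definition dominated :: "(nat \<Rightarrow> real) \<Rightarrow> (nat \<Rightarrow> real) \<Rightarrow> bool"  (infix \<open>\<preceq>\<^sub>c\<close> 50) where
  "x \<preceq>\<^sub>c y \<longleftrightarrow> (\<exists>c>0. \<forall>n\<ge>1. x n \<le> c * y n)"


section \<open>The Hilbert space \<open>L\<^sub>2[0,1]\<close>\<close>

abbreviation leb01 :: "real measure" where
  "leb01 \<equiv> lebesgue_on {0..1}"

definition square_integrable01 :: "(real \<Rightarrow> real) \<Rightarrow> bool" where
  "square_integrable01 f \<longleftrightarrow>
     f \<in> borel_measurable leb01 \<and> integrable leb01 (\<lambda>x. (f x)\<^sup>2)"

definition l2_eq :: "(real \<Rightarrow> real) \<Rightarrow> (real \<Rightarrow> real) \<Rightarrow> bool" where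
  "l2_eq f g \<longleftrightarrow>
     square_integrable01 f \<and> square_integrable01 g \<and> (AE x in leb01. f x = g x)"

lemma l2_eq_refl: "square_integrable01 f \<Longrightarrow> l2_eq f f"
  by (simp add: l2_eq_def)

lemma square_integrable01_zero: "square_integrable01 (\<lambda>x. 0)"
  by (simp add: square_integrable01_def)

lemma square_integrable01_mult:
  assumes "square_integrable01 f" "square_integrable01 g"
  shows "integrable leb01 (\<lambda>x. f x * g x)"
proof (rule Bochner_Integration.integrable_bound)
  show "integrable leb01 (\<lambda>x. (f x)\<^sup>2 + (g x)\<^sup>2)"
    using assms by (auto simp: square_integrable01_def)
  show "(\<lambda>x. f x * g x) \<in> borel_measurable leb01"
    using assms by (auto simp: square_integrable01_def)
  have "\<bar>a * b\<bar> \<le> a\<^sup>2 + b\<^sup>2" for a b :: real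
  proof -
    have "2 * \<bar>a\<bar> * \<bar>b\<bar> \<le> a\<^sup>2 + b\<^sup>2"
      using sum_squares_bound[of "\<bar>a\<bar>" "\<bar>b\<bar>"] by simp
    moreover have "0 \<le> \<bar>a\<bar> * \<bar>b\<bar>"
      by simp
    ultimately show ?thesis
      unfolding abs_mult by linarith
  qed
  then show "AE x in leb01. norm (f x * g x) \<le> norm ((f x)\<^sup>2 + (g x)\<^sup>2)"
    by simp
qed

lemma square_integrable01_add:
  assumes "square_integrable01 f" "square_integrable01 g"
  shows "square_integrable01 (\<lambda>x. f x + g x)"
  using assms square_integrable01_mult[OF assms]
  by (auto simp: square_integrable01_def power2_sum intro!: Bochner_Integration.integrable_add
      borel_measurable_add simp: mult.assoc)

lemma square_integrable01_cmult:
  assumes "square_integrable01 f"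
  shows "square_integrable01 (\<lambda>x. c * f x)"
  using assms by (auto simp: square_integrable01_def power_mult_distrib)

lemma square_integrable01_uminus:
  "square_integrable01 f \<Longrightarrow> square_integrable01 (\<lambda>x. - f x)"
  by (auto simp: square_integrable01_def)

lemma square_integrable01_diff:
  "square_integrable01 f \<Longrightarrow> square_integrable01 g \<Longrightarrow> square_integrable01 (\<lambda>x. f x - g x)"
  using square_integrable01_add[of f "\<lambda>x. - g x"] square_integrable01_uminus[of g] by simp

quotient_type l2 = "real \<Rightarrow> real" / partial: l2_eq
proof (rule part_equivpI)
  show "\<exists>f. l2_eq f f"
    by (rule exI[of _ "\<lambda>_. 0"]) (simp add: l2_eq_def square_integrable01_zero)
  show "symp l2_eq"
    by (auto simp: symp_def l2_eq_def)
  show "transp l2_eq"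
    by (auto simp: transp_def l2_eq_def)
qed

lemma l2_eq_integral_mult:
  assumes "l2_eq f f'" "l2_eq g g'"
  shows "(LINT x|leb01. f x * g x) = (LINT x|leb01. f' x * g' x)"
  using assms by (intro integral_cong_AE) (auto simp: l2_eq_def square_integrable01_def)

instantiation l2 :: real_inner
begin

lift_definition zero_l2 :: l2 is "\<lambda>x. 0"
  by (simp add: l2_eq_def square_integrable01_zero)

lift_definition plus_l2 :: "l2 \<Rightarrow> l2 \<Rightarrow> l2" is "\<lambda>f g x. f x + g x"
  by (auto simp: l2_eq_def square_integrable01_add)

lift_definition uminus_l2 :: "l2 \<Rightarrow> l2" is "\<lambda>f x. - f x"
  by (auto simp: l2_eq_def square_integrable01_uminus)

lift_definition minus_l2 :: "l2 \<Rightarrow> l2 \<Rightarrow> l2" is "\<lambda>f g x. f x - g x"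
  by (auto simp: l2_eq_def square_integrable01_diff)

lift_definition scaleR_l2 :: "real \<Rightarrow> l2 \<Rightarrow> l2" is "\<lambda>c f x. c * f x"
  by (auto simp: l2_eq_def square_integrable01_cmult)

lift_definition inner_l2 :: "l2 \<Rightarrow> l2 \<Rightarrow> real" is "\<lambda>f g. LINT x|leb01. f x * g x"
  by (rule l2_eq_integral_mult)

definition norm_l2 :: "l2 \<Rightarrow> real" where
  "norm_l2 f = sqrt (inner f f)"

definition sgn_l2 :: "l2 \<Rightarrow> l2" where
  "sgn_l2 f = scaleR (inverse (norm f)) f"

definition dist_l2 :: "l2 \<Rightarrow> l2 \<Rightarrow> real" where
  "dist_l2 f g = norm (f - g)"

definition uniformity_l2 :: "(l2 \<times> l2) filter" where
  "uniformity_l2 = (INF e\<in>{0<..}. principal {(f, g). dist f g < e})"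

definition open_l2 :: "l2 set \<Rightarrow> bool" where
  "open_l2 S = (\<forall>f\<in>S. \<forall>\<^sub>F (f', g) in uniformity. f' = f \<longrightarrow> g \<in> S)"

instance
proof
  fix f g h :: l2 and a b :: real
  show "f + g + h = f + (g + h)"
    by transfer (auto simp: l2_eq_def algebra_simps intro!: square_integrable01_add)
  show "f + g = g + f"
    by transfer (auto simp: l2_eq_def algebra_simps intro!: square_integrable01_add)
  show "0 + f = f"
    by transfer (auto simp: l2_eq_def)
  show "- f + f = 0"
    by transfer (auto simp: l2_eq_def square_integrable01_zero)
  show "f - g = f + - g"
    by transfer (auto simp: l2_eq_def intro!: square_integrable01_diff)
  show "a *\<^sub>R (f + g) = a *\<^sub>R f + a *\<^sub>R g"
    by transfer (auto simp: l2_eq_def algebra_simps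
        intro!: square_integrable01_add square_integrable01_cmult)
  show "(a + b) *\<^sub>R f = a *\<^sub>R f + b *\<^sub>R f"
    by transfer (auto simp: l2_eq_def algebra_simps
        intro!: square_integrable01_add square_integrable01_cmult)
  show "a *\<^sub>R b *\<^sub>R f = (a * b) *\<^sub>R f"
    by transfer (auto simp: l2_eq_def mult.assoc intro!: square_integrable01_cmult)
  show "1 *\<^sub>R f = f"
    by transfer (auto simp: l2_eq_def)
  show "sgn f = scaleR (inverse (norm f)) f"
    by (rule sgn_l2_def)
  show "dist f g = norm (f - g)"
    by (rule dist_l2_def)
  show "(uniformity :: (l2 \<times> l2) filter) = (INF e\<in>{0<..}. principal {(x, y). dist x y < e})"
    by (rule uniformity_l2_def)
  show "open S = (\<forall>x\<in>S. \<forall>\<^sub>F (x', y) in uniformity. x' = x \<longrightarrow> y \<in> S)" for S :: "l2 set"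
    by (rule open_l2_def)
  show "inner f g = inner g f"
    by transfer (simp add: mult.commute)
  show "inner (f + g) h = inner f h + inner g h"
  proof transfer
    fix f g h assume "l2_eq f f" "l2_eq g g" "l2_eq h h"
    then show "(LINT x|leb01. (f x + g x) * h x)
        = (LINT x|leb01. f x * h x) + (LINT x|leb01. g x * h x)"
      by (simp add: distrib_right l2_eq_def square_integrable01_mult)
  qed
  show "inner (a *\<^sub>R f) g = a * inner f g"
    by transfer (simp add: mult.assoc)
  show "0 \<le> inner f f"
    by transfer simp
  show "inner f f = 0 \<longleftrightarrow> f = 0"
  proof transfer
    fix f assume f: "l2_eq f f"
    then have "integrable leb01 (\<lambda>x. f x * f x)"
      by (simp add: l2_eq_def square_integrable01_mult)
    then have "(LINT x|leb01. f x * f x) = 0 \<longleftrightarrow> (AE x in leb01. f x * f x = 0)"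
      by (intro integral_nonneg_eq_0_iff_AE) auto
    then show "(LINT x|leb01. f x * f x) = 0 \<longleftrightarrow> l2_eq f (\<lambda>x. 0)"
      using f by (simp add: l2_eq_def square_integrable01_zero)
  qed
  show "norm f = sqrt (inner f f)"
    by (rule norm_l2_def)
qed

end


section \<open>The space \<open>C[0,1]\<close>\<close>

text \<open>The interval \<open>[0,1]\<close> as a type with the metric of the real line. As it is compact,
  the type \<open>unit_interval \<Rightarrow>\<^sub>C real\<close> of bounded continuous functions with the supremum norm
  is \<open>C[0,1]\<close>.\<close>

typedef unit_interval = "{0..1::real}"
  morphisms real_of_ui ui_of_real
  by (rule exI[of _ 0]) simp

instantiation unit_interval :: metric_space
begin

definition dist_unit_interval :: "unit_interval \<Rightarrow> unit_interval \<Rightarrow> real" where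
  "dist_unit_interval s t = dist (real_of_ui s) (real_of_ui t)"

definition uniformity_unit_interval :: "(unit_interval \<times> unit_interval) filter" where
  "uniformity_unit_interval = (INF e\<in>{0<..}. principal {(s, t). dist s t < e})"

definition open_unit_interval :: "unit_interval set \<Rightarrow> bool" where
  "open_unit_interval S = (\<forall>s\<in>S. \<forall>\<^sub>F (s', t) in uniformity. s' = s \<longrightarrow> t \<in> S)"

instance
  by standard (auto simp: dist_unit_interval_def uniformity_unit_interval_def
      open_unit_interval_def real_of_ui_inject dist_triangle2)

end

type_synonym C01 = "unit_interval \<Rightarrow>\<^sub>C real"

lemma compact_UNIV_unit_interval: "compact (UNIV :: unit_interval set)"
proof -
  have "continuous_on {0..1} ui_of_real"
    by (auto simp: continuous_on_iff dist_unit_interval_def ui_of_real_inverse)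
  moreover have "ui_of_real ` {0..1} = UNIV"
    using type_definition.Abs_image[OF type_definition_unit_interval] .
  ultimately show ?thesis
    by (metis compact_continuous_image compact_Icc)
qed

lemma continuous_in_bcontfun:
  fixes g :: "unit_interval \<Rightarrow> real"
  shows "continuous_on UNIV g \<Longrightarrow> g \<in> bcontfun"
  by (auto simp: bcontfun_def intro!: compact_imp_bounded compact_continuous_image
      compact_UNIV_unit_interval)


section \<open>Integral operators\<close>

text \<open>\<open>integral_op K\<close> is only meaningful if \<open>t \<mapsto> \<integral> K(t,x) f(x) dx\<close> is continuous for all
  \<open>f\<close>; the lemmas at the end of this theory show that this is so for the kernels considered here,
  and that the integral does not depend on the representative of \<open>f\<close>.\<close>

definition integral_op :: "(real \<Rightarrow> real \<Rightarrow> real) \<Rightarrow> l2 \<Rightarrow> C01" where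
  "integral_op K f = Bcontfun (\<lambda>t. LINT x|leb01. K (real_of_ui t) x * rep_l2 f x)"

definition kernel_WS :: "(real \<Rightarrow> real) \<Rightarrow> real \<Rightarrow> real \<Rightarrow> real" where
  "kernel_WS k t x = k \<bar>t - x\<bar>"

definition kernel_VO :: "(real \<Rightarrow> real) \<Rightarrow> real \<Rightarrow> real \<Rightarrow> real" where
  "kernel_VO k t x = (if x < t then k (t - x) else 0)"

text \<open>A factor with exponent \<open>0\<close> is \<open>1\<close> for every base, whereas \<open>0 powr 0 = 0\<close>. For nonzero
  exponent \<^const>\<open>powr\<close> is the real power only for positive base, and for base \<open>0\<close> if the
  exponent is positive.\<close>

definition rpow :: "real \<Rightarrow> real \<Rightarrow> real" where
  "rpow b a = (if a = 0 then 1 else b powr a)"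

definition rpow_defined :: "real \<Rightarrow> real \<Rightarrow> bool" where
  "rpow_defined b a \<longleftrightarrow> b > 0 \<or> a = 0 \<or> (b = 0 \<and> a > 0)"

definition kfun :: "real \<Rightarrow> real \<Rightarrow> real \<Rightarrow> real \<Rightarrow> real \<Rightarrow> real" where
  "kfun \<tau> \<beta> \<gamma> c\<^sub>0 x =
     rpow x (-\<tau>) * rpow (c\<^sub>0 - ln x) (-\<beta>) * rpow (c\<^sub>0 + ln (c\<^sub>0 - ln x)) (-\<gamma>)"

definition kfun_well_defined :: "real \<Rightarrow> real \<Rightarrow> real \<Rightarrow> real \<Rightarrow> bool" where
  "kfun_well_defined \<tau> \<beta> \<gamma> c\<^sub>0 \<longleftrightarrow>
     (\<forall>x\<in>{0<..1}. rpow_defined x (-\<tau>) \<and> rpow_defined (c\<^sub>0 - ln x) (-\<beta>) \<and>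
        rpow_defined (c\<^sub>0 + ln (c\<^sub>0 - ln x)) (-\<gamma>))"

text \<open>The cases exhaust the parameters with \<open>0 < \<tau> \<le> 1/2\<close> for which \<open>kfun\<close> is square
  integrable; the final value is irrelevant.\<close>

definition rate :: "real \<Rightarrow> real \<Rightarrow> real \<Rightarrow> nat \<Rightarrow> real" where
  "rate \<tau> \<beta> \<gamma> n =
    (let N = real n; L = log 2 (N + 1); LL = log 2 (log 2 (N + 3)) in
     if 0 < \<tau> \<and> \<tau> < 1/2 then N powr (\<tau> - 1) * L powr (-\<beta>) * LL powr (-\<gamma>)
     else if \<tau> = 1/2 \<and> 1/2 < \<beta> \<and> \<beta> < 1 then N powr (1/2 - \<beta>) * L powr (-\<gamma>)
     else if \<tau> = 1/2 \<and> 1 < \<beta> then N powr (-1/2) * L powr (1 - \<beta>) * LL powr (-\<gamma>)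
     else if \<tau> = 1/2 \<and> \<beta> = 1 \<and> \<gamma> < 1 then N powr (-1/2) * L powr (1 - \<gamma>)
     else if \<tau> = 1/2 \<and> \<beta> = 1 \<and> \<gamma> = 1 then N powr (-1/2) * LL
     else if \<tau> = 1/2 \<and> \<beta> = 1 \<and> 1 < \<gamma> then N powr (-1/2) * LL powr (1 - \<gamma>)
     else if \<tau> = 1/2 \<and> \<beta> = 1/2 \<and> 1/2 < \<gamma> then L powr (1/2 - \<gamma>)
     else undefined)"


subsection \<open>The operators are well defined\<close>

lemma continuous_inner_imp_integral_op:
  assumes sq: "\<And>t. t \<in> {0..1} \<Longrightarrow> square_integrable01 (K t)"
    and cont: "\<And>T t. (\<And>n. T n \<in> {0..1}) \<Longrightarrow> t \<in> {0..1} \<Longrightarrow> T \<longlonglongrightarrow> t \<Longrightarrow>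
      (\<lambda>n. abs_l2 (K (T n))) \<longlonglongrightarrow> abs_l2 (K t)"
  shows "bounded_linear (integral_op K)"
    and "square_integrable01 f \<Longrightarrow>
      integral_op K (abs_l2 f) t = (LINT x|leb01. K (real_of_ui t) x * f x)"
proof -
  have ui: "real_of_ui t \<in> {0..1}" for t
    by (rule real_of_ui)
  have rep: "l2_eq (rep_l2 f) (rep_l2 f)" for f
    using Quotient3_rep_reflp[OF Quotient3_l2] .
  have absrep: "abs_l2 (rep_l2 f) = f" for f
    using Quotient3_abs_rep[OF Quotient3_l2] .
  have inner_abs: "inner (abs_l2 g) (abs_l2 h) = (LINT x|leb01. g x * h x)"
    if "square_integrable01 g" "square_integrable01 h" for g h
    using that by (intro inner_l2.abs_eq) (auto simp: l2_eq_def)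
  define \<kappa> where "\<kappa> t = abs_l2 (K (real_of_ui t))" for t
  have int_eq: "(LINT x|leb01. K (real_of_ui t) x * rep_l2 f x) = inner (\<kappa> t) f" for t f
    using inner_abs[OF sq[OF ui], of "rep_l2 f" t] rep[of f] absrep[of f]
    by (simp add: \<kappa>_def l2_eq_def)
  have \<kappa>: "continuous_on UNIV \<kappa>"
  proof (clarsimp simp: continuous_on_sequentially)
    fix x :: "nat \<Rightarrow> unit_interval" and a
    assume "x \<longlonglongrightarrow> a"
    then have "(\<lambda>n. real_of_ui (x n)) \<longlonglongrightarrow> real_of_ui a"
      by (simp add: tendsto_iff dist_unit_interval_def)
    then show "(\<kappa> \<circ> x) \<longlonglongrightarrow> \<kappa> a"
      using cont[of "\<lambda>n. real_of_ui (x n)" "real_of_ui a"] ui by (simp add: \<kappa>_def o_def)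
  qed
  then have "bounded (range \<kappa>)"
    by (intro compact_imp_bounded compact_continuous_image compact_UNIV_unit_interval)
  then obtain B where B: "norm (\<kappa> t) \<le> B" for t
    by (auto simp: bounded_iff)
  have app: "apply_bcontfun (integral_op K f) t = inner (\<kappa> t) f" for f t
  proof -
    have "(\<lambda>t. inner (\<kappa> t) f) \<in> bcontfun"
      by (intro continuous_in_bcontfun continuous_intros \<kappa>)
    then show ?thesis
      by (simp add: integral_op_def int_eq Bcontfun_inverse)
  qed
  show "bounded_linear (integral_op K)"
  proof (rule bounded_linear_intro[of _ B])
    fix f g :: l2 and c :: real
    show "integral_op K (f + g) = integral_op K f + integral_op K g"
      by (rule bcontfun_eqI) (simp add: app inner_add_right)
    show "integral_op K (c *\<^sub>R f) = c *\<^sub>R integral_op K f"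
      by (rule bcontfun_eqI) (simp add: app)
    show "norm (integral_op K f) \<le> norm f * B"
    proof (rule norm_bound)
      fix t
      have "norm (inner (\<kappa> t) f) \<le> norm (\<kappa> t) * norm f"
        by (simp add: Cauchy_Schwarz_ineq2)
      also have "\<dots> \<le> B * norm f"
        by (intro mult_right_mono B) simp
      finally show "norm (integral_op K f t) \<le> norm f * B"
        by (simp add: app mult.commute)
    qed
  qed
  show "integral_op K (abs_l2 f) t = (LINT x|leb01. K (real_of_ui t) x * f x)"
    if "square_integrable01 f"
    using that inner_abs[OF sq[OF ui] that] by (simp add: app \<kappa>_def)
qed

lemma tendsto_power2_zero:
  fixes f :: "nat \<Rightarrow> real"
  assumes "(\<lambda>n. (f n)\<^sup>2) \<longlonglongrightarrow> 0"
  shows "f \<longlonglongrightarrow> 0"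
  using tendsto_real_sqrt[OF assms] by (simp add: tendsto_rabs_zero_iff)

lemma square_diff_le:
  fixes a b :: real
  assumes "0 \<le> a" "0 \<le> b"
  shows "(a - b) * (a - b) \<le> norm (a\<^sup>2 - b\<^sup>2)"
proof -
  have "(a - b) * (a - b) = \<bar>a - b\<bar> * \<bar>a - b\<bar>"
    by simp
  also have "\<dots> \<le> \<bar>a - b\<bar> * \<bar>a + b\<bar>"
    using assms by (intro mult_left_mono) auto
  also have "\<dots> = norm (a\<^sup>2 - b\<^sup>2)"
    unfolding abs_mult[symmetric] real_norm_def by (simp add: algebra_simps power2_eq_square)
  finally show ?thesis .
qed

lemma translation_L2:
  fixes h :: "real \<Rightarrow> real"
  assumes h[measurable]: "h \<in> borel_measurable borel" and nn: "\<And>u. 0 \<le> h u"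
    and int: "integrable lborel (\<lambda>u. (h u)\<^sup>2)"
    and S: "finite S" "\<And>u. u \<notin> S \<Longrightarrow> isCont h u"
    and c: "\<bar>c\<bar> = (1::real)" and T: "T \<longlonglongrightarrow> t"
  shows "square_integrable01 (\<lambda>x. h (c * (t - x)))"
    and "(\<lambda>n. abs_l2 (\<lambda>x. h (c * (T n - x)))) \<longlonglongrightarrow> abs_l2 (\<lambda>x. h (c * (t - x)))"
proof -
  have c0: "c \<noteq> 0" using c by auto
  have aff: "c * (t - x) = c * t + (- c) * x" for t x
    by (simp add: algebra_simps)
  have int': "integrable lborel (\<lambda>x. (h (c * (t - x)))\<^sup>2)" for t
    using lborel_integrable_real_affine[OF int, of "-c" "c * t"] c0 by (simp add: aff)
  have sq: "square_integrable01 (\<lambda>x. h (c * (t - x)))" for t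
  proof -
    have "integrable lebesgue (\<lambda>x. (h (c * (t - x)))\<^sup>2)"
      using int'[of t] by (subst integrable_completion) auto
    then have "integrable lebesgue (\<lambda>x. indicator {0..1} x *\<^sub>R (h (c * (t - x)))\<^sup>2)"
      by (rule integrable_mult_indicator[rotated]) auto
    then have "integrable leb01 (\<lambda>x. (h (c * (t - x)))\<^sup>2)"
      by (subst integrable_restrict_space) auto
    moreover have "(\<lambda>x. h (c * (t - x))) \<in> borel_measurable leb01"
      by (intro measurable_restrict_space1 measurable_completion) simp
    ultimately show ?thesis
      by (simp add: square_integrable01_def)
  qed
  then show "square_integrable01 (\<lambda>x. h (c * (t - x)))" .
  have nneq: "(\<integral>\<^sup>+ x. norm ((h (c * (t - x)))\<^sup>2) \<partial>lborel) = (\<integral>\<^sup>+ x. norm ((h x)\<^sup>2) \<partial>lborel)" for t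
    using nn_integral_real_affine[of "\<lambda>x. ennreal (norm ((h x)\<^sup>2))" "-c" "c * t"] c c0
    by (simp add: aff)
  have "AE x in lborel. c * (t - x) \<notin> S"
  proof (rule AE_I')
    show "(\<lambda>u. t - u / c) ` S \<in> null_sets lborel"
      using S(1) by (intro finite_imp_null_set_lborel) simp
    show "{x \<in> space lborel. \<not> c * (t - x) \<notin> S} \<subseteq> (\<lambda>u. t - u / c) ` S"
    proof clarsimp
      fix x assume "c * (t - x) \<in> S"
      moreover have "x = t - c * (t - x) / c"
        using c0 by simp
      ultimately show "x \<in> (\<lambda>u. t - u / c) ` S"
        by blast
    qed
  qed
  then have AE: "AE x in lborel. (\<lambda>n. (h (c * (T n - x)))\<^sup>2) \<longlonglongrightarrow> (h (c * (t - x)))\<^sup>2"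
  proof (rule AE_mp, intro AE_I2 impI)
    fix x assume "c * (t - x) \<notin> S"
    then have "isCont h (c * (t - x))" by (rule S(2))
    moreover have "(\<lambda>n. c * (T n - x)) \<longlonglongrightarrow> c * (t - x)"
      by (intro tendsto_intros T)
    ultimately show "(\<lambda>n. (h (c * (T n - x)))\<^sup>2) \<longlonglongrightarrow> (h (c * (t - x)))\<^sup>2"
      by (intro tendsto_power) (rule isCont_tendsto_compose)
  qed
  have lim: "(\<lambda>n. \<integral>\<^sup>+ x. norm ((h (c * (T n - x)))\<^sup>2 - (h (c * (t - x)))\<^sup>2) \<partial>lborel) \<longlonglongrightarrow> 0"
  proof (rule Scheffe_lemma2)
    show "(\<lambda>x. (h (c * (T n - x)))\<^sup>2) \<in> borel_measurable lborel" for n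
      by measurable
    show "(\<integral>\<^sup>+ x. norm ((h (c * (T n - x)))\<^sup>2) \<partial>lborel) \<le> (\<integral>\<^sup>+ x. norm ((h (c * (t - x)))\<^sup>2) \<partial>lborel)" for n
      by (simp only: nneq order_refl)
  qed (rule int' AE)+
  have bound: "ennreal ((dist (abs_l2 (\<lambda>x. h (c * (s - x)))) (abs_l2 (\<lambda>x. h (c * (t - x)))))\<^sup>2)
      \<le> (\<integral>\<^sup>+ x. norm ((h (c * (s - x)))\<^sup>2 - (h (c * (t - x)))\<^sup>2) \<partial>lborel)" for s
  proof -
    let ?d = "\<lambda>x. h (c * (s - x)) - h (c * (t - x))"
    have d: "square_integrable01 ?d"
      by (intro square_integrable01_diff sq)
    have "abs_l2 (\<lambda>x. h (c * (s - x))) - abs_l2 (\<lambda>x. h (c * (t - x))) = abs_l2 ?d"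
      by (rule minus_l2.abs_eq) (rule l2_eq_refl[OF sq])+
    then have "(dist (abs_l2 (\<lambda>x. h (c * (s - x)))) (abs_l2 (\<lambda>x. h (c * (t - x)))))\<^sup>2
        = inner (abs_l2 ?d) (abs_l2 ?d)"
      by (simp add: dist_norm power2_norm_eq_inner)
    also have "\<dots> = (LINT x|leb01. ?d x * ?d x)"
      by (rule inner_l2.abs_eq) (rule l2_eq_refl[OF d])+
    finally have "ennreal ((dist (abs_l2 (\<lambda>x. h (c * (s - x)))) (abs_l2 (\<lambda>x. h (c * (t - x)))))\<^sup>2)
        = ennreal (LINT x|leb01. ?d x * ?d x)"
      by (rule arg_cong)
    also have "\<dots> = (\<integral>\<^sup>+ x. ennreal (?d x * ?d x) \<partial>leb01)"
      by (rule nn_integral_eq_integral[symmetric], rule square_integrable01_mult[OF d d]) simp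
    also have "\<dots> = (\<integral>\<^sup>+ x. ennreal (?d x * ?d x) * indicator {0..1} x \<partial>lebesgue)"
      by (rule nn_integral_restrict_space) auto
    also have "\<dots> \<le> (\<integral>\<^sup>+ x. ennreal (norm ((h (c * (s - x)))\<^sup>2 - (h (c * (t - x)))\<^sup>2)) \<partial>lebesgue)"
    proof (rule nn_integral_mono)
      fix x
      let ?a = "h (c * (s - x))" and ?b = "h (c * (t - x))"
      have "?d x * ?d x \<le> norm (?a\<^sup>2 - ?b\<^sup>2)"
        by (rule square_diff_le) (rule nn)+
      then show "ennreal (?d x * ?d x) * indicator {0..1} x \<le> ennreal (norm (?a\<^sup>2 - ?b\<^sup>2))"
        by (cases "x \<in> {0..1}") (simp_all only: indicator_simps not_False_eq_True mult_1_right mult_zero_right zero_le ennreal_leI)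
    qed
    also have "\<dots> = (\<integral>\<^sup>+ x. norm ((h (c * (s - x)))\<^sup>2 - (h (c * (t - x)))\<^sup>2) \<partial>lborel)"
      by (rule nn_integral_completion)
    finally show ?thesis .
  qed
  have "(\<lambda>n. ennreal ((dist (abs_l2 (\<lambda>x. h (c * (T n - x)))) (abs_l2 (\<lambda>x. h (c * (t - x)))))\<^sup>2)) \<longlonglongrightarrow> 0"
    by (rule tendsto_sandwich[OF _ _ tendsto_const lim]) (use bound in auto)
  then have "(\<lambda>n. (dist (abs_l2 (\<lambda>x. h (c * (T n - x)))) (abs_l2 (\<lambda>x. h (c * (t - x)))))\<^sup>2) \<longlonglongrightarrow> 0"
    by (subst (asm) tendsto_ennreal_iff[where x=0, simplified]) auto
  then have "(\<lambda>n. dist (abs_l2 (\<lambda>x. h (c * (T n - x)))) (abs_l2 (\<lambda>x. h (c * (t - x))))) \<longlonglongrightarrow> 0"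
    by (rule tendsto_power2_zero)
  then show "(\<lambda>n. abs_l2 (\<lambda>x. h (c * (T n - x)))) \<longlonglongrightarrow> abs_l2 (\<lambda>x. h (c * (t - x)))"
    using tendsto_dist_iff by blast
qed

lemma kernels_integral_op:
  assumes k: "continuous_on {0<..1} k" "\<forall>x\<in>{0<..1}. 0 \<le> k x" "square_integrable01 k"
    and K: "K = kernel_WS k \<or> K = kernel_VO k"
  shows "bounded_linear (integral_op K)"
    and "square_integrable01 f \<Longrightarrow>
      integral_op K (abs_l2 f) t = (LINT x|leb01. K (real_of_ui t) x * f x)"
proof -
  define h where "h u = (if u \<in> {0<..1} then k u else 0)" for u
  have cont: "isCont h u" if u: "u \<notin> {0, 1}" for u
  proof -
    consider "u \<in> {..<0}" | "u \<in> {0<..<1}" | "u \<in> {1<..}"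
      using u by fastforce
    then show ?thesis
    proof cases
      case 1
      have "continuous_on {..<0} h"
        by (rule continuous_on_eq[OF continuous_on_const[of _ 0]]) (auto simp: h_def)
      with 1 show ?thesis
        using continuous_on_eq_continuous_at open_lessThan by blast
    next
      case 2
      have "continuous_on {0<..<1} h"
        by (rule continuous_on_eq[OF continuous_on_subset[OF k(1)]]) (auto simp: h_def)
      with 2 show ?thesis
        using continuous_on_eq_continuous_at open_greaterThanLessThan by blast
    next
      case 3
      have "continuous_on {1<..} h"
        by (rule continuous_on_eq[OF continuous_on_const[of _ 0]]) (auto simp: h_def)
      with 3 show ?thesis
        using continuous_on_eq_continuous_at open_greaterThan by blast
    qed
  qed
  have h[measurable]: "h \<in> borel_measurable borel"
    by (rule borel_measurable_continuous_countable_exceptions[of "{0, 1}"])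
      (use cont in \<open>auto intro!: continuous_at_imp_continuous_on\<close>)
  have nn: "0 \<le> h u" for u
    using k(2) by (simp add: h_def)
  have int: "integrable lborel (\<lambda>u. (h u)\<^sup>2)"
  proof -
    have "integrable lebesgue (\<lambda>u. indicator {0..1} u *\<^sub>R (k u)\<^sup>2)"
      using k(3) by (simp add: square_integrable01_def integrable_restrict_space)
    then have "integrable lebesgue (\<lambda>u. indicator {0<..1} u *\<^sub>R (indicator {0..1} u *\<^sub>R (k u)\<^sup>2))"
      by (rule integrable_mult_indicator[rotated]) auto
    also have "(\<lambda>u. indicator {0<..1} u *\<^sub>R (indicator {0..1} u *\<^sub>R (k u)\<^sup>2)) = (\<lambda>u. (h u)\<^sup>2)"
      by (auto simp: h_def indicator_def)
    finally show ?thesis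
      by (rule integrable_completion[THEN iffD1, rotated]) measurable
  qed
  have finite01: "finite {0, 1 :: real}"
    by simp
  note tr = translation_L2[OF h nn int finite01 cont]
  define r where "r t x = h (1 * (t - x))" for t x
  define l where "l t x = h ((-1) * (t - x))" for t x
  have r: "square_integrable01 (r t)" and l: "square_integrable01 (l t)" for t
    using tr(1)[where c = 1 and T = "\<lambda>_. t" and t = t]
      tr(1)[where c = "-1" and T = "\<lambda>_. t" and t = t]
    unfolding r_def l_def by simp_all
  have rlim: "(\<lambda>n. abs_l2 (r (T n))) \<longlonglongrightarrow> abs_l2 (r t)"
    and llim: "(\<lambda>n. abs_l2 (l (T n))) \<longlonglongrightarrow> abs_l2 (l t)" if "T \<longlonglongrightarrow> t" for T t
    using tr(2)[where c = 1 and T = T and t = t] tr(2)[where c = "-1" and T = T and t = t] that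
    unfolding r_def l_def by simp_all
  have ne: "AE x in leb01. x \<noteq> t" for t :: real
  proof -
    have "AE x in lebesgue. x \<noteq> t"
      by (rule AE_completion) (rule AE_lborel_singleton)
    then show ?thesis
      by (subst AE_restrict_space_iff) (auto elim: eventually_mono)
  qed
  have transfer_eq: "square_integrable01 f \<and> abs_l2 f = abs_l2 g"
    if g: "square_integrable01 g" and ae: "\<And>x. x \<in> {0..1} \<Longrightarrow> x \<noteq> t \<Longrightarrow> f x = g x" for f g t
  proof -
    have AE: "AE x in leb01. g x = f x"
      using ne[of t] by (rule AE_mp) (auto simp: ae intro!: AE_I2)
    have mg: "g \<in> borel_measurable leb01"
      using g by (simp add: square_integrable01_def)
    have mf: "f \<in> borel_measurable leb01"
    proof -
      have "(\<lambda>x. if x \<in> {t} then f t else g x) \<in> borel_measurable leb01"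
        by (rule measurable_If_set) (use mg in \<open>auto simp: sets_restrict_space image_iff intro!: bexI[of _ "{t}"]\<close>)
      then show ?thesis
        by (subst measurable_cong[of _ _ "\<lambda>x. if x \<in> {t} then f t else g x"]) (auto simp: ae)
    qed
    have "integrable leb01 (\<lambda>x. (f x)\<^sup>2)"
      using g mf AE unfolding square_integrable01_def
      by (subst integrable_cong_AE[of _ _ "\<lambda>x. (g x)\<^sup>2"]) (auto elim: eventually_mono)
    with mf have "square_integrable01 f"
      by (simp add: square_integrable01_def)
    moreover have "l2_eq f g"
      using g calculation AE by (auto simp: l2_eq_def elim: eventually_mono)
    ultimately show ?thesis
      using Quotient3_rel_abs[OF Quotient3_l2] by blast
  qed
  have "\<exists>G. (\<forall>t\<in>{0..1}. square_integrable01 (G t) \<and> (\<forall>x\<in>{0..1}. x \<noteq> t \<longrightarrow> K t x = G t x)) \<and>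
    (\<forall>T t. T \<longlonglongrightarrow> t \<longrightarrow> (\<lambda>n. abs_l2 (G (T n))) \<longlonglongrightarrow> abs_l2 (G t))"
    using K
  proof
    assume K: "K = kernel_WS k"
    show ?thesis
    proof (intro exI[of _ "\<lambda>t x. r t x + l t x"] conjI ballI allI impI)
      show "square_integrable01 (\<lambda>x. r t x + l t x)" for t
        by (intro square_integrable01_add r l)
      show "K t x = r t x + l t x" if "t \<in> {0..1}" "x \<in> {0..1}" "x \<noteq> t" for t x
        using that by (auto simp: K kernel_WS_def r_def l_def h_def abs_if)
      have "abs_l2 (\<lambda>x. r t x + l t x) = abs_l2 (r t) + abs_l2 (l t)" for t
        using r l by (intro plus_l2.abs_eq[symmetric]) (auto simp: l2_eq_def)
      then show "(\<lambda>n. abs_l2 (\<lambda>x. r (T n) x + l (T n) x)) \<longlonglongrightarrow> abs_l2 (\<lambda>x. r t x + l t x)"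
        if "T \<longlonglongrightarrow> t" for T t
        by (simp add: tendsto_add rlim llim that)
    qed
  next
    assume K: "K = kernel_VO k"
    show ?thesis
    proof (intro exI[of _ r] conjI ballI allI impI r rlim)
      show "K t x = r t x" if "t \<in> {0..1}" "x \<in> {0..1}" "x \<noteq> t" for t x
        using that by (auto simp: K kernel_VO_def r_def h_def)
    qed
  qed
  then obtain G where G: "\<And>t. t \<in> {0..1} \<Longrightarrow> square_integrable01 (G t)"
      "\<And>t x. t \<in> {0..1} \<Longrightarrow> x \<in> {0..1} \<Longrightarrow> x \<noteq> t \<Longrightarrow> K t x = G t x"
      "\<And>T t. T \<longlonglongrightarrow> t \<Longrightarrow> (\<lambda>n. abs_l2 (G (T n))) \<longlonglongrightarrow> abs_l2 (G t)"
    by blast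
  have KG: "square_integrable01 (K t) \<and> abs_l2 (K t) = abs_l2 (G t)" if "t \<in> {0..1}" for t
    by (rule transfer_eq[of _ t]) (use G that in auto)
  have lim: "(\<lambda>n. abs_l2 (K (T n))) \<longlonglongrightarrow> abs_l2 (K t)"
    if "\<And>n. T n \<in> {0..1}" "t \<in> {0..1}" "T \<longlonglongrightarrow> t" for T t
    using G(3)[OF that(3)] KG that by simp
  show "bounded_linear (integral_op K)"
    by (rule continuous_inner_imp_integral_op) (use KG lim in blast)+
  show "integral_op K (abs_l2 f) t = (LINT x|leb01. K (real_of_ui t) x * f x)"
    if "square_integrable01 f"
    by (rule continuous_inner_imp_integral_op) (use KG lim that in blast)+
qed

end

theory Submission
  imports Defs "HOL-Real_Asymp.Real_Asymp"
begin

text \<open>Write \<open>T f t = inner (\<kappa> t) f\<close> with the curve \<open>\<kappa> t = K t\<close> in \<open>L\<^sub>2\<close>. Everything is governed by the energy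
\<open>\<Phi> \<delta> = \<integral>\<^sub>0\<^sup>\<delta> k\<^sup>2\<close>. Because \<open>k\<close> is decreasing, \<open>norm (\<kappa> s - \<kappa> t)\<^sup>2\<close> is at most a multiple of
\<open>\<Phi> \<bar>s - t\<bar>\<close> (\<open>kernel_section_modulus\<close>), and the increments of \<open>\<kappa>\<close> over a grid of mesh \<open>\<delta>\<close> are almost
orthogonal: they satisfy a Bessel inequality with a constant of the same order \<open>\<Phi> \<delta>\<close>
(\<open>kernel_section_Bessel\<close>). Sampling \<open>T f\<close> on a fine grid and interpolating linearly reduces the
theorem to approximating the finitely many numbers \<open>inner (\<kappa> t\<^sub>i) f\<close>, uniformly in \<open>i\<close>, by an
\<open>n\<close>-dimensional space.

Linear approximation of \<open>\<kappa>\<close> by \<open>n\<close> vectors would only give the modulus of \<open>\<kappa>\<close>. The extra factor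
\<open>n\<^sup>-\<^sup>1\<^sup>/\<^sup>2\<close> comes from random subspaces. Let \<open>X\<close> be the absolutely convex hull of the vectors. By duality,
the error of approximation by the span of \<open>a\<^sub>1,\<dots>,a\<^sub>m\<close> is the largest norm of an element of \<open>X\<close> orthogonal to all
\<open>a\<^sub>i\<close> (\<open>approximation_duality\<close>). For independent sign vectors, symmetrization and contraction bound the
largest value over \<open>X\<close> of \<open>c * m * norm x - (\<Sum>i. \<bar>inner a\<^sub>i x\<bar>)\<close> by twice the mean of the largest
value of \<open>inner (\<Sum>i. a\<^sub>i) x\<close> (\<open>random_rows\<close>); for \<open>x\<close> orthogonal to all \<open>a\<^sub>i\<close> this bounds \<open>norm x\<close> by
\<open>m\<^sup>-\<^sup>1\<^sup>/\<^sup>2\<close> times the mean width of \<open>X\<close>. The width is estimated in two ways.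

For \<open>\<tau> < 1/2\<close> the energies at dyadic points decay geometrically, and it is enough to treat the increments of
each dyadic level separately, with Kashin's bound \<open>sqrt (ln (N / m) / m)\<close> for \<open>N\<close> almost orthogonal
vectors (\<open>kolmogorov_approx_Bessel\<close>); the dimensions of the levels decrease so slowly that the errors
still sum up. For \<open>\<tau> = 1/2\<close> the energies decay at most like a power of the level, and at \<open>\<beta> = 1\<close> all
levels contribute alike; distributing the dimensions among them would lose a power of the logarithm.
There one random subspace serves all levels, and the width is bounded by chaining along the grids of mesh
\<open>2\<^sup>-\<^sup>P\<close>, \<open>P = 2\<^sup>j\<close> (\<open>kolmogorov_approx_chaining\<close>). Grids with fewer than \<open>n\<close> points cause no error, since
the samples on them are reproduced exactly; this is why the sum over \<open>j\<close> starts at \<open>log log n\<close>, and its behaviour between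
\<open>log log n\<close> and \<open>log n\<close> produces the cases of the rate (\<open>critical_sums\<close>). Parameters with
\<open>\<tau> = 1/2\<close> outside the list are excluded by square integrability (\<open>critical_parameters\<close>).

Entropy numbers follow from the finite-dimensional approximations by Carl's telescoping argument
(\<open>covering_from_approximation\<close>), as the rates are doubling. It rests on the volumetric covering
bound for balls of finite-dimensional normed spaces, for which a packing argument without volumes is given
(\<open>card_separated_set\<close>).\<close>

section \<open>Averages over sign vectors\<close>

definition dot :: "'d set \<Rightarrow> ('d \<Rightarrow> real) \<Rightarrow> ('d \<Rightarrow> real) \<Rightarrow> real" where
  "dot D x y = (\<Sum>d\<in>D. x d * y d)"

text \<open>A sign vector is encoded by the set of indices at which it is \<open>1\<close>; averages over independent signs
become averages over \<open>Pow D\<close>.\<close>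

definition signs :: "'d set \<Rightarrow> 'd \<Rightarrow> real" where
  "signs S d = (if d \<in> S then 1 else - 1)"

definition sign_mean :: "'d set \<Rightarrow> ('d set \<Rightarrow> real) \<Rightarrow> real" where
  "sign_mean D F = (\<Sum>S\<in>Pow D. F S) / 2 ^ card D"

lemma sign_mean_mono:
  "finite D \<Longrightarrow> (\<And>S. S \<subseteq> D \<Longrightarrow> F S \<le> G S) \<Longrightarrow> sign_mean D F \<le> sign_mean D G"
  unfolding sign_mean_def by (intro divide_right_mono sum_mono) auto

lemma sign_mean_const [simp]: "finite D \<Longrightarrow> sign_mean D (\<lambda>S. c) = c"
  by (simp add: sign_mean_def card_Pow)

lemma sign_mean_add: "sign_mean D (\<lambda>S. F S + G S) = sign_mean D F + sign_mean D G"
  by (simp add: sign_mean_def sum.distrib add_divide_distrib)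

lemma sign_mean_cmult: "sign_mean D (\<lambda>S. c * F S) = c * sign_mean D F"
  by (simp add: sign_mean_def sum_distrib_left)

lemma sign_mean_cmult_right: "sign_mean D (\<lambda>S. F S * c) = sign_mean D F * c"
  by (simp add: sign_mean_def sum_distrib_right)

lemma sign_mean_sum: "sign_mean D (\<lambda>S. \<Sum>i\<in>I. F i S) = (\<Sum>i\<in>I. sign_mean D (F i))"
  by (simp add: sign_mean_def sum.swap[of _ I] sum_divide_distrib)

lemma sign_mean_insert:
  assumes "finite D" "b \<notin> D"
  shows "sign_mean (insert b D) F = (sign_mean D (\<lambda>S. F (insert b S)) + sign_mean D F) / 2"
proof -
  have "inj_on (insert b) (Pow D)"
    using assms by (intro inj_onI) (metis PowD insert_ident subsetD)
  moreover have "Pow D \<inter> insert b ` Pow D = {}"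
    using assms by auto
  ultimately have "(\<Sum>S\<in>Pow (insert b D). F S) = (\<Sum>S\<in>Pow D. F S) + (\<Sum>S\<in>Pow D. F (insert b S))"
    using assms by (simp add: Pow_insert sum.union_disjoint sum.reindex o_def)
  then show ?thesis
    using assms by (simp add: sign_mean_def add_divide_distrib)
qed

lemma sign_mean_complement:
  shows "sign_mean D (\<lambda>S. F (D - S)) = sign_mean D F"
proof -
  have "(\<Sum>S\<in>Pow D. F (D - S)) = (\<Sum>S\<in>Pow D. F S)"
    by (rule sum.reindex_bij_witness[of _ "\<lambda>S. D - S" "\<lambda>S. D - S"]) auto
  then show ?thesis by (simp add: sign_mean_def)
qed

lemma dot_sign_complement: "S \<subseteq> D \<Longrightarrow> dot D (signs (D - S)) x = - dot D (signs S) x"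
  unfolding dot_def sum_negf[symmetric] by (intro sum.cong) (auto simp: signs_def)

lemma dot_sign_insert:
  assumes "finite D" "b \<notin> D" "S \<subseteq> D"
  shows "dot (insert b D) (signs (insert b S)) x = x b + dot D (signs S) x"
    and "dot (insert b D) (signs S) x = - x b + dot D (signs S) x"
proof -
  have "(\<Sum>d\<in>D. signs (insert b S) d * x d) = (\<Sum>d\<in>D. signs S d * x d)"
    using assms by (intro sum.cong) (auto simp: signs_def)
  then show "dot (insert b D) (signs (insert b S)) x = x b + dot D (signs S) x"
    using assms by (simp add: dot_def) (simp add: signs_def)
  have "b \<notin> S" using assms by auto
  then show "dot (insert b D) (signs S) x = - x b + dot D (signs S) x"
    using assms by (simp add: dot_def) (simp add: signs_def)
qed

text \<open>Conditioning on the sign at one index; the moment bounds below are inductions over the index set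
with this step.\<close>

lemma sign_mean_insert_dot:
  assumes "finite D" "b \<notin> D"
  shows "sign_mean (insert b D) (\<lambda>S. f (dot (insert b D) (signs S) x)) =
    sign_mean D (\<lambda>S. (f (x b + dot D (signs S) x) + f (- x b + dot D (signs S) x)) / 2)"
proof -
  have "sign_mean D (\<lambda>S. f (dot (insert b D) (signs (insert b S)) x)) =
      sign_mean D (\<lambda>S. f (x b + dot D (signs S) x))"
    unfolding sign_mean_def by (intro arg_cong2[where f="(/)"] sum.cong) (auto simp: dot_sign_insert assms)
  moreover have "sign_mean D (\<lambda>S. f (dot (insert b D) (signs S) x)) =
      sign_mean D (\<lambda>S. f (- x b + dot D (signs S) x))"
    unfolding sign_mean_def by (intro arg_cong2[where f="(/)"] sum.cong) (auto simp: dot_sign_insert assms)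
  ultimately show ?thesis
    unfolding sign_mean_insert[OF assms]
    by (simp add: sign_mean_def sum.distrib sum_divide_distrib[symmetric] add_divide_distrib)
qed

lemma tanh_le_self: "0 \<le> x \<Longrightarrow> tanh x \<le> (x::real)"
proof -
  assume x: "0 \<le> x"
  have "(\<lambda>x. x - tanh x) 0 \<le> (\<lambda>x. x - tanh x) x"
  proof (rule DERIV_nonneg_imp_nondecreasing[OF x])
    fix y :: real
    have "((\<lambda>x. x - tanh x) has_real_derivative (1 - (1 - tanh y ^ 2))) (at y)"
      by (auto intro!: derivative_eq_intros)
    then show "\<exists>z. ((\<lambda>x. x - tanh x) has_real_derivative z) (at y) \<and> 0 \<le> z"
      by (intro exI[of _ "1 - (1 - tanh y ^ 2)"]) auto
  qed
  then show ?thesis by simp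
qed

lemma cosh_le_exp_square: "cosh x \<le> exp (x\<^sup>2 / 2)" for x :: real
proof -
  have "cosh x \<le> exp (x\<^sup>2 / 2)" if x: "0 \<le> x" for x :: real
  proof -
    have "(\<lambda>x. x\<^sup>2 / 2 - ln (cosh x)) 0 \<le> (\<lambda>x. x\<^sup>2 / 2 - ln (cosh x)) x"
    proof (rule DERIV_nonneg_imp_nondecreasing[OF x])
      fix y :: real assume y: "0 \<le> y"
      have "((\<lambda>x. x\<^sup>2 / 2 - ln (cosh x)) has_real_derivative (y - tanh y)) (at y)"
        by (auto intro!: derivative_eq_intros simp: tanh_def)
      then show "\<exists>z. ((\<lambda>x. x\<^sup>2 / 2 - ln (cosh x)) has_real_derivative z) (at y) \<and> 0 \<le> z"
        using tanh_le_self[OF y] by (intro exI[of _ "y - tanh y"]) auto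
    qed
    then have "ln (cosh x) \<le> x\<^sup>2 / 2" by simp
    then show ?thesis
      using cosh_real_pos[of x] by (metis exp_le_cancel_iff exp_ln)
  qed
  from this[of "\<bar>x\<bar>"] show ?thesis by simp
qed

lemma sign_mean_exp:
  assumes "finite D"
  shows "sign_mean D (\<lambda>S. exp (dot D (signs S) x)) \<le> exp (dot D x x / 2)"
  using assms
proof (induction D)
  case empty
  show ?case by (simp add: sign_mean_def dot_def)
next
  case (insert b D)
  have "sign_mean (insert b D) (\<lambda>S. exp (dot (insert b D) (signs S) x)) =
      sign_mean D (\<lambda>S. cosh (x b) * exp (dot D (signs S) x))"
  proof -
    have "(exp (x b + y) + exp (- x b + y)) / 2 = cosh (x b) * exp y" for y
      unfolding exp_add cosh_field_def by (simp add: distrib_right)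
    then show ?thesis
      by (simp only: sign_mean_insert_dot[OF insert.hyps(1,2), of exp])
  qed
  also have "\<dots> = cosh (x b) * sign_mean D (\<lambda>S. exp (dot D (signs S) x))"
    by (rule sign_mean_cmult)
  also have "\<dots> \<le> exp ((x b)\<^sup>2 / 2) * exp (dot D x x / 2)"
    by (rule mult_mono[OF cosh_le_exp_square insert.IH])
      (auto simp: sign_mean_def intro!: divide_nonneg_nonneg sum_nonneg)
  also have "\<dots> = exp (dot (insert b D) x x / 2)"
    using insert.hyps by (simp add: dot_def exp_add[symmetric] add_divide_distrib power2_eq_square)
  finally show ?case .
qed

lemma dot_self_nonneg [simp]: "0 \<le> dot D x x"
  by (simp add: dot_def sum_nonneg)

lemma sign_mean_square:
  assumes "finite D"
  shows "sign_mean D (\<lambda>S. (dot D (signs S) x)\<^sup>2) = dot D x x"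
  using assms
proof (induction D)
  case empty
  show ?case by (simp add: sign_mean_def dot_def)
next
  case (insert b D)
  have "sign_mean (insert b D) (\<lambda>S. (dot (insert b D) (signs S) x)\<^sup>2) =
      sign_mean D (\<lambda>S. (x b)\<^sup>2 + (dot D (signs S) x)\<^sup>2)"
    unfolding sign_mean_insert_dot[OF insert.hyps(1,2), of "\<lambda>y. y\<^sup>2"]
    by (simp add: power2_eq_square algebra_simps add_divide_distrib)
  also have "\<dots> = dot (insert b D) x x"
    using insert by (simp add: sign_mean_add dot_def power2_eq_square)
  finally show ?case .
qed

lemma sign_mean_fourth_power:
  assumes "finite D"
  shows "sign_mean D (\<lambda>S. (dot D (signs S) x) ^ 4) \<le> 3 * (dot D x x)\<^sup>2"
  using assms
proof (induction D)
  case empty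
  show ?case by (simp add: sign_mean_def dot_def)
next
  case (insert b D)
  have "sign_mean (insert b D) (\<lambda>S. (dot (insert b D) (signs S) x) ^ 4) =
      sign_mean D (\<lambda>S. (x b) ^ 4 + (6 * (x b)\<^sup>2 * (dot D (signs S) x)\<^sup>2 + (dot D (signs S) x) ^ 4))"
    unfolding sign_mean_insert_dot[OF insert.hyps(1,2), of "\<lambda>y. y ^ 4"]
    by (simp add: power2_eq_square power4_eq_xxxx algebra_simps add_divide_distrib)
  also have "\<dots> = (x b) ^ 4 + (6 * (x b)\<^sup>2 * dot D x x + sign_mean D (\<lambda>S. (dot D (signs S) x) ^ 4))"
    using insert.hyps by (simp add: sign_mean_add sign_mean_cmult sign_mean_square)
  also have "\<dots> \<le> 3 * (x b) ^ 4 + (6 * (x b)\<^sup>2 * dot D x x + 3 * (dot D x x)\<^sup>2)"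
    using insert.IH by (intro add_mono) auto
  also have "\<dots> = 3 * (dot (insert b D) x x)\<^sup>2"
    using insert.hyps
    by (simp add: dot_def[of "insert b D"]) (simp add: dot_def[symmetric] power2_eq_square power4_eq_xxxx algebra_simps)
  finally show ?case .
qed

text \<open>Khinchine's inequality in \<open>L\<^sub>1\<close>. The second and fourth moments suffice: with \<open>s\<close> the second moment's root,
\<open>\<bar>y\<bar>\<close> dominates a combination of \<open>y\<^sup>2\<close> and \<open>- y\<^sup>4\<close> whose mean is \<open>9/16 * s\<close>. The combination is chosen so that
the difference, in the variable \<open>z = \<bar>y\<bar> / s\<close>, has the double root \<open>z = 2\<close>.\<close>

lemma sign_mean_abs:
  assumes "finite D"
  shows "9 / 16 * sqrt (dot D x x) \<le> sign_mean D (\<lambda>S. \<bar>dot D (signs S) x\<bar>)"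
proof (cases "dot D x x = 0")
  case True
  then show ?thesis
    by (auto simp: sign_mean_def intro!: divide_nonneg_nonneg sum_nonneg)
next
  case False
  define s where "s = sqrt (dot D x x)"
  have s: "s > 0" "dot D x x = s\<^sup>2"
    using False by (auto simp: s_def less_le)
  have poly: "3 / 4 / s * y\<^sup>2 + (- 1 / (16 * s ^ 3)) * y ^ 4 \<le> \<bar>y\<bar>" for y
  proof -
    define z where "z = \<bar>y\<bar> / s"
    have z: "0 \<le> z" "\<bar>y\<bar> = s * z" using s by (auto simp: z_def)
    have "0 \<le> z * ((z - 2)\<^sup>2 * (z + 4)) / 16" using z by simp
    also have "\<dots> = z - (3 / 4 * z\<^sup>2 - z ^ 4 / 16)"
      by (simp add: power2_eq_square power4_eq_xxxx field_simps)
    finally have "s * (3 / 4 * z\<^sup>2 - z ^ 4 / 16) \<le> s * z"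
      using s by (intro mult_left_mono) auto
    moreover have "y\<^sup>2 = s\<^sup>2 * z\<^sup>2" "y ^ 4 = s ^ 4 * z ^ 4"
      using z(2) by (metis power2_abs power_mult_distrib, metis power_even_abs_numeral power_mult_distrib even_numeral)
    moreover have "3 / 4 / s * (s\<^sup>2 * z\<^sup>2) + (- 1 / (16 * s ^ 3)) * (s ^ 4 * z ^ 4) = s * (3 / 4 * z\<^sup>2 - z ^ 4 / 16)"
      using s by (simp add: field_simps power2_eq_square power3_eq_cube power4_eq_xxxx)
    ultimately show ?thesis
      using z(2) by simp
  qed
  have "9 / 16 * s = 3 / 4 / s * s\<^sup>2 + (- 1 / (16 * s ^ 3)) * (3 * (s\<^sup>2)\<^sup>2)"
    using s by (simp add: field_simps power2_eq_square power3_eq_cube)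
  also have "\<dots> \<le> 3 / 4 / s * sign_mean D (\<lambda>S. (dot D (signs S) x)\<^sup>2) +
      (- 1 / (16 * s ^ 3)) * sign_mean D (\<lambda>S. (dot D (signs S) x) ^ 4)"
    using sign_mean_fourth_power[OF assms, of x] s
    unfolding sign_mean_square[OF assms] s(2)
    by (intro add_left_mono mult_left_mono_neg) auto
  also have "\<dots> \<le> sign_mean D (\<lambda>S. \<bar>dot D (signs S) x\<bar>)"
    unfolding sign_mean_cmult[symmetric] sign_mean_add[symmetric]
    by (intro sign_mean_mono assms poly)
  finally show ?thesis unfolding s_def .
qed

section \<open>Symmetrization\<close>

lemma SUP_add_le:
  fixes f g :: "'a \<Rightarrow> real"
  assumes "K \<noteq> {}" "\<And>x y. x \<in> K \<Longrightarrow> y \<in> K \<Longrightarrow> f x + g y \<le> B"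
  shows "(SUP x\<in>K. f x) + (SUP y\<in>K. g y) \<le> B"
proof -
  have "(SUP x\<in>K. f x) \<le> B - (SUP y\<in>K. g y)"
  proof (rule cSUP_least[OF assms(1)])
    fix x assume x: "x \<in> K"
    have "(SUP y\<in>K. g y) \<le> B - f x"
      using assms(2)[OF x] by (intro cSUP_least[OF assms(1)]) (auto simp: algebra_simps)
    then show "f x \<le> B - (SUP y\<in>K. g y)" by simp
  qed
  then show ?thesis by simp
qed

text \<open>The contraction principle for a single sign: replacing \<open>Y\<close> by \<open>\<bar>Y\<bar>\<close> does not increase the
average over the two signs, since \<open>\<bar>Y x\<bar> - \<bar>Y z\<bar> \<le> \<bar>Y x - Y z\<bar>\<close> and the right-hand side is symmetric in
\<open>x\<close> and \<open>z\<close>.\<close>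

lemma contraction_one_sign:
  fixes G Y :: "'a \<Rightarrow> real"
  assumes "K \<noteq> {}" and bd: "bdd_above ((\<lambda>x. G x + Y x) ` K)" "bdd_above ((\<lambda>x. G x - Y x) ` K)"
  shows "(SUP x\<in>K. G x + \<bar>Y x\<bar>) + (SUP x\<in>K. G x - \<bar>Y x\<bar>)
    \<le> (SUP x\<in>K. G x + Y x) + (SUP x\<in>K. G x - Y x)"
proof (rule SUP_add_le[OF assms(1)])
  fix x z assume "x \<in> K" "z \<in> K"
  then have "G x + Y x \<le> (SUP x\<in>K. G x + Y x)" "G z + Y z \<le> (SUP x\<in>K. G x + Y x)"
    "G x - Y x \<le> (SUP x\<in>K. G x - Y x)" "G z - Y z \<le> (SUP x\<in>K. G x - Y x)"
    using bd by (auto intro!: cSUP_upper)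
  then show "G x + \<bar>Y x\<bar> + (G z - \<bar>Y z\<bar>) \<le> (SUP x\<in>K. G x + Y x) + (SUP x\<in>K. G x - Y x)"
    by linarith
qed

lemma abs_dot_sign_le:
  fixes R :: real
  assumes "finite D" "\<And>d. d \<in> D \<Longrightarrow> \<bar>x d\<bar> \<le> R"
  shows "\<bar>dot D (signs S) x\<bar> \<le> card D * R"
proof -
  have "\<bar>dot D (signs S) x\<bar> \<le> (\<Sum>d\<in>D. \<bar>signs S d * x d\<bar>)"
    unfolding dot_def by (rule sum_abs)
  also have "\<dots> \<le> (\<Sum>d\<in>D. R)"
    using assms by (intro sum_mono) (auto simp: signs_def abs_mult)
  finally show ?thesis by simp
qed

text \<open>The mean of \<open>\<bar>dot D (signs S) x\<bar>\<close> is replaced by an independent copy, the supremum of the sum is split into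
two halves, and the two halves together are one average over an additional sign, to which the contraction
principle applies. That the additional sign disappears again is the symmetry \<open>S \<mapsto> D - S\<close>. The term
\<open>G\<close> carries the other rows, so that they can be processed one at a time.\<close>

lemma symmetrization_one_row:
  assumes D: "finite D" and K: "K \<noteq> {}" "\<And>x d. x \<in> K \<Longrightarrow> d \<in> D \<Longrightarrow> \<bar>x d\<bar> \<le> R"
    and G: "\<And>x. x \<in> K \<Longrightarrow> G x \<le> R'"
  shows "sign_mean D (\<lambda>S. SUP x\<in>K. G x + (sign_mean D (\<lambda>S. \<bar>dot D (signs S) x\<bar>) - \<bar>dot D (signs S) x\<bar>))
    \<le> sign_mean D (\<lambda>S. SUP x\<in>K. G x + 2 * dot D (signs S) x)"
proof -
  have bound: "\<bar>dot D (signs S) x\<bar> \<le> card D * R" if "x \<in> K" for S x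
    using abs_dot_sign_le[OF D K(2)[OF that]] .
  have bdd: "bdd_above ((\<lambda>x. G x + c * \<bar>dot D (signs S) x\<bar>) ` K)"
    "bdd_above ((\<lambda>x. G x + c * dot D (signs S) x) ` K)" for c S
  proof -
    have "G x + c * \<bar>dot D (signs S) x\<bar> \<le> R' + \<bar>c\<bar> * (card D * R)"
      "G x + c * dot D (signs S) x \<le> R' + \<bar>c\<bar> * (card D * R)" if x: "x \<in> K" for x
    proof -
      have "\<bar>c * \<bar>dot D (signs S) x\<bar>\<bar> \<le> \<bar>c\<bar> * (card D * R)" "\<bar>c * dot D (signs S) x\<bar> \<le> \<bar>c\<bar> * (card D * R)"
        using bound[OF x, of S] by (auto simp: abs_mult intro!: mult_left_mono)
      then show "G x + c * \<bar>dot D (signs S) x\<bar> \<le> R' + \<bar>c\<bar> * (card D * R)"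
        "G x + c * dot D (signs S) x \<le> R' + \<bar>c\<bar> * (card D * R)"
        using G[OF x] by (auto dest!: abs_le_D1 intro!: add_mono)
    qed
    then show "bdd_above ((\<lambda>x. G x + c * \<bar>dot D (signs S) x\<bar>) ` K)"
      "bdd_above ((\<lambda>x. G x + c * dot D (signs S) x) ` K)"
      by (auto intro!: bdd_aboveI2)
  qed
  define P where "P S = (SUP x\<in>K. G x + 2 * \<bar>dot D (signs S) x\<bar>)" for S
  define N where "N S = (SUP x\<in>K. G x + (- 2) * \<bar>dot D (signs S) x\<bar>)" for S
  define Q where "Q S = (SUP x\<in>K. G x + 2 * dot D (signs S) x)" for S
  define Q' where "Q' S = (SUP x\<in>K. G x + (- 2) * dot D (signs S) x)" for S
  have *: "(SUP x\<in>K. G x + (sign_mean D (\<lambda>S. \<bar>dot D (signs S) x\<bar>) - \<bar>dot D (signs S) x\<bar>))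
      \<le> 1 / 2 * N S + 1 / 2 * sign_mean D P" for S
  proof (rule cSUP_least[OF K(1)])
    fix x assume x: "x \<in> K"
    have "G x + 2 * sign_mean D (\<lambda>S. \<bar>dot D (signs S) x\<bar>) =
        sign_mean D (\<lambda>S. G x + 2 * \<bar>dot D (signs S) x\<bar>)"
      by (simp add: sign_mean_add sign_mean_cmult D)
    also have "\<dots> \<le> sign_mean D P"
      unfolding P_def by (intro sign_mean_mono D cSUP_upper x bdd)
    finally have "G x + 2 * sign_mean D (\<lambda>S. \<bar>dot D (signs S) x\<bar>) \<le> sign_mean D P" .
    moreover have "G x + (- 2) * \<bar>dot D (signs S) x\<bar> \<le> N S"
      unfolding N_def by (intro cSUP_upper x bdd)
    ultimately show "G x + (sign_mean D (\<lambda>S. \<bar>dot D (signs S) x\<bar>) - \<bar>dot D (signs S) x\<bar>)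
        \<le> 1 / 2 * N S + 1 / 2 * sign_mean D P" by simp
  qed
  have PN: "P S + N S \<le> Q S + Q' S" for S
    using contraction_one_sign[OF K(1), of G "\<lambda>x. 2 * dot D (signs S) x"] bdd[of 2 S] bdd[of "-2" S]
    by (simp add: P_def N_def Q_def Q'_def abs_mult)
  have Q': "sign_mean D Q' = sign_mean D Q"
  proof -
    have "sign_mean D Q' = sign_mean D (\<lambda>S. Q (D - S))"
      unfolding sign_mean_def by (intro arg_cong2[where f="(/)"] sum.cong)
        (auto simp: Q'_def Q_def dot_sign_complement)
    then show ?thesis by (simp add: sign_mean_complement)
  qed
  have "sign_mean D (\<lambda>S. SUP x\<in>K. G x + (sign_mean D (\<lambda>S. \<bar>dot D (signs S) x\<bar>) - \<bar>dot D (signs S) x\<bar>))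
      \<le> sign_mean D (\<lambda>S. 1 / 2 * N S + 1 / 2 * sign_mean D P)"
    by (rule sign_mean_mono[OF D *])
  also have "\<dots> = 1 / 2 * sign_mean D (\<lambda>S. P S + N S)"
    by (simp add: sign_mean_add sign_mean_cmult D distrib_left del: times_divide_eq_left)
  also have "\<dots> \<le> 1 / 2 * sign_mean D (\<lambda>S. Q S + Q' S)"
    using sign_mean_mono[OF D PN] by simp
  also have "\<dots> = sign_mean D Q"
    by (simp add: sign_mean_add Q')
  finally show ?thesis unfolding Q_def .
qed

text \<open>Means over \<open>m\<close> independent sign vectors, the rows of a random matrix.\<close>

fun rows_mean :: "'d set \<Rightarrow> nat \<Rightarrow> ('d set list \<Rightarrow> real) \<Rightarrow> real" where
  "rows_mean D 0 F = F []"
| "rows_mean D (Suc m) F = sign_mean D (\<lambda>S. rows_mean D m (\<lambda>l. F (S # l)))"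

lemma rows_mean_mono:
  assumes "finite D" "\<And>l. length l = m \<Longrightarrow> F l \<le> G l"
  shows "rows_mean D m F \<le> rows_mean D m G"
  using assms(2)
proof (induction m arbitrary: F G)
  case (Suc m)
  show ?case
    unfolding rows_mean.simps by (rule sign_mean_mono[OF assms(1)], rule Suc.IH, rule Suc.prems) simp
qed simp

lemma rows_mean_const [simp]: "finite D \<Longrightarrow> rows_mean D m (\<lambda>l. c) = c"
  by (induction m) auto

lemma rows_mean_add: "rows_mean D m (\<lambda>l. F l + G l) = rows_mean D m F + rows_mean D m G"
  by (induction m arbitrary: F G) (auto simp: sign_mean_add)

lemma rows_mean_cmult: "rows_mean D m (\<lambda>l. c * F l) = c * rows_mean D m F"
  by (induction m arbitrary: F) (auto simp: sign_mean_cmult)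

lemma rows_mean_sum: "rows_mean D m (\<lambda>l. \<Sum>i\<in>I. F i l) = (\<Sum>i\<in>I. rows_mean D m (F i))"
  by (induction m arbitrary: F) (auto simp: sign_mean_sum)

lemma rows_mean_sign_mean:
  "rows_mean D m (\<lambda>l. sign_mean D (\<lambda>S. F S l)) = sign_mean D (\<lambda>S. rows_mean D m (F S))"
  using rows_mean_cmult[of D m "inverse (2 ^ card D)"]
  by (simp add: sign_mean_def divide_inverse_commute rows_mean_sum)

lemma rows_mean_exists:
  assumes "finite D"
  shows "\<exists>l. length l = m \<and> F l \<le> rows_mean D m F"
proof (rule ccontr)
  assume "\<not> ?thesis"
  then have *: "length l = m \<Longrightarrow> rows_mean D m F < F l" for l
    by (auto simp: not_le)
  show False
    using *
  proof (induction m arbitrary: F)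
    case 0
    then show ?case by (metis list.size(3) order_less_irrefl rows_mean.simps(1))
  next
    case (Suc m)
    have ex: "\<exists>S\<in>Pow D. H S \<le> sign_mean D H" for H
    proof (rule ccontr)
      assume "\<not> ?thesis"
      then have "\<And>S. S \<in> Pow D \<Longrightarrow> sign_mean D H < H S" by (auto simp: not_le)
      then have "(\<Sum>S\<in>Pow D. sign_mean D H) < (\<Sum>S\<in>Pow D. H S)"
        using assms by (intro sum_strict_mono) auto
      then show False using assms by (simp add: sign_mean_def card_Pow)
    qed
    obtain S where "rows_mean D m (\<lambda>l. F (S # l)) \<le> rows_mean D (Suc m) F"
      using ex[of "\<lambda>S. rows_mean D m (\<lambda>l. F (S # l))"] by auto
    with Suc show False
      by (metis length_Cons order_le_less_trans)
  qed
qed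

lemma rows_mean_exp:
  assumes "finite D"
  shows "rows_mean D m (\<lambda>l. exp (\<Sum>S\<leftarrow>l. dot D (signs S) x)) \<le> exp (m * (dot D x x / 2))"
proof (induction m)
  case (Suc m)
  have "rows_mean D (Suc m) (\<lambda>l. exp (\<Sum>S\<leftarrow>l. dot D (signs S) x)) =
      rows_mean D m (\<lambda>l. exp (\<Sum>S\<leftarrow>l. dot D (signs S) x)) * sign_mean D (\<lambda>S. exp (dot D (signs S) x))"
    by (simp add: exp_add rows_mean_cmult sign_mean_cmult_right mult.commute)
  also have "\<dots> \<le> exp (m * (dot D x x / 2)) * exp (dot D x x / 2)"
    using Suc sign_mean_exp[OF assms, of x]
    by (intro mult_mono) (auto simp: sign_mean_def intro!: divide_nonneg_nonneg sum_nonneg)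
  also have "\<dots> = exp (Suc m * (dot D x x / 2))"
    by (simp add: exp_add[symmetric] algebra_simps add_divide_distrib)
  finally show ?case .
qed auto

lemma symmetrization:
  assumes D: "finite D" and K: "K \<noteq> {}" "\<And>x d. x \<in> K \<Longrightarrow> d \<in> D \<Longrightarrow> \<bar>x d\<bar> \<le> R"
    and G: "\<And>x. x \<in> K \<Longrightarrow> G x \<le> R'"
  defines "\<mu> \<equiv> \<lambda>x. sign_mean D (\<lambda>S. \<bar>dot D (signs S) x\<bar>)"
  shows "rows_mean D m (\<lambda>l. SUP x\<in>K. G x + (\<Sum>S\<leftarrow>l. \<mu> x - \<bar>dot D (signs S) x\<bar>))
    \<le> rows_mean D m (\<lambda>l. SUP x\<in>K. G x + 2 * (\<Sum>S\<leftarrow>l. dot D (signs S) x))"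
  using G
proof (induction m arbitrary: G R')
  case (Suc m)
  have bound: "\<bar>dot D (signs S) x\<bar> \<le> card D * R" if "x \<in> K" for S x
    using abs_dot_sign_le[OF D K(2)[OF that]] .
  have \<mu>: "\<mu> x \<le> card D * R" if "x \<in> K" for x
    using sign_mean_mono[OF D bound[OF that]] D by (simp add: \<mu>_def)
  have lbound: "(\<Sum>S\<leftarrow>l. dot D (signs S) x) \<le> length l * (card D * R)" if "x \<in> K" for l x
  proof (induction l)
    case (Cons S l)
    then show ?case using bound[OF that, of S] by (simp add: algebra_simps) 
  qed auto
  have "rows_mean D (Suc m) (\<lambda>l. SUP x\<in>K. G x + (\<Sum>S\<leftarrow>l. \<mu> x - \<bar>dot D (signs S) x\<bar>)) =
      sign_mean D (\<lambda>S. rows_mean D m (\<lambda>l. SUP x\<in>K. (G x + (\<mu> x - \<bar>dot D (signs S) x\<bar>))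
        + (\<Sum>S\<leftarrow>l. \<mu> x - \<bar>dot D (signs S) x\<bar>)))"
    by (simp add: add.assoc)
  also have "\<dots> \<le> sign_mean D (\<lambda>S. rows_mean D m (\<lambda>l. SUP x\<in>K. (G x + (\<mu> x - \<bar>dot D (signs S) x\<bar>))
        + 2 * (\<Sum>S\<leftarrow>l. dot D (signs S) x)))"
  proof (intro sign_mean_mono[OF D] Suc.IH)
    fix S x assume "x \<in> K"
    then show "G x + (\<mu> x - \<bar>dot D (signs S) x\<bar>) \<le> R' + card D * R"
      using Suc.prems[of x] \<mu>[of x] by linarith
  qed
  also have "\<dots> = rows_mean D m (\<lambda>l. sign_mean D (\<lambda>S. SUP x\<in>K.
      (G x + 2 * (\<Sum>S\<leftarrow>l. dot D (signs S) x)) + (\<mu> x - \<bar>dot D (signs S) x\<bar>)))"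
    unfolding rows_mean_sign_mean[symmetric] by (simp only: ac_simps)
  also have "\<dots> \<le> rows_mean D m (\<lambda>l. sign_mean D (\<lambda>S. SUP x\<in>K.
      (G x + 2 * (\<Sum>S\<leftarrow>l. dot D (signs S) x)) + 2 * dot D (signs S) x))"
  proof (intro rows_mean_mono[OF D], unfold \<mu>_def, rule symmetrization_one_row[OF D K(1)])
    show "\<bar>x d\<bar> \<le> R" if "x \<in> K" "d \<in> D" for x d
      using K(2) that .
    fix l :: "'a set list" and x assume "x \<in> K"
    then show "G x + 2 * (\<Sum>S\<leftarrow>l. dot D (signs S) x) \<le> R' + 2 * (length l * (card D * R))"
      using Suc.prems[of x] lbound[of x l] by linarith
  qed
  also have "\<dots> = rows_mean D (Suc m) (\<lambda>l. SUP x\<in>K. G x + 2 * (\<Sum>S\<leftarrow>l. dot D (signs S) x))"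
    unfolding rows_mean_sign_mean by (simp add: algebra_simps)
  finally show ?case .
qed auto

text \<open>A lower estimate for random sections: if the rows of some \<open>m \<times> D\<close> sign matrix are orthogonal to
\<open>x \<in> K\<close>, the norm of \<open>x\<close> is controlled by the mean width of \<open>K\<close>, of which \<open>Q\<close> is a bound.
Symmetrization bounds the mean of the largest deficit on the right-hand side, so the bound holds for at
least one matrix.\<close>

lemma random_rows:
  assumes D: "finite D" and K: "\<And>x d. x \<in> K \<Longrightarrow> d \<in> D \<Longrightarrow> \<bar>x d\<bar> \<le> R"
    and Q: "\<And>l x. x \<in> K \<Longrightarrow> (\<Sum>S\<leftarrow>l. dot D (signs S) x) \<le> Q l"
  shows "\<exists>l. length l = m \<and> (\<forall>x\<in>K. 9 / 16 * m * sqrt (dot D x x)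
    \<le> (\<Sum>S\<leftarrow>l. \<bar>dot D (signs S) x\<bar>) + 2 * rows_mean D m Q)"
proof (cases "K = {}")
  case True
  then show ?thesis by (auto intro!: exI[of _ "replicate m {}"])
next
  case False
  define \<mu> where "\<mu> x = sign_mean D (\<lambda>S. \<bar>dot D (signs S) x\<bar>)" for x
  define H where "H l = (SUP x\<in>K. 0 + (\<Sum>S\<leftarrow>l. \<mu> x - \<bar>dot D (signs S) x\<bar>))" for l
  obtain l where l: "length l = m" "H l \<le> rows_mean D m H"
    using rows_mean_exists[OF D] by blast
  note l(2)
  also have "rows_mean D m H \<le> rows_mean D m (\<lambda>l. SUP x\<in>K. 0 + 2 * (\<Sum>S\<leftarrow>l. dot D (signs S) x))"
    unfolding H_def \<mu>_def
    by (rule symmetrization[where R=R and R'=0, OF D False]) (auto simp: K)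
  also have "\<dots> \<le> rows_mean D m (\<lambda>l. 2 * Q l)"
    using Q by (intro rows_mean_mono[OF D] cSUP_least False) auto
  also have "\<dots> = 2 * rows_mean D m Q" by (rule rows_mean_cmult)
  finally have H: "H l \<le> 2 * rows_mean D m Q" .
  have bound: "\<bar>dot D (signs S) x\<bar> \<le> card D * R" if "x \<in> K" for S x
    using abs_dot_sign_le[OF D K[OF that]] .
  have \<mu>: "\<mu> x \<le> card D * R" if "x \<in> K" for x
    using sign_mean_mono[OF D bound[OF that]] D by (simp add: \<mu>_def)
  have bdd: "bdd_above ((\<lambda>x. 0 + (\<Sum>S\<leftarrow>l. \<mu> x - \<bar>dot D (signs S) x\<bar>)) ` K)" for l
  proof (rule bdd_aboveI2)
    fix x assume x: "x \<in> K"
    show "0 + (\<Sum>S\<leftarrow>l. \<mu> x - \<bar>dot D (signs S) x\<bar>) \<le> length l * (card D * R)"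
    proof (induction l)
      case (Cons S l)
      have "\<mu> x - \<bar>dot D (signs S) x\<bar> \<le> card D * R" using \<mu>[OF x] by linarith
      with Cons show ?case by (simp add: algebra_simps)
    qed auto
  qed
  have "9 / 16 * m * sqrt (dot D x x) \<le> (\<Sum>S\<leftarrow>l. \<bar>dot D (signs S) x\<bar>) + 2 * rows_mean D m Q"
    if x: "x \<in> K" for x
  proof -
    have "(\<Sum>S\<leftarrow>l. \<mu> x - \<bar>dot D (signs S) x\<bar>) = m * \<mu> x - (\<Sum>S\<leftarrow>l. \<bar>dot D (signs S) x\<bar>)"
      by (simp add: sum_list_subtractf sum_list_const_mult[symmetric] l(1)[symmetric])
        (simp add: sum_list_triv)
    moreover have "0 + (\<Sum>S\<leftarrow>l. \<mu> x - \<bar>dot D (signs S) x\<bar>) \<le> H l"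
      unfolding H_def by (rule cSUP_upper[OF x bdd])
    moreover have "m * (9 / 16 * sqrt (dot D x x)) \<le> m * \<mu> x"
      unfolding \<mu>_def by (intro mult_left_mono sign_mean_abs D) auto
    ultimately show ?thesis using H by simp
  qed
  with l(1) show ?thesis by blast
qed

section \<open>Duality\<close>

text \<open>Vectors are coordinate functions, because the dimension is a parameter of the argument and not a
type.\<close>

definition sublinear :: "(('d \<Rightarrow> real) \<Rightarrow> real) \<Rightarrow> bool" where
  "sublinear p \<longleftrightarrow> (\<forall>x y. p (\<lambda>d. x d + y d) \<le> p x + p y) \<and>
     (\<forall>x. \<forall>c\<ge>0. p (\<lambda>d. c * x d) = c * p x)"

lemma sublinearD:
  assumes "sublinear p"
  shows "p (\<lambda>d. x d + y d) \<le> p x + p y" "0 \<le> c \<Longrightarrow> p (\<lambda>d. c * x d) = c * p x"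
    "p (\<lambda>d. 0) = 0" "0 \<le> p x + p (\<lambda>d. - x d)"
proof -
  show "p (\<lambda>d. x d + y d) \<le> p x + p y" "0 \<le> c \<Longrightarrow> p (\<lambda>d. c * x d) = c * p x" for x y c
    using assms by (auto simp: sublinear_def)
  from this(2)[of 0] show zero: "p (\<lambda>d. 0) = 0" by simp
  show "0 \<le> p x + p (\<lambda>d. - x d)"
    using assms zero unfolding sublinear_def by (metis (no_types, lifting) add.right_inverse ext)
qed

lemma sublinearI:
  assumes add: "\<And>x y. p (\<lambda>d. x d + y d) \<le> p x + p y"
    and le: "\<And>x c. 0 < c \<Longrightarrow> p (\<lambda>d. c * x d) \<le> c * p x"
    and zero: "p (\<lambda>d. 0) = 0"
  shows "sublinear p"
  unfolding sublinear_def
proof (intro conjI allI impI add)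
  fix x and c :: real assume "0 \<le> c"
  then consider "c = 0" | "0 < c" by linarith
  then show "p (\<lambda>d. c * x d) = c * p x"
  proof cases
    case 2
    have "p x = p (\<lambda>d. inverse c * (c * x d))"
      using 2 by (simp add: mult.assoc[symmetric])
    also have "\<dots> \<le> inverse c * p (\<lambda>d. c * x d)"
      using 2 by (intro le) simp
    finally have "c * p x \<le> p (\<lambda>d. c * x d)"
      using 2 by (simp add: field_simps)
    with le[OF 2, of x] show ?thesis by simp
  qed (simp add: zero)
qed

lemma INF_add_ge:
  fixes f g :: "'a \<Rightarrow> real"
  assumes "A \<noteq> {}" "\<And>x y. x \<in> A \<Longrightarrow> y \<in> A \<Longrightarrow> B \<le> f x + g y"
  shows "B \<le> (INF x\<in>A. f x) + (INF y\<in>A. g y)"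
proof -
  have "B - (INF y\<in>A. g y) \<le> (INF x\<in>A. f x)"
  proof (rule cINF_greatest[OF assms(1)])
    fix x assume x: "x \<in> A"
    have "B - f x \<le> (INF y\<in>A. g y)"
      using assms(2)[OF x] by (intro cINF_greatest[OF assms(1)]) (auto simp: algebra_simps)
    then show "B - (INF y\<in>A. g y) \<le> f x" by simp
  qed
  then show ?thesis by simp
qed

text \<open>The Hahn-Banach step without subspaces: the largest sublinear \<open>q \<le> p\<close> that is linear along \<open>v\<close> with
\<open>q (- v) = - p v\<close>.\<close>

lemma sublinear_reduce:
  assumes p: "sublinear p"
  shows "\<exists>q. sublinear q \<and> (\<forall>x. q x \<le> p x) \<and> q (\<lambda>d. - v d) \<le> - p v"
proof -
  define F where "F y a = p (\<lambda>d. y d + a * v d) - a * p v" for y a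
  define q where "q y = (INF a\<in>{0..}. F y a)" for y
  note p1 = sublinearD(1)[OF p] and p2 = sublinearD(2)[OF p]
  have lower: "- p (\<lambda>d. - y d) \<le> F y a" if "0 \<le> a" for y a
    using p1[of "\<lambda>d. y d + a * v d" "\<lambda>d. - y d"] p2[OF that, of v] by (simp add: F_def)
  have bdd: "bdd_below (F y ` {0..})" for y
    by (rule bdd_belowI2[where m="- p (\<lambda>d. - y d)"]) (simp add: lower)
  have le: "q y \<le> F y a" if "0 \<le> a" for y a
    unfolding q_def using that by (intro cINF_lower bdd) auto
  have qp: "q y \<le> p y" for y
    using le[of 0 y] by (simp add: F_def)
  have "sublinear q"
  proof (rule sublinearI)
    show "q (\<lambda>d. x d + y d) \<le> q x + q y" for x y
      unfolding q_def[of x] q_def[of y]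
    proof (rule INF_add_ge)
      fix a b :: real assume ab: "a \<in> {0..}" "b \<in> {0..}"
      then have "q (\<lambda>d. x d + y d) \<le> F (\<lambda>d. x d + y d) (a + b)" by (intro le) auto
      also have "\<dots> \<le> F x a + F y b"
        using p1[of "\<lambda>d. x d + a * v d" "\<lambda>d. y d + b * v d"] by (simp add: F_def algebra_simps)
      finally show "q (\<lambda>d. x d + y d) \<le> F x a + F y b" .
    qed simp
    show "q (\<lambda>d. c * x d) \<le> c * q x" if c: "0 < c" for x c
    proof -
      have "q (\<lambda>d. c * x d) / c \<le> q x"
        unfolding q_def[of x]
      proof (rule cINF_greatest)
        fix a :: real assume a: "a \<in> {0..}"
        then have "q (\<lambda>d. c * x d) \<le> F (\<lambda>d. c * x d) (c * a)" using c by (intro le) auto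
        also have "\<dots> = c * F x a"
          using p2[of c "\<lambda>d. x d + a * v d"] c by (simp add: F_def algebra_simps)
        finally show "q (\<lambda>d. c * x d) / c \<le> F x a" using c by (simp add: field_simps)
      qed simp
      then show ?thesis using c by (simp add: field_simps)
    qed
    show "q (\<lambda>d. 0) = 0"
    proof (rule antisym)
      show "q (\<lambda>d. 0) \<le> 0" using qp[of "\<lambda>d. 0"] sublinearD(3)[OF p] by simp
      show "0 \<le> q (\<lambda>d. 0)" unfolding q_def
        using lower[of _ "\<lambda>d. 0"] sublinearD(3)[OF p] by (intro cINF_greatest) auto
    qed
  qed
  moreover have "q (\<lambda>d. - v d) \<le> - p v"
    using le[of 1 "\<lambda>d. - v d"] sublinearD(3)[OF p] by (simp add: F_def)
  ultimately show ?thesis using qp by blast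
qed

text \<open>Linearity along a direction survives any further reduction, since it is an upper bound on the value at
\<open>- v\<close>; so it can be enforced for finitely many directions in turn.\<close>

lemma sublinear_reduce_finite:
  assumes "finite B" "sublinear p"
  shows "\<exists>q. sublinear q \<and> (\<forall>x. q x \<le> p x) \<and> (\<forall>v\<in>B. q (\<lambda>d. - v d) \<le> - q v)"
  using assms(1)
proof (induction B)
  case empty
  show ?case using assms(2) by auto
next
  case (insert v B)
  then obtain q where q: "sublinear q" "\<And>x. q x \<le> p x" "\<And>v. v \<in> B \<Longrightarrow> q (\<lambda>d. - v d) \<le> - q v"
    by blast
  obtain r where r: "sublinear r" "\<And>x. r x \<le> q x" "r (\<lambda>d. - v d) \<le> - q v"
    using sublinear_reduce[OF q(1)] by blast
  have "r (\<lambda>d. - u d) \<le> - r u" if "u \<in> insert v B" for u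
  proof -
    have "r (\<lambda>d. - u d) \<le> - q u"
      using that q(3)[of u] r(2)[of "\<lambda>d. - u d"] r(3) by fastforce
    then show ?thesis using r(2)[of u] by linarith
  qed
  then show ?case using r(1,2) q(2) by (meson order_trans)
qed

text \<open>The functional norming \<open>f\<close>: reduce \<open>p\<close> first along \<open>f\<close> and then along the unit vectors; the result is
linear on the coordinates in \<open>D\<close> and its values at the unit vectors are the coordinates of \<open>x\<close>.\<close>

lemma dual_functional:
  fixes p :: "('d \<Rightarrow> real) \<Rightarrow> real"
  assumes D: "finite D" and p: "sublinear p"
    and dep: "\<And>h h'. (\<And>d. d \<in> D \<Longrightarrow> h d = h' d) \<Longrightarrow> p h = p h'"
  shows "\<exists>x. (\<forall>h. dot D x h \<le> p h) \<and> p f \<le> dot D x f"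
proof -
  define e where "e d = (\<lambda>d'. if d' = d then 1 else (0::real))" for d :: 'd
  obtain r where r: "sublinear r" "\<And>x. r x \<le> p x" "r (\<lambda>d. - f d) \<le> - p f"
    using sublinear_reduce[OF p] by blast
  obtain q where q: "sublinear q" "\<And>x. q x \<le> r x" "\<And>v. v \<in> e ` D \<Longrightarrow> q (\<lambda>d. - v d) \<le> - q v"
    using sublinear_reduce_finite[OF finite_imageI[OF D] r(1)] by blast
  have lin: "q (\<lambda>d'. c * e d d') = c * q (e d)" if "d \<in> D" for c d
  proof (cases "0 \<le> c")
    case True
    then show ?thesis using sublinearD(2)[OF q(1)] by blast
  next
    case False
    then have "q (\<lambda>d'. (- c) * (- e d d')) = (- c) * q (\<lambda>d'. - e d d')"
      by (intro sublinearD(2)[OF q(1)]) auto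
    moreover have "q (\<lambda>d'. - e d d') = - q (e d)"
      using q(3)[of "e d"] that sublinearD(4)[OF q(1), of "e d"] by force
    ultimately show ?thesis by simp
  qed
  have sum_le: "q (\<lambda>d'. \<Sum>d\<in>E. h d * e d d') \<le> (\<Sum>d\<in>E. h d * q (e d))" if "E \<subseteq> D" for E h
    using finite_subset[OF that D] that
  proof (induction E)
    case empty
    then show ?case using sublinearD(3)[OF q(1)] by simp
  next
    case (insert b E)
    then show ?case
      using sublinearD(1)[OF q(1), of "\<lambda>d'. h b * e b d'" "\<lambda>d'. \<Sum>d\<in>E. h d * e d d'"] lin[of b "h b"]
      by simp
  qed
  define x where "x d = q (e d)" for d
  have coord: "(\<Sum>d\<in>D. h d * e d d') = h d'" if "d' \<in> D" for h d'
    using D that by (simp add: e_def if_distrib[of "\<lambda>z. _ * z"] sum.delta cong: if_cong)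
  have upper: "q (\<lambda>d'. \<Sum>d\<in>D. h d * e d d') \<le> dot D x h" for h
    using sum_le[OF order_refl, of h] by (simp add: dot_def x_def mult.commute)
  have "dot D x h \<le> p h" for h
  proof -
    have "q (\<lambda>d'. - (\<Sum>d\<in>D. h d * e d d')) \<le> - dot D x h"
      using upper[of "\<lambda>d. - h d"] by (simp add: dot_def sum_negf)
    then have "dot D x h \<le> q (\<lambda>d'. \<Sum>d\<in>D. h d * e d d')"
      using sublinearD(4)[OF q(1), of "\<lambda>d'. \<Sum>d\<in>D. h d * e d d'"] by linarith
    also have "\<dots> \<le> p (\<lambda>d'. \<Sum>d\<in>D. h d * e d d')"
      using q(2) r(2) by (meson order_trans)
    also have "\<dots> = p h" by (rule dep) (rule coord)
    finally show ?thesis .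
  qed
  moreover have "p f \<le> dot D x f"
  proof -
    define f' where "f' d' = (\<Sum>d\<in>D. f d * e d d')" for d'
    define g where "g d = f d - f' d" for d
    have "p (\<lambda>d. - g d) = p (\<lambda>d. 0)" by (rule dep) (simp add: g_def f'_def coord)
    then have "q (\<lambda>d. - g d) \<le> 0"
      using q(2)[of "\<lambda>d. - g d"] r(2)[of "\<lambda>d. - g d"] sublinearD(3)[OF p] by linarith
    have "- q (\<lambda>d. - f d) \<ge> p f"
      using q(2)[of "\<lambda>d. - f d"] r(3) by linarith
    moreover have "q (\<lambda>d. - f d) \<ge> - q f'- q g"
    proof -
      have "q (\<lambda>d. (- f d) + (f' d + g d)) \<le> q (\<lambda>d. - f d) + q (\<lambda>d. f' d + g d)"
        by (rule sublinearD(1)[OF q(1)])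
      moreover have "q (\<lambda>d. f' d + g d) \<le> q f' + q g" by (rule sublinearD(1)[OF q(1)])
      ultimately show ?thesis using sublinearD(3)[OF q(1)] by (simp add: g_def)
    qed
    moreover have "q g \<le> 0"
    proof -
      have "p g = p (\<lambda>d. 0)" by (rule dep) (simp add: g_def f'_def coord)
      then show ?thesis using q(2)[of g] r(2)[of g] sublinearD(3)[OF p] by linarith
    qed
    moreover have "q f' \<le> dot D x f" using upper[of f] by (simp add: f'_def[abs_def])
    ultimately show ?thesis by linarith
  qed
  ultimately show ?thesis by blast
qed

lemma dot_cmult [simp]: "dot D (\<lambda>d. c * x d) y = c * dot D x y" "dot D x (\<lambda>d. c * y d) = c * dot D x y"
  by (simp_all add: dot_def sum_distrib_left ac_simps)

lemma dot_commute: "dot D x y = dot D y x"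
  by (simp add: dot_def mult.commute)

lemma dot_Cauchy_Schwarz: "dot D x y \<le> sqrt (dot D x x) * sqrt (dot D y y)"
proof -
  have "dot D x y \<le> \<bar>dot D x y\<bar>" by simp
  also have "\<dots> \<le> (\<Sum>d\<in>D. \<bar>x d\<bar> * \<bar>y d\<bar>)"
    unfolding dot_def using sum_abs[of "\<lambda>d. x d * y d" D] by (simp add: abs_mult)
  also have "\<dots> \<le> L2_set x D * L2_set y D" by (rule L2_set_mult_ineq)
  finally show ?thesis by (simp add: L2_set_def dot_def power2_eq_square)
qed

text \<open>The distance in \<open>p\<close> to the span of the \<open>a i\<close> is a sublinear functional. Its norming functional lies in the
polar of \<open>p\<close> and annihilates the \<open>a i\<close>, so that its norm, and with it the distance of a unit vector, is at
most \<open>\<rho>\<close>. The factor \<open>2\<close> only makes room for an infimum that need not be attained.\<close>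

lemma approximation_duality:
  fixes p :: "('d \<Rightarrow> real) \<Rightarrow> real" and a :: "nat \<Rightarrow> 'd \<Rightarrow> real"
  assumes D: "finite D" and p: "sublinear p" and nonneg: "\<And>h. 0 \<le> p h"
    and dep: "\<And>h h'. (\<And>d. d \<in> D \<Longrightarrow> h d = h' d) \<Longrightarrow> p h = p h'"
    and small: "\<And>x. (\<And>h. dot D x h \<le> p h) \<Longrightarrow> (\<And>i. i < m \<Longrightarrow> dot D x (a i) = 0) \<Longrightarrow> sqrt (dot D x x) \<le> \<rho>"
    and \<rho>: "0 < \<rho>" and f: "dot D f f \<le> 1"
  shows "\<exists>c. p (\<lambda>d. f d - (\<Sum>i<m. c i * a i d)) \<le> 2 * \<rho>"
proof -
  define F where "F h c = p (\<lambda>d. h d - (\<Sum>i<m. c i * a i d))" for h c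
  define q where "q h = (INF c\<in>UNIV. F h c)" for h
  have bdd: "bdd_below (range (F h))" for h
    by (rule bdd_belowI2[where m=0]) (simp add: F_def nonneg)
  have le: "q h \<le> F h c" for h c
    unfolding q_def by (intro cINF_lower bdd) auto
  have qnn: "0 \<le> q h" for h
    unfolding q_def by (rule cINF_greatest) (auto simp: F_def nonneg)
  have q: "sublinear q"
  proof (rule sublinearI)
    show "q (\<lambda>d. x d + y d) \<le> q x + q y" for x y
      unfolding q_def[of x] q_def[of y]
    proof (rule INF_add_ge)
      fix b c :: "nat \<Rightarrow> real"
      have "q (\<lambda>d. x d + y d) \<le> F (\<lambda>d. x d + y d) (\<lambda>i. b i + c i)" by (rule le)
      also have "\<dots> \<le> F x b + F y c"
        unfolding F_def using sublinearD(1)[OF p, of "\<lambda>d. x d - (\<Sum>i<m. b i * a i d)" "\<lambda>d. y d - (\<Sum>i<m. c i * a i d)"]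
        by (simp add: algebra_simps sum.distrib)
      finally show "q (\<lambda>d. x d + y d) \<le> F x b + F y c" .
    qed simp
    show "q (\<lambda>d. c * x d) \<le> c * q x" if c: "0 < c" for x c
    proof -
      have "q (\<lambda>d. c * x d) / c \<le> q x"
        unfolding q_def[of x]
      proof (rule cINF_greatest)
        fix b :: "nat \<Rightarrow> real"
        have "q (\<lambda>d. c * x d) \<le> F (\<lambda>d. c * x d) (\<lambda>i. c * b i)" by (rule le)
        also have "\<dots> = c * F x b"
          unfolding F_def using sublinearD(2)[OF p, of c "\<lambda>d. x d - (\<Sum>i<m. b i * a i d)"] c
          by (simp add: algebra_simps sum_distrib_left)
        finally show "q (\<lambda>d. c * x d) / c \<le> F x b" using c by (simp add: field_simps)
      qed simp
      then show ?thesis using c by (simp add: field_simps)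
    qed
    show "q (\<lambda>d. 0) = 0"
      using qnn[of "\<lambda>d. 0"] le[of "\<lambda>d. 0" "\<lambda>i. 0"] sublinearD(3)[OF p] by (simp add: F_def)
  qed
  have qdep: "q h = q h'" if "\<And>d. d \<in> D \<Longrightarrow> h d = h' d" for h h'
  proof -
    have "F h c = F h' c" for c
      unfolding F_def by (rule dep) (simp add: that)
    then show ?thesis by (simp add: q_def)
  qed
  have qp: "q h \<le> p h" for h using le[of h "\<lambda>i. 0"] by (simp add: F_def)
  obtain x where x: "\<And>h. dot D x h \<le> q h" "q f \<le> dot D x f"
    using dual_functional[OF D q qdep] by blast
  have "dot D x (a i) = 0" if i: "i < m" for i
  proof -
    have "F (\<lambda>d. c * a i d) (\<lambda>j. if j = i then c else 0) = 0" for c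
      using i sublinearD(3)[OF p] unfolding F_def
      by (simp add: if_distrib[of "\<lambda>z. z * _"] sum.delta cong: if_cong)
    then have "dot D x (\<lambda>d. c * a i d) \<le> 0" for c
      using x(1) le by (metis order_trans)
    then have "c * dot D x (a i) \<le> 0" for c by simp
    from this[of 1] this[of "-1"] show ?thesis by simp
  qed
  then have "sqrt (dot D x x) \<le> \<rho>"
    using small x(1) qp by (meson order_trans)
  then have "sqrt (dot D x x) * sqrt (dot D f f) \<le> \<rho> * 1"
    using f \<rho> by (intro mult_mono) auto
  then have "q f < 2 * \<rho>"
    using x(2) dot_Cauchy_Schwarz[of D x f] \<rho> by linarith
  then obtain c where "F f c < 2 * \<rho>"
    unfolding q_def by (subst (asm) cINF_less_iff) (auto simp: bdd)
  then show ?thesis unfolding F_def by (intro exI[of _ c]) simp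
qed

text \<open>Only elements of the polar with norm at most \<open>\<rho>\<close> have to be considered in the width: an element of larger
norm that is orthogonal to the rows could be scaled down to norm \<open>\<rho>\<close>. Without this localization the sharp
logarithm in Kashin's bound would be lost.\<close>

lemma random_subspace:
  fixes p :: "('d \<Rightarrow> real) \<Rightarrow> real"
  assumes D: "finite D" and p: "sublinear p" and nonneg: "\<And>h. 0 \<le> p h"
    and dep: "\<And>h h'. (\<And>d. d \<in> D \<Longrightarrow> h d = h' d) \<Longrightarrow> p h = p h'"
    and Q: "\<And>l x. (\<And>h. dot D x h \<le> p h) \<Longrightarrow> sqrt (dot D x x) \<le> \<rho> \<Longrightarrow>
      (\<Sum>S\<leftarrow>l. dot D (signs S) x) \<le> Q l"
    and \<rho>: "0 < \<rho>" and mean: "rows_mean D m Q < 9 / 32 * m * \<rho>"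
  shows "\<exists>a. \<forall>f. dot D f f \<le> 1 \<longrightarrow> (\<exists>c. p (\<lambda>d. f d - (\<Sum>i<m. c i * a i d)) \<le> 2 * \<rho>)"
proof -
  define K where "K = {x. (\<forall>h. dot D x h \<le> p h) \<and> sqrt (dot D x x) \<le> \<rho>}"
  have bound: "\<bar>x d\<bar> \<le> \<rho>" if "x \<in> K" "d \<in> D" for x d
  proof -
    have "(x d)\<^sup>2 \<le> dot D x x"
      unfolding dot_def power2_eq_square using D that(2) by (intro member_le_sum) auto
    then have "\<bar>x d\<bar> \<le> sqrt (dot D x x)" using real_sqrt_le_mono by fastforce
    with that(1) show ?thesis by (simp add: K_def)
  qed
  have "\<exists>l. length l = m \<and> (\<forall>x\<in>K. 9 / 16 * m * sqrt (dot D x x)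
      \<le> (\<Sum>S\<leftarrow>l. \<bar>dot D (signs S) x\<bar>) + 2 * rows_mean D m Q)"
    by (rule random_rows[OF D, where R=\<rho>]) (auto simp: bound K_def intro!: Q)
  then obtain l where l: "length l = m" "\<And>x. x \<in> K \<Longrightarrow> 9 / 16 * m * sqrt (dot D x x)
      \<le> (\<Sum>S\<leftarrow>l. \<bar>dot D (signs S) x\<bar>) + 2 * rows_mean D m Q"
    by blast
  define a where "a i = signs (l ! i)" for i
  have small: "sqrt (dot D x x) \<le> \<rho>"
    if x: "\<And>h. dot D x h \<le> p h" "\<And>i. i < m \<Longrightarrow> dot D x (a i) = 0" for x
  proof (rule ccontr)
    assume big: "\<not> sqrt (dot D x x) \<le> \<rho>"
    define s where "s = \<rho> / sqrt (dot D x x)"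
    define y where "y d = s * x d" for d
    have pos: "0 < sqrt (dot D x x)" using big \<rho> by linarith
    have s: "0 \<le> s" "s \<le> 1" using big \<rho> pos unfolding s_def by (simp_all add: divide_le_eq del: real_sqrt_gt_0_iff)
    have "dot D y y = (s * sqrt (dot D x x))\<^sup>2"
      unfolding y_def by (simp add: power2_eq_square algebra_simps)
    also have "\<dots> = \<rho>\<^sup>2" using pos unfolding s_def by simp
    finally have norm_y: "sqrt (dot D y y) = \<rho>" using \<rho> by simp
    have "dot D y h \<le> p h" for h
    proof -
      have "dot D y h \<le> s * p h" using x(1)[of h] s unfolding y_def by (simp add: mult_left_mono)
      also have "\<dots> \<le> p h" using s nonneg[of h] by (intro mult_left_le_one_le)
      finally show ?thesis .
    qed
    then have "y \<in> K" using norm_y by (simp add: K_def)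
    moreover have "(\<Sum>S\<leftarrow>l. \<bar>dot D (signs S) y\<bar>) = 0"
    proof -
      have "dot D (signs S) y = 0" if "S \<in> set l" for S
        using that x(2) l(1) by (auto simp: in_set_conv_nth a_def y_def[abs_def] dot_commute[of D "signs _"])
      then show ?thesis by (simp add: sum_list_0 cong: map_cong)
    qed
    ultimately show False
      using l(2)[of y] norm_y mean by simp
  qed
  show ?thesis
    using approximation_duality[OF D p nonneg dep small \<rho>] by (intro exI[of _ a]) blast
qed

section \<open>Random approximation of finite families\<close>

lemma rows_mean_exp_abs:
  assumes "finite D"
  shows "rows_mean D m (\<lambda>l. exp (a * \<bar>\<Sum>S\<leftarrow>l. dot D (signs S) x\<bar>)) \<le> 2 * exp (a\<^sup>2 * m * dot D x x / 2)"
proof -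
  have lin: "(\<Sum>S\<leftarrow>l. dot D (signs S) (\<lambda>d. c * x d)) = c * (\<Sum>S\<leftarrow>l. dot D (signs S) x)" for c l
    by (simp add: sum_list_const_mult)
  have bound: "rows_mean D m (\<lambda>l. exp (c * (\<Sum>S\<leftarrow>l. dot D (signs S) x))) \<le> exp (a\<^sup>2 * m * dot D x x / 2)"
    if "c\<^sup>2 = a\<^sup>2" for c
  proof -
    have eq: "m * (dot D (\<lambda>d. c * x d) (\<lambda>d. c * x d) / 2) = a\<^sup>2 * m * dot D x x / 2"
      unfolding that[symmetric] by (simp add: power2_eq_square)
    show ?thesis
      using rows_mean_exp[OF assms, of m "\<lambda>d. c * x d"] unfolding lin eq .
  qed
  have "rows_mean D m (\<lambda>l. exp (a * \<bar>\<Sum>S\<leftarrow>l. dot D (signs S) x\<bar>))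
      \<le> rows_mean D m (\<lambda>l. exp (a * (\<Sum>S\<leftarrow>l. dot D (signs S) x)) + exp ((- a) * (\<Sum>S\<leftarrow>l. dot D (signs S) x)))"
    by (intro rows_mean_mono[OF assms]) (simp add: abs_if)
  also have "\<dots> \<le> exp (a\<^sup>2 * m * dot D x x / 2) + exp (a\<^sup>2 * m * dot D x x / 2)"
    unfolding rows_mean_add by (intro add_mono bound) auto
  finally show ?thesis by simp
qed

text \<open>The mean of the maximum of \<open>N\<close> subgaussian variables. Jensen's inequality is replaced by its tangent form
\<open>ln y \<le> y - 1\<close>, applied at a point \<open>B\<close> that is the bound for the mean of the exponentials.\<close>

lemma rows_mean_max:
  fixes v :: "'i \<Rightarrow> 'd \<Rightarrow> real"
  assumes D: "finite D" and I: "finite I" "I \<noteq> {}" and m: "0 < m"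
    and card: "finite V" "v ` I \<subseteq> V" "card V \<le> N"
    and \<sigma>: "0 < \<sigma>" "\<And>x. x \<in> V \<Longrightarrow> dot D x x \<le> \<sigma>\<^sup>2"
  shows "rows_mean D m (\<lambda>l. Max ((\<lambda>i. \<bar>\<Sum>S\<leftarrow>l. dot D (signs S) (v i)\<bar>) ` I))
    \<le> sqrt m * (\<sigma> * sqrt (2 * ln (2 * real N)))"
proof -
  have "V \<noteq> {}" using I(2) card(2) by auto
  then have N: "1 \<le> N" using card by (metis One_nat_def Suc_leI card_gt_0_iff order_trans)
  define L where "L = ln (2 * real N)"
  have L: "0 < L" using N by (simp add: L_def)
  define a where "a = sqrt (2 * L / (\<sigma>\<^sup>2 * m))"
  have a: "0 < a" "a\<^sup>2 = 2 * L / (\<sigma>\<^sup>2 * m)" using L \<sigma> m by (auto simp: a_def)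
  have aL: "a\<^sup>2 * m * \<sigma>\<^sup>2 / 2 = L" using a \<sigma> m by simp
  define B where "B = 2 * N * exp L"
  have B: "0 < B" using N by (simp add: B_def)
  have lnB: "ln B = 2 * L" using N by (simp add: B_def L_def ln_mult)
  define Y where "Y x l = (\<Sum>S\<leftarrow>l. dot D (signs S) x)" for x l
  have "rows_mean D m (\<lambda>l. Max ((\<lambda>i. \<bar>Y (v i) l\<bar>) ` I))
      \<le> rows_mean D m (\<lambda>l. inverse a * (inverse B * (\<Sum>x\<in>V. exp (a * \<bar>Y x l\<bar>)) + (ln B - 1)))"
  proof (rule rows_mean_mono[OF D])
    fix l
    have "\<bar>Y (v i) l\<bar> \<le> inverse a * (inverse B * (\<Sum>x\<in>V. exp (a * \<bar>Y x l\<bar>)) + (ln B - 1))" if i: "i \<in> I" for i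
    proof -
      have "a * \<bar>Y (v i) l\<bar> - ln B = ln (exp (a * \<bar>Y (v i) l\<bar>) / B)"
        using B by (simp add: ln_div)
      also have "\<dots> \<le> exp (a * \<bar>Y (v i) l\<bar>) / B - 1"
        using B by (intro ln_le_minus_one) simp
      also have "\<dots> \<le> (\<Sum>x\<in>V. exp (a * \<bar>Y x l\<bar>)) / B - 1"
        using B card i by (intro diff_right_mono divide_right_mono member_le_sum) auto
      finally show ?thesis using a by (simp add: field_simps)
    qed
    then show "Max ((\<lambda>i. \<bar>Y (v i) l\<bar>) ` I) \<le> inverse a * (inverse B * (\<Sum>x\<in>V. exp (a * \<bar>Y x l\<bar>)) + (ln B - 1))"
      using I by (intro Max.boundedI) auto
  qed
  also have "\<dots> = inverse a * (inverse B * (\<Sum>x\<in>V. rows_mean D m (\<lambda>l. exp (a * \<bar>Y x l\<bar>))) + (ln B - 1))"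
    by (simp only: rows_mean_cmult rows_mean_add rows_mean_sum rows_mean_const[OF D])
  also have "\<dots> \<le> inverse a * (inverse B * (\<Sum>x\<in>V. 2 * exp L) + (ln B - 1))"
  proof (intro mult_left_mono add_right_mono sum_mono)
    fix x assume x: "x \<in> V"
    have "rows_mean D m (\<lambda>l. exp (a * \<bar>Y x l\<bar>)) \<le> 2 * exp (a\<^sup>2 * m * dot D x x / 2)"
      unfolding Y_def by (rule rows_mean_exp_abs[OF D])
    also have "a\<^sup>2 * m * dot D x x / 2 \<le> a\<^sup>2 * m * \<sigma>\<^sup>2 / 2"
      using \<sigma>(2)[OF x] by (intro divide_right_mono mult_left_mono) auto
    finally show "rows_mean D m (\<lambda>l. exp (a * \<bar>Y x l\<bar>)) \<le> 2 * exp L" by (simp add: aL)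
  qed (use a B in auto)
  also have "\<dots> \<le> inverse a * (1 + (ln B - 1))"
    using a B card N by (intro mult_left_mono add_right_mono) (auto simp: B_def field_simps)
  also have "\<dots> = sqrt m * (\<sigma> * sqrt (2 * L))"
  proof -
    have "a * (\<sigma> * sqrt m) = sqrt (2 * L)"
      using \<sigma> m by (simp add: a_def real_sqrt_divide real_sqrt_mult)
    then have "a * (sqrt m * (\<sigma> * sqrt (2 * L))) = 2 * L"
      using L by (metis abs_of_pos mult.assoc mult.left_commute mult_pos_pos real_sqrt_mult_self zero_less_numeral)
    then show ?thesis using a by (simp add: lnB field_simps)
  qed
  finally show ?thesis unfolding Y_def L_def .
qed

text \<open>The functionals \<open>w i\<close> on the unit ball are approximated, uniformly in \<open>i\<close>, by an \<open>m\<close>-dimensional space of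
functions of \<open>i\<close>. This is a bound for a Kolmogorov number of the operator \<open>f \<mapsto> (inner (w i) f)\<^sub>i\<close> into
\<open>\<ell>\<^sub>\<infinity>\<close> that is additive in \<open>w\<close>, which makes splitting into levels easy.\<close>

definition kolmogorov_approx ::
    "nat \<Rightarrow> real \<Rightarrow> ('i \<Rightarrow> 'a::real_inner) \<Rightarrow> 'i set \<Rightarrow> bool" where
  "kolmogorov_approx m \<delta> w I \<longleftrightarrow> (\<exists>g :: nat \<Rightarrow> 'i \<Rightarrow> real. \<forall>f. norm f \<le> 1 \<longrightarrow>
     (\<exists>c. \<forall>i\<in>I. \<bar>inner (w i) f - (\<Sum>j<m. c j * g j i)\<bar> \<le> \<delta>))"

lemma kolmogorov_approx_mono:
  fixes w :: "'i \<Rightarrow> 'a::real_inner"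
  assumes "kolmogorov_approx m \<delta> w I" "m \<le> m'" "\<delta> \<le> \<delta>'"
  shows "kolmogorov_approx m' \<delta>' w I"
proof -
  obtain g where g: "\<And>f. norm f \<le> 1 \<Longrightarrow> \<exists>c. \<forall>i\<in>I. \<bar>inner (w i) f - (\<Sum>j<m. c j * g j i)\<bar> \<le> \<delta>"
    using assms(1) by (auto simp: kolmogorov_approx_def)
  have "\<exists>c. \<forall>i\<in>I. \<bar>inner (w i) f - (\<Sum>j<m'. c j * g j i)\<bar> \<le> \<delta>'" if f: "norm f \<le> 1" for f :: 'a
  proof -
    obtain c where c: "\<And>i. i \<in> I \<Longrightarrow> \<bar>inner (w i) f - (\<Sum>j<m. c j * g j i)\<bar> \<le> \<delta>"
      using g[OF f] by blast
    have "(\<Sum>j<m'. (if j < m then c j else 0) * g j i) = (\<Sum>j<m. c j * g j i)" for i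
      using assms(2) by (intro sum.mono_neutral_cong_right) auto
    then show ?thesis
      using c assms(3) by (intro exI[of _ "\<lambda>j. if j < m then c j else 0"]) force
  qed
  then show ?thesis unfolding kolmogorov_approx_def by blast
qed

lemma sum_lessThan_add:
  fixes h :: "nat \<Rightarrow> 'a::comm_monoid_add"
  shows "(\<Sum>j<m + n. h j) = (\<Sum>j<m. h j) + (\<Sum>j<n. h (m + j))"
  by (induction n) (auto simp: add.assoc)

lemma kolmogorov_approx_add:
  fixes w1 w2 :: "'i \<Rightarrow> 'a::real_inner"
  assumes "kolmogorov_approx m1 \<delta>1 w1 I" "kolmogorov_approx m2 \<delta>2 w2 I"
  shows "kolmogorov_approx (m1 + m2) (\<delta>1 + \<delta>2) (\<lambda>i. w1 i + w2 i) I"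
proof -
  obtain g1 where g1: "\<And>f. norm f \<le> 1 \<Longrightarrow> \<exists>c. \<forall>i\<in>I. \<bar>inner (w1 i) f - (\<Sum>j<m1. c j * g1 j i)\<bar> \<le> \<delta>1"
    using assms(1) by (auto simp: kolmogorov_approx_def)
  obtain g2 where g2: "\<And>f. norm f \<le> 1 \<Longrightarrow> \<exists>c. \<forall>i\<in>I. \<bar>inner (w2 i) f - (\<Sum>j<m2. c j * g2 j i)\<bar> \<le> \<delta>2"
    using assms(2) by (auto simp: kolmogorov_approx_def)
  define g where "g j = (if j < m1 then g1 j else g2 (j - m1))" for j
  have "\<exists>c. \<forall>i\<in>I. \<bar>inner (w1 i + w2 i) f - (\<Sum>j<m1 + m2. c j * g j i)\<bar> \<le> \<delta>1 + \<delta>2" if f: "norm f \<le> 1" for f :: 'a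
  proof -
    obtain c1 where c1: "\<And>i. i \<in> I \<Longrightarrow> \<bar>inner (w1 i) f - (\<Sum>j<m1. c1 j * g1 j i)\<bar> \<le> \<delta>1"
      using g1[OF f] by blast
    obtain c2 where c2: "\<And>i. i \<in> I \<Longrightarrow> \<bar>inner (w2 i) f - (\<Sum>j<m2. c2 j * g2 j i)\<bar> \<le> \<delta>2"
      using g2[OF f] by blast
    define c where "c j = (if j < m1 then c1 j else c2 (j - m1))" for j
    have "(\<Sum>j<m1 + m2. c j * g j i) = (\<Sum>j<m1. c1 j * g1 j i) + (\<Sum>j<m2. c2 j * g2 j i)" for i
      by (simp add: sum_lessThan_add c_def g_def)
    then show ?thesis
      using c1 c2 by (intro exI[of _ c]) (force simp: inner_add_left)
  qed
  then show ?thesis unfolding kolmogorov_approx_def by blast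
qed

lemma kolmogorov_approx_reindex:
  assumes "kolmogorov_approx m \<delta> w J" "\<And>i. i \<in> I \<Longrightarrow> \<sigma> i \<in> J" "\<And>i. i \<in> I \<Longrightarrow> w' i = w (\<sigma> i)"
  shows "kolmogorov_approx m \<delta> w' I"
proof -
  obtain g where g: "\<And>f. norm f \<le> 1 \<Longrightarrow> \<exists>c. \<forall>i\<in>J. \<bar>inner (w i) f - (\<Sum>j<m. c j * g j i)\<bar> \<le> \<delta>"
    using assms(1) by (auto simp: kolmogorov_approx_def)
  show ?thesis
    unfolding kolmogorov_approx_def
  proof (intro exI[of _ "\<lambda>j i. g j (\<sigma> i)"] allI impI)
    fix f :: 'b assume "norm f \<le> 1"
    then show "\<exists>c. \<forall>i\<in>I. \<bar>inner (w' i) f - (\<Sum>j<m. c j * g j (\<sigma> i))\<bar> \<le> \<delta>"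
      using g[of f] assms(2,3) by fastforce
  qed
qed

lemma kolmogorov_approx_finite:
  fixes w :: "nat \<Rightarrow> 'a::real_inner"
  shows "kolmogorov_approx m 0 w {..<m}"
  unfolding kolmogorov_approx_def
proof (intro exI[of _ "\<lambda>j i. if j = i then 1 else 0"] allI impI)
  fix f :: 'a
  show "\<exists>c. \<forall>i\<in>{..<m}. \<bar>inner (w i) f - (\<Sum>j<m. c j * (if j = i then 1 else 0))\<bar> \<le> 0"
    by (rule exI[of _ "\<lambda>j. inner (w j) f"]) (simp add: if_distrib[of "\<lambda>z. _ * z"] sum.delta cong: if_cong)
qed

lemma kolmogorov_approx_sum:
  fixes J :: nat
  assumes "\<And>j. j < J \<Longrightarrow> kolmogorov_approx (m j) (\<delta> j) (w j) I"
  shows "kolmogorov_approx (\<Sum>j<J. m j) (\<Sum>j<J. \<delta> j) (\<lambda>i. \<Sum>j<J. w j i) I"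
  using assms
proof (induction J)
  case 0
  then show ?case by (simp add: kolmogorov_approx_def)
next
  case (Suc J)
  then show ?case using kolmogorov_approx_add[OF Suc.IH, of "m J" "\<delta> J" "w J"] by simp
qed

lemma sublinear_Max:
  fixes w :: "'i \<Rightarrow> 'd \<Rightarrow> real"
  assumes I: "finite I" "I \<noteq> {}"
  shows "sublinear (\<lambda>h. Max ((\<lambda>i. \<bar>dot D (w i) h\<bar>) ` I))"
proof (rule sublinearI)
  let ?p = "\<lambda>h. Max ((\<lambda>i. \<bar>dot D (w i) h\<bar>) ` I)"
  have le: "\<bar>dot D (w i) h\<bar> \<le> ?p h" if "i \<in> I" for i h
    using I that by (intro Max_ge) auto
  show "?p (\<lambda>d. x d + y d) \<le> ?p x + ?p y" for x y
  proof (rule Max.boundedI)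
    fix z assume "z \<in> (\<lambda>i. \<bar>dot D (w i) (\<lambda>d. x d + y d)\<bar>) ` I"
    then obtain i where i: "i \<in> I" "z = \<bar>dot D (w i) (\<lambda>d. x d + y d)\<bar>" by blast
    have "dot D (w i) (\<lambda>d. x d + y d) = dot D (w i) x + dot D (w i) y"
      by (simp add: dot_def sum.distrib algebra_simps)
    then show "z \<le> ?p x + ?p y" using le[OF i(1), of x] le[OF i(1), of y] i(2) by linarith
  qed (use I in auto)
  show "?p (\<lambda>d. c * x d) \<le> c * ?p x" if "0 < c" for x c
  proof (rule Max.boundedI)
    fix z assume "z \<in> (\<lambda>i. \<bar>dot D (w i) (\<lambda>d. c * x d)\<bar>) ` I"
    then show "z \<le> c * ?p x" using le[of _ x] that by (auto simp: abs_mult)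
  qed (use I in auto)
  show "?p (\<lambda>d. 0) = 0"
    using I by (simp add: dot_def image_constant_conv)
qed

text \<open>Only the part of a coordinate of \<open>\<Sum>i. a\<^sub>i\<close> above the threshold \<open>M\<close> is expensive, and the threshold is
chosen such that the total excess of all \<open>N\<close> coordinates is a small multiple of \<open>m\<^sup>2\<close>; the factor \<open>128\<close> in the logarithm
provides the small multiple.\<close>

lemma rows_mean_excess:
  assumes D: "finite D" and dD: "d \<in> D" and m: "0 < m" and N: "real m \<le> N"
  defines "M \<equiv> sqrt (2 * m * ln (128 * N / m))"
  shows "rows_mean D m (\<lambda>l. (max 0 (\<bar>\<Sum>S\<leftarrow>l. signs S d\<bar> - M))\<^sup>2) \<le> (real m)\<^sup>2 / (32 * N)"
proof -
  define L where "L = ln (128 * N / m)"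
  have Nm: "0 < N" "1 \<le> N / m" using N m by (auto simp: field_simps)
  have L: "1 \<le> L"
  proof -
    have "exp 1 \<le> (128::real)" using exp_le by simp
    also have "\<dots> \<le> 128 * N / m" using Nm by simp
    finally show ?thesis unfolding L_def using Nm m by (subst ln_ge_iff) auto
  qed
  have M: "0 < M" "M\<^sup>2 = 2 * m * L" using L m by (auto simp: M_def L_def)
  define a where "a = M / m"
  have a: "0 < a" "a\<^sup>2 = 2 * L / m" "a * M = 2 * L"
    using M m by (auto simp: a_def power_divide power2_eq_square field_simps)
  define e where "e = (\<lambda>d'. if d' = d then 1 else (0::real))"
  have e: "dot D x e = x d" for x
    using D dD by (simp add: dot_def e_def if_distrib[of "\<lambda>z. _ * z"] sum.delta cong: if_cong)
  define Y where "Y l = (\<Sum>S\<leftarrow>l. signs S d)" for l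
  have *: "(max 0 (y - M))\<^sup>2 \<le> (2 / a\<^sup>2 * exp (- 2 * L)) * exp (a * y)" for y
  proof (cases "y \<le> M")
    case True
    then show ?thesis by (simp add: max_def)
  next
    case False
    have "0 \<le> a * (y - M)" using False a by simp
    then have "(a * (y - M))\<^sup>2 / 2 \<le> exp (a * (y - M))"
      using exp_lower_Taylor_quadratic[of "a * (y - M)"] by linarith
    moreover have "exp (a * (y - M)) = exp (- 2 * L) * exp (a * y)"
      using a(3) by (simp add: exp_add[symmetric] algebra_simps)
    ultimately have "(y - M)\<^sup>2 * a\<^sup>2 \<le> 2 * (exp (- 2 * L) * exp (a * y))"
      by (simp add: power_mult_distrib mult.commute)
    then have "(y - M)\<^sup>2 \<le> 2 * (exp (- 2 * L) * exp (a * y)) / a\<^sup>2"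
      using a(1) by (simp add: pos_le_divide_eq)
    then show ?thesis using False by (simp add: max_def mult.assoc)
  qed
  have "rows_mean D m (\<lambda>l. (max 0 (\<bar>Y l\<bar> - M))\<^sup>2)
      \<le> rows_mean D m (\<lambda>l. (2 / a\<^sup>2 * exp (- 2 * L)) * exp (a * \<bar>Y l\<bar>))"
    by (intro rows_mean_mono[OF D] *)
  also have "\<dots> \<le> (2 / a\<^sup>2 * exp (- 2 * L)) * (2 * exp (a\<^sup>2 * m * dot D e e / 2))"
    unfolding rows_mean_cmult using rows_mean_exp_abs[OF D, where m=m and a=a and x=e]
    by (intro mult_left_mono) (simp_all add: Y_def e)
  also have "\<dots> = 4 / a\<^sup>2 * exp (- L)"
  proof -
    have "a\<^sup>2 * m * dot D e e / 2 = L" using a m by (simp only: e) (simp add: e_def)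
    then show ?thesis by (simp add: exp_add[symmetric])
  qed
  also have "exp (- L) = m / (128 * N)"
    using Nm m by (simp add: L_def exp_minus)
  also have "4 / a\<^sup>2 * (m / (128 * N)) \<le> (real m)\<^sup>2 / (32 * N)"
  proof -
    have "4 / a\<^sup>2 * (m / (128 * N)) = 1 / (2 * L) * ((real m)\<^sup>2 / (32 * N))"
      unfolding a(2) using L m by (simp add: field_simps power2_eq_square)
    also have "\<dots> \<le> 1 * ((real m)\<^sup>2 / (32 * N))"
      using L Nm by (intro mult_right_mono) auto
    finally show ?thesis by simp
  qed
  finally show ?thesis unfolding Y_def .
qed

text \<open>Kashin's theorem in the form of Garnaev and Gluskin, transported along the Bessel inequality. The polar of
the maximum norm is the unit ball of \<open>\<ell>\<^sub>1\<close>; on elements with \<open>\<ell>\<^sub>2\<close>-norm at most \<open>\<rho>\<close> the width is at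
most \<open>M\<close> (from the \<open>\<ell>\<^sub>1\<close>-norm) plus \<open>\<rho>\<close> times the norm of the excess over \<open>M\<close>.\<close>

lemma kolmogorov_approx_Bessel:
  fixes u :: "'d \<Rightarrow> 'a::real_inner"
  assumes D: "finite D" and m: "0 < m" "m \<le> card D" and A: "0 < A"
    and Bessel: "\<And>f. (\<Sum>d\<in>D. (inner (u d) f)\<^sup>2) \<le> A\<^sup>2 * (norm f)\<^sup>2"
  shows "kolmogorov_approx m (22 * A * sqrt (2 * ln (128 * card D / m) / m)) u D"
proof -
  define N where "N = card D"
  define M where "M = sqrt (2 * m * ln (128 * N / m))"
  have Nm: "0 < N" "1 \<le> real N / m" using m by (auto simp: N_def field_simps)
  have "1 < 128 * (real N / m)" using Nm by linarith
  then have L: "0 < ln (128 * N / m)" by (intro ln_gt_zero) simp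
  have M: "0 < M" using L m by (simp add: M_def)
  define \<rho> where "\<rho> = 11 * M / m"
  have \<rho>: "0 < \<rho>" using M m by (simp add: \<rho>_def)
  have D0: "D \<noteq> {}" using Nm by (auto simp: N_def)
  define p where "p h = Max ((\<lambda>d. \<bar>h d\<bar>) ` D)" for h :: "'d \<Rightarrow> real"
  have ple: "\<bar>h d\<bar> \<le> p h" if "d \<in> D" for h d
    unfolding p_def using that D by (intro Max_ge) auto
  have p_dot: "p h = Max ((\<lambda>d. \<bar>dot D (\<lambda>d'. if d' = d then 1 else 0) h\<bar>) ` D)" for h
    unfolding p_def using D
    by (intro arg_cong[where f=Max] image_cong) (simp_all add: dot_def if_distrib[of "\<lambda>z. z * _"] sum.delta cong: if_cong)
  have p: "sublinear p"
    unfolding p_dot[abs_def] by (rule sublinear_Max[OF D D0])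
  have nonneg: "0 \<le> p h" for h
    using ple D0 by (metis abs_ge_zero all_not_in_conv order_trans)
  have dep: "p h = p h'" if "\<And>d. d \<in> D \<Longrightarrow> h d = h' d" for h h'
    unfolding p_def using that by (intro arg_cong[where f=Max] image_cong) auto
  define X where "X l d = (\<Sum>S\<leftarrow>l. signs S d)" for l and d :: 'd
  define Q where "Q l = (M + \<rho> * m / 16) + 4 * \<rho> / m * (\<Sum>d\<in>D. (max 0 (\<bar>X l d\<bar> - M))\<^sup>2)" for l
  have Q: "(\<Sum>S\<leftarrow>l. dot D (signs S) x) \<le> Q l"
    if x: "\<And>h. dot D x h \<le> p h" "sqrt (dot D x x) \<le> \<rho>" for l x
  proof -
    define Z where "Z d = max 0 (\<bar>X l d\<bar> - M)" for d
    have l1: "(\<Sum>d\<in>D. \<bar>x d\<bar>) \<le> 1"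
    proof -
      have "(\<Sum>d\<in>D. \<bar>x d\<bar>) = dot D x (\<lambda>d. sgn (x d))"
        unfolding dot_def by (intro sum.cong) (auto simp: abs_sgn)
      also have "\<dots> \<le> p (\<lambda>d. sgn (x d))" by (rule x(1))
      also have "\<dots> \<le> 1" unfolding p_def using D D0 by (intro Max.boundedI) (auto simp: abs_sgn_eq)
      finally show ?thesis .
    qed
    have "(\<Sum>S\<leftarrow>l. dot D (signs S) x) = (\<Sum>d\<in>D. X l d * x d)"
    proof (induction l)
      case (Cons S l)
      then show ?case by (simp add: X_def dot_def sum.distrib algebra_simps)
    qed (simp add: X_def)
    also have "\<dots> \<le> (\<Sum>d\<in>D. M * \<bar>x d\<bar> + Z d * \<bar>x d\<bar>)"
    proof (rule sum_mono)
      fix d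
      have "X l d * x d \<le> \<bar>X l d\<bar> * \<bar>x d\<bar>" by (metis abs_ge_self abs_mult)
      also have "\<dots> \<le> (M + Z d) * \<bar>x d\<bar>" by (intro mult_right_mono) (auto simp: Z_def)
      finally show "X l d * x d \<le> M * \<bar>x d\<bar> + Z d * \<bar>x d\<bar>" by (simp add: algebra_simps)
    qed
    also have "\<dots> = M * (\<Sum>d\<in>D. \<bar>x d\<bar>) + dot D Z (\<lambda>d. \<bar>x d\<bar>)"
      by (simp add: sum.distrib sum_distrib_left dot_def)
    also have "\<dots> \<le> M * 1 + sqrt (dot D Z Z) * \<rho>"
    proof (intro add_mono mult_left_mono l1)
      have "dot D Z (\<lambda>d. \<bar>x d\<bar>) \<le> sqrt (dot D Z Z) * sqrt (dot D (\<lambda>d. \<bar>x d\<bar>) (\<lambda>d. \<bar>x d\<bar>))"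
        by (rule dot_Cauchy_Schwarz)
      also have "dot D (\<lambda>d. \<bar>x d\<bar>) (\<lambda>d. \<bar>x d\<bar>) = dot D x x" by (simp add: dot_def)
      also have "sqrt (dot D Z Z) * sqrt (dot D x x) \<le> sqrt (dot D Z Z) * \<rho>"
        by (intro mult_left_mono x(2)) auto
      finally show "dot D Z (\<lambda>d. \<bar>x d\<bar>) \<le> sqrt (dot D Z Z) * \<rho>" .
    qed (use M in auto)
    also have "\<dots> \<le> M + (4 / m * dot D Z Z + m / 16) * \<rho>"
    proof -
      define z where "z = sqrt (dot D Z Z)"
      have "z\<^sup>2 = dot D Z Z" by (simp add: z_def)
      moreover have "z \<le> 4 / m * z\<^sup>2 + m / 16"
      proof -
        have "0 \<le> 4 / m * (z - m / 8)\<^sup>2" by simp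
        also have "\<dots> = 4 / m * z\<^sup>2 + m / 16 - z" using m by (simp add: field_simps power2_eq_square)
        finally show ?thesis by simp
      qed
      ultimately show ?thesis using \<rho> by (simp add: z_def[symmetric])
    qed
    also have "\<dots> = Q l"
      unfolding Q_def Z_def dot_def by (simp add: power2_eq_square algebra_simps)
    finally show ?thesis .
  qed
  have excess: "rows_mean D m (\<lambda>l. (max 0 (\<bar>X l d\<bar> - M))\<^sup>2) \<le> (real m)\<^sup>2 / (32 * N)" if "d \<in> D" for d
    unfolding X_def M_def using rows_mean_excess[OF D that m(1), of "real N"] m by (simp add: N_def)
  have mean: "rows_mean D m Q < 9 / 32 * m * \<rho>"
  proof -
    have "rows_mean D m Q = (M + \<rho> * m / 16) + 4 * \<rho> / m * (\<Sum>d\<in>D. rows_mean D m (\<lambda>l. (max 0 (\<bar>X l d\<bar> - M))\<^sup>2))"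
      unfolding Q_def[abs_def] by (simp only: rows_mean_add rows_mean_cmult rows_mean_sum rows_mean_const[OF D])
    also have "\<dots> \<le> (M + \<rho> * m / 16) + 4 * \<rho> / m * (\<Sum>d\<in>D. (real m)\<^sup>2 / (32 * N))"
      using \<rho> m excess by (intro add_left_mono mult_left_mono sum_mono) auto
    also have "\<dots> = M + 3 * \<rho> * m / 16"
      using Nm m by (simp add: N_def[symmetric] field_simps power2_eq_square)
    also have "\<dots> < 9 / 32 * m * \<rho>"
      using M m by (simp add: \<rho>_def field_simps)
    finally show ?thesis .
  qed
  obtain a where a: "\<And>f. dot D f f \<le> 1 \<Longrightarrow> \<exists>c. p (\<lambda>d. f d - (\<Sum>i<m. c i * a i d)) \<le> 2 * \<rho>"
    using random_subspace[OF D p nonneg dep Q \<rho> mean] by blast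
  have "\<exists>c. \<forall>d\<in>D. \<bar>inner (u d) f - (\<Sum>j<m. c j * a j d)\<bar> \<le> A * (2 * \<rho>)" if f: "norm f \<le> 1" for f
  proof -
    have "dot D (\<lambda>d. inner (u d) f / A) (\<lambda>d. inner (u d) f / A) = (\<Sum>d\<in>D. (inner (u d) f)\<^sup>2) / A\<^sup>2"
      by (simp add: dot_def sum_divide_distrib power2_eq_square)
    also have "\<dots> \<le> A\<^sup>2 * (norm f)\<^sup>2 / A\<^sup>2" by (intro divide_right_mono Bessel) simp
    also have "\<dots> \<le> 1" using A f by (simp add: abs_square_le_1)
    finally obtain c where c: "p (\<lambda>d. inner (u d) f / A - (\<Sum>i<m. c i * a i d)) \<le> 2 * \<rho>"
      using a by blast
    have "\<bar>inner (u d) f - (\<Sum>j<m. (A * c j) * a j d)\<bar> \<le> A * (2 * \<rho>)" if "d \<in> D" for d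
    proof -
      have "inner (u d) f - (\<Sum>j<m. (A * c j) * a j d) = A * (inner (u d) f / A - (\<Sum>j<m. c j * a j d))"
        using A by (simp add: algebra_simps sum_distrib_left)
      then have "\<bar>inner (u d) f - (\<Sum>j<m. (A * c j) * a j d)\<bar> = A * \<bar>inner (u d) f / A - (\<Sum>j<m. c j * a j d)\<bar>"
        using A by (simp add: abs_mult)
      also have "\<dots> \<le> A * (2 * \<rho>)"
        using A c ple[OF that, of "\<lambda>d. inner (u d) f / A - (\<Sum>j<m. c j * a j d)"] by (intro mult_left_mono) auto
      finally show ?thesis .
    qed
    then show ?thesis by (intro exI[of _ "\<lambda>j. A * c j"]) blast
  qed
  moreover have "A * (2 * \<rho>) = 22 * A * sqrt (2 * ln (128 * card D / m) / m)"
  proof -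
    have "sqrt (2 * ln (128 * N / m) / m) = M / m"
      using m unfolding M_def by (simp add: real_sqrt_mult real_sqrt_divide field_simps)
    then show ?thesis by (simp add: \<rho>_def N_def)
  qed
  ultimately show ?thesis unfolding kolmogorov_approx_def by (intro exI[of _ a]) auto
qed

lemma finite_orthonormal_basis:
  fixes W :: "'a::real_inner set"
  assumes "finite W"
  obtains B where "finite B" "\<forall>b\<in>B. norm b = 1" "pairwise orthogonal B" "W \<subseteq> span B"
proof -
  obtain C where C: "finite C" "span C = span W" "pairwise orthogonal C"
    using basis_orthogonal[OF assms] by blast
  define B where "B = (\<lambda>c. c /\<^sub>R norm c) ` (C - {0})"
  have "c \<in> span B" if "c \<in> C" for c
  proof (cases "c = 0")
    case False
    then have "norm c *\<^sub>R (c /\<^sub>R norm c) \<in> span B"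
      using that by (intro span_scale span_base) (auto simp: B_def)
    then show ?thesis using False by simp
  qed (simp add: span_zero)
  then have "span W \<subseteq> span B" using C(2) span_minimal[of C "span B"] by auto
  moreover have "pairwise orthogonal B"
    using C(3) unfolding pairwise_def B_def by (auto simp: orthogonal_def) 
  moreover have "norm (c /\<^sub>R norm c) = 1" if "c \<noteq> 0" for c :: 'a
    using that by simp
  ultimately show ?thesis
    using C(1) span_superset[of W] by (intro that[of B]) (auto simp: B_def simp del: norm_scaleR)
qed

lemma inner_orthonormal_expansion:
  fixes B :: "'a::real_inner set"
  assumes B: "finite B" "\<forall>b\<in>B. norm b = 1" "pairwise orthogonal B"
  shows "v \<in> span B \<Longrightarrow> inner v f = dot B (inner v) (inner f)"
    and "dot B (inner f) (inner f) \<le> (norm f)\<^sup>2"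
proof -
  have orth: "inner b b' = (if b = b' then 1 else 0)" if "b \<in> B" "b' \<in> B" for b b'
    using B that by (auto simp: pairwise_def orthogonal_def dot_square_norm)
  show exp: "inner v f = dot B (inner v) (inner f)" if v: "v \<in> span B" for v f
  proof -
    obtain c where c: "v = (\<Sum>b\<in>B. c b *\<^sub>R b)"
      using v B(1) by (auto simp: span_finite)
    have "inner v b' = c b'" if "b' \<in> B" for b'
      unfolding c inner_sum_left using B(1) that
      by (simp add: orth if_distrib[of "\<lambda>z. _ * z"] sum.delta' cong: if_cong)
    moreover have "inner v f = (\<Sum>b\<in>B. c b * inner f b)"
      unfolding c inner_sum_left by (simp add: inner_commute)
    ultimately show ?thesis by (simp add: dot_def)
  qed
  define P where "P = (\<Sum>b\<in>B. inner f b *\<^sub>R b)"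
  have P: "P \<in> span B" unfolding P_def by (intro span_sum span_scale span_base)
  have Pb: "inner P b = inner f b" if "b \<in> B" for b
    unfolding P_def inner_sum_left using B(1) that
    by (simp add: orth if_distrib[of "\<lambda>z. _ * z"] sum.delta' cong: if_cong)
  have "inner P f = dot B (inner f) (inner f)" "inner P P = dot B (inner f) (inner f)"
    using exp[OF P] Pb by (auto simp: dot_def)
  then have "0 \<le> inner f f - dot B (inner f) (inner f)"
    using inner_ge_zero[of "f - P"] by (simp add: inner_diff_left inner_diff_right inner_commute)
  then show "dot B (inner f) (inner f) \<le> (norm f)\<^sup>2"
    by (simp add: power2_norm_eq_inner)
qed

text \<open>The convex hull of the whole family has as its width the mean over the random rows of the maximum of
\<open>\<bar>inner (w i) x\<bar>\<close>, where \<open>x\<close> is the sum of the rows. The levels are separated only inside this mean, so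
that one subspace serves all of them. Sign vectors live in the coordinates of an orthonormal basis \<open>B\<close> of
the span of all \<open>v j i\<close>, with the basis vectors themselves as indices.\<close>

lemma kolmogorov_approx_chaining:
  fixes v :: "nat \<Rightarrow> 'i \<Rightarrow> 'a::real_inner"
  assumes I: "finite I" "I \<noteq> {}" and m: "0 < m" and J: "finite J" "J \<noteq> {}"
    and N: "\<And>j. j \<in> J \<Longrightarrow> card (v j ` I) \<le> N j"
    and \<omega>: "\<And>j. j \<in> J \<Longrightarrow> 0 < \<omega> j" "\<And>j i. j \<in> J \<Longrightarrow> i \<in> I \<Longrightarrow> norm (v j i) \<le> \<omega> j"
  shows "kolmogorov_approx m (8 / sqrt m * (\<Sum>j\<in>J. \<omega> j * sqrt (2 * ln (2 * real (N j))))) (\<lambda>i. \<Sum>j\<in>J. v j i) I"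
proof -
  define w where "w i = (\<Sum>j\<in>J. v j i)" for i
  obtain B where B: "finite B" "\<forall>b\<in>B. norm b = 1" "pairwise orthogonal B"
      "(\<Union>j\<in>J. v j ` I) \<subseteq> span B"
    using I(1) J(1) by (rule_tac finite_orthonormal_basis[of "\<Union>j\<in>J. v j ` I"]) auto
  note exp = inner_orthonormal_expansion[OF B(1-3)]
  have wB: "w i \<in> span B" if "i \<in> I" for i
    unfolding w_def using B(4) that by (intro span_sum) auto
  define \<Sigma> where "\<Sigma> = (\<Sum>j\<in>J. \<omega> j * sqrt (2 * ln (2 * real (N j))))"
  have N1: "1 \<le> N j" if "j \<in> J" for j
  proof -
    have "0 < card (v j ` I)" using I by (simp add: card_gt_0_iff)
    with N[OF that] show ?thesis by linarith
  qed
  have \<Sigma>: "0 < \<Sigma>"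
    unfolding \<Sigma>_def
  proof (rule sum_pos[OF J])
    fix j assume j: "j \<in> J"
    then have "0 < ln (2 * real (N j))" using N1[OF j] by simp
    then show "0 < \<omega> j * sqrt (2 * ln (2 * real (N j)))" using \<omega>(1)[OF j] by simp
  qed
  define \<rho> where "\<rho> = 4 * \<Sigma> / sqrt m"
  have \<rho>: "0 < \<rho>" using \<Sigma> m by (simp add: \<rho>_def)
  define p where "p h = Max ((\<lambda>i. \<bar>dot B (inner (w i)) h\<bar>) ` I)" for h
  have ple: "\<bar>dot B (inner (w i)) h\<bar> \<le> p h" if "i \<in> I" for h i
    unfolding p_def using that I by (intro Max_ge) auto
  have p: "sublinear p" unfolding p_def[abs_def] by (rule sublinear_Max[OF I])
  have nonneg: "0 \<le> p h" for h
    using ple I(2) by (metis abs_ge_zero all_not_in_conv order_trans)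
  have dep: "p h = p h'" if "\<And>d. d \<in> B \<Longrightarrow> h d = h' d" for h h'
  proof -
    have "dot B (inner (w i)) h = dot B (inner (w i)) h'" for i
      unfolding dot_def using that by (intro sum.cong) auto
    then show ?thesis by (simp add: p_def)
  qed
  define X where "X l b = (\<Sum>S\<leftarrow>l. signs S b)" for l and b :: 'a
  have X: "(\<Sum>S\<leftarrow>l. dot B (signs S) x) = dot B x (X l)" for l x
  proof (induction l)
    case (Cons S l)
    then show ?case by (simp add: X_def dot_def sum.distrib algebra_simps)
  qed (simp add: X_def dot_def)
  define Q where "Q l = p (X l)" for l
  have Q: "(\<Sum>S\<leftarrow>l. dot B (signs S) x) \<le> Q l" if "\<And>h. dot B x h \<le> p h" for l x
    using that by (simp add: X Q_def)
  have mean: "rows_mean B m Q < 9 / 32 * m * \<rho>"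
  proof -
    have "rows_mean B m Q \<le> rows_mean B m (\<lambda>l. \<Sum>j\<in>J. Max ((\<lambda>i. \<bar>\<Sum>S\<leftarrow>l. dot B (signs S) (inner (v j i))\<bar>) ` I))"
    proof (rule rows_mean_mono[OF B(1)])
      fix l
      have "\<bar>dot B (inner (w i)) (X l)\<bar> \<le> (\<Sum>j\<in>J. Max ((\<lambda>i. \<bar>\<Sum>S\<leftarrow>l. dot B (signs S) (inner (v j i))\<bar>) ` I))"
        if i: "i \<in> I" for i
      proof -
        have "dot B (inner (w i)) (X l) = (\<Sum>j\<in>J. dot B (inner (v j i)) (X l))"
          unfolding dot_def w_def inner_sum_left sum_distrib_right by (rule sum.swap)
        also have "\<bar>\<dots>\<bar> \<le> (\<Sum>j\<in>J. \<bar>dot B (inner (v j i)) (X l)\<bar>)" by (rule sum_abs)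
        also have "\<dots> \<le> (\<Sum>j\<in>J. Max ((\<lambda>i. \<bar>\<Sum>S\<leftarrow>l. dot B (signs S) (inner (v j i))\<bar>) ` I))"
          unfolding X using I(1) i by (intro sum_mono Max_ge) auto
        finally show ?thesis .
      qed
      then show "Q l \<le> (\<Sum>j\<in>J. Max ((\<lambda>i. \<bar>\<Sum>S\<leftarrow>l. dot B (signs S) (inner (v j i))\<bar>) ` I))"
        unfolding Q_def p_def using I by (intro Max.boundedI) auto
    qed
    also have "\<dots> = (\<Sum>j\<in>J. rows_mean B m (\<lambda>l. Max ((\<lambda>i. \<bar>\<Sum>S\<leftarrow>l. dot B (signs S) (inner (v j i))\<bar>) ` I)))"
      by (rule rows_mean_sum)
    also have "\<dots> \<le> (\<Sum>j\<in>J. sqrt m * (\<omega> j * sqrt (2 * ln (2 * real (N j)))))"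
    proof (rule sum_mono)
      fix j assume j: "j \<in> J"
      show "rows_mean B m (\<lambda>l. Max ((\<lambda>i. \<bar>\<Sum>S\<leftarrow>l. dot B (signs S) (inner (v j i))\<bar>) ` I))
          \<le> sqrt m * (\<omega> j * sqrt (2 * ln (2 * real (N j))))"
      proof (rule rows_mean_max[OF B(1) I m, where V="inner ` v j ` I"])
        show "card (inner ` v j ` I) \<le> N j"
          using N[OF j] card_image_le[of "v j ` I" inner] I(1) by simp
        fix x assume "x \<in> inner ` v j ` I"
        then obtain i where i: "i \<in> I" "x = inner (v j i)" by blast
        have "dot B x x \<le> (norm (v j i))\<^sup>2" unfolding i by (rule exp(2))
        also have "\<dots> \<le> (\<omega> j)\<^sup>2" using \<omega>(2)[OF j i(1)] by (intro power_mono) auto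
        finally show "dot B x x \<le> (\<omega> j)\<^sup>2" .
      qed (use I \<omega>(1)[OF j] in auto)
    qed
    also have "\<dots> = sqrt m * \<Sigma>" by (simp add: \<Sigma>_def sum_distrib_left)
    also have "\<dots> < 9 / 32 * m * \<rho>"
    proof -
      have "9 / 32 * m * \<rho> = 9 / 8 * (sqrt m * \<Sigma>)"
        using m by (simp add: \<rho>_def field_simps)
      moreover have "0 < sqrt m * \<Sigma>" using \<Sigma> m by simp
      ultimately show ?thesis by linarith
    qed
    finally show ?thesis .
  qed
  obtain a where a: "\<And>f. dot B f f \<le> 1 \<Longrightarrow> \<exists>c. p (\<lambda>d. f d - (\<Sum>i<m. c i * a i d)) \<le> 2 * \<rho>"
    using random_subspace[OF B(1) p nonneg dep Q \<rho> mean] by blast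
  have "\<exists>c. \<forall>i\<in>I. \<bar>inner (w i) f - (\<Sum>j<m. c j * dot B (inner (w i)) (a j))\<bar> \<le> 2 * \<rho>" if f: "norm f \<le> 1" for f
  proof -
    have "dot B (inner f) (inner f) \<le> 1"
      by (rule order_trans[OF exp(2)[of f] power_le_one[OF norm_ge_zero f]])
    then obtain c where c: "p (\<lambda>d. inner f d - (\<Sum>j<m. c j * a j d)) \<le> 2 * \<rho>"
      using a by blast
    have "\<bar>inner (w i) f - (\<Sum>j<m. c j * dot B (inner (w i)) (a j))\<bar> \<le> 2 * \<rho>" if i: "i \<in> I" for i
    proof -
      have "dot B (inner (w i)) (\<lambda>d. inner f d - (\<Sum>j<m. c j * a j d)) =
          dot B (inner (w i)) (inner f) - (\<Sum>j<m. c j * dot B (inner (w i)) (a j))"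
        unfolding dot_def right_diff_distrib sum_subtractf sum_distrib_left
        by (subst sum.swap) (simp add: algebra_simps)
      then show ?thesis
        using c ple[OF i, of "\<lambda>d. inner f d - (\<Sum>j<m. c j * a j d)"] exp(1)[OF wB[OF i], of f] by simp
    qed
    then show ?thesis by blast
  qed
  moreover have "2 * \<rho> = 8 / sqrt m * \<Sigma>" by (simp add: \<rho>_def)
  ultimately show ?thesis
    unfolding kolmogorov_approx_def w_def \<Sigma>_def by (intro exI[of _ "\<lambda>j i. dot B (inner (\<Sum>j\<in>J. v j i)) (a j)"]) auto
qed

section \<open>Entropy of finite-dimensional balls\<close>

text \<open>Words over a \<open>\<sigma>\<close>-separated set, read as expansions in base \<open>q\<close>, are again \<open>\<sigma>\<close>-separated: the base is
just large enough for the leading difference to dominate all lower ones.\<close>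

lemma lattice_words_separated:
  fixes X :: "'a::real_normed_vector set"
  assumes s: "\<And>x. x \<in> X \<Longrightarrow> norm x \<le> s" and \<sigma>: "0 < \<sigma>" "\<And>x y. x \<in> X \<Longrightarrow> y \<in> X \<Longrightarrow> x \<noteq> y \<Longrightarrow> \<sigma> \<le> norm (x - y)"
    and q: "q = 1 + 2 * s / \<sigma>" and s0: "0 < s"
    and w: "\<And>l. l < k \<Longrightarrow> w l \<in> X" "\<And>l. l < k \<Longrightarrow> w' l \<in> X" "\<exists>l<k. w l \<noteq> w' l"
  shows "\<sigma> \<le> norm (\<Sum>l<k. q ^ l *\<^sub>R (w l - w' l))"
  using w
proof (induction k)
  case (Suc k)
  have q1: "1 < q" unfolding q using s0 \<sigma>(1) by simp
  show ?case
  proof (cases "w k = w' k")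
    case True
    have "\<exists>l<k. w l \<noteq> w' l" using Suc.prems(3) True by (metis less_Suc_eq)
    then have "\<sigma> \<le> norm (\<Sum>l<k. q ^ l *\<^sub>R (w l - w' l))"
      by (intro Suc.IH Suc.prems) simp_all
    then show ?thesis using True by simp
  next
    case False
    have "norm (\<Sum>l<k. q ^ l *\<^sub>R (w l - w' l)) \<le> (\<Sum>l<k. q ^ l * (2 * s))"
    proof (rule sum_norm_le)
      fix l assume "l \<in> {..<k}"
      then have "norm (w l - w' l) \<le> 2 * s"
        using s[of "w l"] s[of "w' l"] Suc.prems(1,2)[of l] norm_triangle_ineq4[of "w l" "w' l"] by simp
      then show "norm (q ^ l *\<^sub>R (w l - w' l)) \<le> q ^ l * (2 * s)"
        using q1 by (auto intro!: mult_left_mono)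
    qed
    also have "\<dots> = \<sigma> * (q ^ k - 1)"
    proof -
      have "(q - 1) * (\<Sum>l<k. q ^ l) = q ^ k - 1" using power_diff_1_eq[of q k] by simp
      moreover have "2 * s = \<sigma> * (q - 1)" unfolding q using \<sigma>(1) by simp
      ultimately have "(\<Sum>l<k. q ^ l) * (2 * s) = \<sigma> * (q ^ k - 1)"
        by (metis mult.commute mult.left_commute)
      then show ?thesis by (simp only: sum_distrib_right)
    qed
    finally have small: "norm (\<Sum>l<k. q ^ l *\<^sub>R (w l - w' l)) \<le> \<sigma> * (q ^ k - 1)" .
    have "q ^ k * \<sigma> \<le> norm (q ^ k *\<^sub>R (w k - w' k))"
      using \<sigma>(2)[OF Suc.prems(1,2)[of k]] False q1 by simp
    then show ?thesis
      using small norm_diff_ineq[of "q ^ k *\<^sub>R (w k - w' k)" "\<Sum>l<k. q ^ l *\<^sub>R (w l - w' l)"]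
      by (simp add: algebra_simps)
  qed
qed simp

text \<open>The volumetric bound without volume. The expansions of length \<open>k\<close> give \<open>card X ^ k\<close> separated points
whose coordinates are bounded by a multiple of \<open>q ^ k\<close>. Rounding the coordinates finely enough is injective, as
points with close coordinates are close in norm; so \<open>card X ^ k\<close> is at most a constant times \<open>q ^ (k * d)\<close>, and
the constant disappears as \<open>k\<close> grows.\<close>

lemma card_separated_set:
  fixes X :: "'a::real_normed_vector set" and b :: "nat \<Rightarrow> 'a"
  assumes fin: "finite X" and span: "\<And>x. x \<in> X \<Longrightarrow> \<exists>c. x = (\<Sum>j<d. c j *\<^sub>R b j)"
    and s: "0 < s" "\<And>x. x \<in> X \<Longrightarrow> norm x \<le> s"
    and \<sigma>: "0 < \<sigma>" "\<And>x y. x \<in> X \<Longrightarrow> y \<in> X \<Longrightarrow> x \<noteq> y \<Longrightarrow> \<sigma> \<le> norm (x - y)"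
  shows "card X \<le> (1 + 2 * s / \<sigma>) ^ d"
proof -
  define q where "q = 1 + 2 * s / \<sigma>"
  have q: "1 < q" using s(1) \<sigma>(1) by (simp add: q_def)
  define C where "C x = (SOME c. x = (\<Sum>j<d. c j *\<^sub>R b j))" for x
  have C: "x = (\<Sum>j<d. C x j *\<^sub>R b j)" if "x \<in> X" for x
    unfolding C_def by (rule someI_ex[OF span[OF that]])
  define \<Gamma> where "\<Gamma> = (\<Sum>x\<in>X. \<Sum>j<d. \<bar>C x j\<bar>)"
  have \<Gamma>: "\<bar>C x j\<bar> \<le> \<Gamma>" if "x \<in> X" "j < d" for x j
  proof -
    have "\<bar>C x j\<bar> \<le> (\<Sum>j<d. \<bar>C x j\<bar>)" using that by (intro member_le_sum) auto
    also have "\<dots> \<le> \<Gamma>" unfolding \<Gamma>_def using that fin by (intro member_le_sum) (auto intro: sum_nonneg)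
    finally show ?thesis .
  qed
  have \<Gamma>0: "0 \<le> \<Gamma>" unfolding \<Gamma>_def by (intro sum_nonneg) auto
  define \<beta> where "\<beta> = 1 + (\<Sum>j<d. norm (b j))"
  have \<beta>: "1 \<le> \<beta>" unfolding \<beta>_def by (simp add: sum_nonneg)
  define \<mu> where "\<mu> = 2 * \<beta> / \<sigma>"
  have \<mu>: "0 < \<mu>" using \<beta> \<sigma>(1) by (simp add: \<mu>_def)
  define Y where "Y k w j = (\<Sum>l<k. q ^ l * C (w l) j)" for k w j
  define A where "A = 2 * (\<Gamma> / (q - 1) * \<mu>) + 3"
  have A: "0 < A" using \<Gamma>0 q \<mu> by (auto simp: A_def intro!: add_nonneg_pos)
  have bound: "real (card X) ^ k \<le> (A * q ^ k) ^ d" for k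
  proof -
    define W where "W = PiE {..<k} (\<lambda>_. X)"
    define Z where "Z = \<lfloor>\<Gamma> / (q - 1) * q ^ k * \<mu>\<rfloor> + 1"
    have Z0: "0 \<le> Z" using \<Gamma>0 q \<mu> by (auto simp: Z_def intro!: add_nonneg_nonneg)
    define V where "V = PiE {..<d} (\<lambda>_. {- Z..Z})"
    define \<phi> where "\<phi> w = restrict (\<lambda>j. \<lfloor>Y k w j * \<mu>\<rfloor>) {..<d}" for w
    have WX: "w l \<in> X" if "w \<in> W" "l < k" for w l
      using that by (auto simp: W_def)
    have sumY: "(\<Sum>l<k. q ^ l *\<^sub>R w l) = (\<Sum>j<d. Y k w j *\<^sub>R b j)" if "w \<in> W" for w
    proof -
      have "(\<Sum>l<k. q ^ l *\<^sub>R w l) = (\<Sum>l<k. q ^ l *\<^sub>R (\<Sum>j<d. C (w l) j *\<^sub>R b j))"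
        using C[OF WX[OF that]] by (intro sum.cong) auto
      also have "\<dots> = (\<Sum>j<d. Y k w j *\<^sub>R b j)"
        unfolding Y_def scaleR_sum_right scaleR_sum_left by (subst sum.swap) simp
      finally show ?thesis .
    qed
    have "\<phi> ` W \<subseteq> V"
    proof (intro image_subsetI)
      fix w assume w: "w \<in> W"
      have "\<lfloor>Y k w j * \<mu>\<rfloor> \<in> {- Z..Z}" if j: "j < d" for j
      proof -
        have "\<bar>Y k w j\<bar> \<le> (\<Sum>l<k. \<bar>q ^ l * C (w l) j\<bar>)" unfolding Y_def by (rule sum_abs)
        also have "\<dots> \<le> (\<Sum>l<k. q ^ l * \<Gamma>)"
          using q \<Gamma>[OF WX[OF w] j] by (intro sum_mono) (auto simp: abs_mult intro!: mult_left_mono)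
        also have "\<dots> = \<Gamma> / (q - 1) * (q ^ k - 1)"
          using power_diff_1_eq[of q k] q by (simp add: sum_distrib_right[symmetric])
        also have "\<dots> \<le> \<Gamma> / (q - 1) * q ^ k" using q \<Gamma>0 by (intro mult_left_mono) auto
        finally have "\<bar>Y k w j\<bar> * \<mu> \<le> \<Gamma> / (q - 1) * q ^ k * \<mu>" using \<mu> by (intro mult_right_mono) auto
        then have "\<bar>Y k w j * \<mu>\<bar> \<le> \<Gamma> / (q - 1) * q ^ k * \<mu>" using \<mu> by (simp add: abs_mult)
        then show ?thesis unfolding Z_def atLeastAtMost_iff by linarith
      qed
      then show "\<phi> w \<in> V" by (auto simp: \<phi>_def V_def)
    qed
    moreover have "inj_on \<phi> W"
    proof (rule inj_onI, rule ccontr)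
      fix w w' assume w: "w \<in> W" "w' \<in> W" "\<phi> w = \<phi> w'" "w \<noteq> w'"
      have ex: "\<exists>l<k. w l \<noteq> w' l"
      proof (rule ccontr)
        assume "\<not> ?thesis"
        then have "w = w'" using w(1,2) unfolding W_def by (intro PiE_ext) auto
        with w(4) show False by simp
      qed
      have "\<bar>Y k w j - Y k w' j\<bar> \<le> 1 / \<mu>" if j: "j < d" for j
      proof -
        have "\<lfloor>Y k w j * \<mu>\<rfloor> = \<lfloor>Y k w' j * \<mu>\<rfloor>"
          using fun_cong[OF w(3), of j] j by (simp add: \<phi>_def)
        then have "\<bar>Y k w j * \<mu> - Y k w' j * \<mu>\<bar> \<le> 1" by linarith
        then have "\<bar>Y k w j - Y k w' j\<bar> * \<mu> \<le> 1" using \<mu>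
          by (simp add: left_diff_distrib[symmetric] abs_mult)
        then show ?thesis using \<mu> by (simp add: field_simps)
      qed
      then have "norm (\<Sum>j<d. (Y k w j - Y k w' j) *\<^sub>R b j) \<le> (\<Sum>j<d. 1 / \<mu> * norm (b j))"
        unfolding lessThan_iff[symmetric] by (intro sum_norm_le, unfold norm_scaleR real_norm_def) (intro mult_right_mono, auto)
      also have "\<dots> \<le> 1 / \<mu> * \<beta>" using \<mu> by (simp add: \<beta>_def sum_divide_distrib[symmetric] divide_right_mono)
      also have "\<dots> = \<sigma> / 2" using \<beta> \<sigma>(1) by (simp add: \<mu>_def)
      also have "(\<Sum>j<d. (Y k w j - Y k w' j) *\<^sub>R b j) = (\<Sum>l<k. q ^ l *\<^sub>R (w l - w' l))"
        by (simp add: sumY[OF w(1), symmetric] sumY[OF w(2), symmetric] algebra_simps sum_subtractf)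
      finally have "norm (\<Sum>l<k. q ^ l *\<^sub>R (w l - w' l)) < \<sigma>" using \<sigma>(1) by linarith
      moreover have "\<sigma> \<le> norm (\<Sum>l<k. q ^ l *\<^sub>R (w l - w' l))"
        by (rule lattice_words_separated[OF s(2) \<sigma> q_def s(1)]) (use WX w ex in auto)
      ultimately show False by linarith
    qed
    moreover have "finite V" unfolding V_def by (intro finite_PiE) auto
    ultimately have "card W \<le> card V" by (intro card_inj_on_le)
    then have "card X ^ k \<le> nat (2 * Z + 1) ^ d"
      by (simp add: W_def V_def card_PiE)
    then have "real (card X) ^ k \<le> real (nat (2 * Z + 1)) ^ d"
      by (metis of_nat_le_iff of_nat_power)
    also have "\<dots> \<le> (A * q ^ k) ^ d"
    proof (rule power_mono)
      have "real (nat (2 * Z + 1)) = 2 * of_int Z + 1" using Z0 by simp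
      also have "\<dots> \<le> 2 * (\<Gamma> / (q - 1) * q ^ k * \<mu>) + 3"
      proof -
        have "2 * of_int (\<lfloor>x\<rfloor> + 1) + 1 \<le> 2 * x + 3" for x :: real
          using of_int_floor_le[of x] by simp
        then show ?thesis unfolding Z_def .
      qed
      also have "\<dots> \<le> 2 * (\<Gamma> / (q - 1) * q ^ k * \<mu>) + 3 * q ^ k"
        using q one_le_power[of q k] by simp
      also have "\<dots> = A * q ^ k" by (simp add: A_def algebra_simps)
      finally show "real (nat (2 * Z + 1)) \<le> A * q ^ k" .
    qed simp
    finally show ?thesis .
  qed
  have "real (card X) \<le> q ^ d"
  proof (rule ccontr)
    assume "\<not> ?thesis"
    then have x: "1 < real (card X) / q ^ d" using q by (simp add: field_simps)
    then obtain k where "A ^ d < (real (card X) / q ^ d) ^ k"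
      using real_arch_pow by blast
    then have "A ^ d * (q ^ d) ^ k < real (card X) ^ k"
      using q by (simp add: power_divide field_simps)
    also have "\<dots> \<le> (A * q ^ k) ^ d" by (rule bound)
    also have "\<dots> = A ^ d * (q ^ d) ^ k"
      by (simp add: power_mult_distrib power_mult[symmetric] mult.commute)
    finally show False by simp
  qed
  then show ?thesis by (simp add: q_def)
qed

lemma finite_dimensional_covering:
  fixes b :: "nat \<Rightarrow> 'a::real_normed_vector"
  assumes s: "0 < s" and \<epsilon>: "0 < \<epsilon>"
  shows "\<exists>X. finite X \<and> X \<noteq> {} \<and> real (card X) \<le> (1 + 2 * s / \<epsilon>) ^ d \<and>
    (\<forall>c. norm (\<Sum>j<d. c j *\<^sub>R b j) \<le> s \<longrightarrow> (\<exists>x\<in>X. norm ((\<Sum>j<d. c j *\<^sub>R b j) - x) \<le> \<epsilon>))"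
proof -
  define P where "P X \<longleftrightarrow> finite X \<and> (\<forall>x\<in>X. norm x \<le> s \<and> (\<exists>c. x = (\<Sum>j<d. c j *\<^sub>R b j))) \<and>
    (\<forall>x\<in>X. \<forall>y\<in>X. x \<noteq> y \<longrightarrow> \<epsilon> \<le> norm (x - y))" for X
  have P_card: "real (card X) \<le> (1 + 2 * s / \<epsilon>) ^ d" if "P X" for X
    using that unfolding P_def by (intro card_separated_set[where b=b]) (auto simp: s \<epsilon>)
  have "P {0}" using s by (auto simp: P_def intro!: exI[of _ "\<lambda>_. 0"])
  moreover have "\<forall>X. P X \<longrightarrow> card X < Suc (nat \<lfloor>(1 + 2 * s / \<epsilon>) ^ d\<rfloor>)"
    using P_card by (simp add: le_nat_floor less_Suc_eq_le)
  ultimately obtain X where X: "P X" "\<And>X'. P X' \<Longrightarrow> card X' \<le> card X"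
    using Lattices_Big.ex_has_greatest_nat[of P "{0}" card] by blast
  have "\<exists>x\<in>X. norm (y - x) \<le> \<epsilon>" if y: "y = (\<Sum>j<d. c j *\<^sub>R b j)" "norm y \<le> s" for y c
  proof (rule ccontr)
    assume "\<not> ?thesis"
    then have far: "\<And>x. x \<in> X \<Longrightarrow> \<epsilon> < norm (y - x)" by force
    then have "y \<notin> X" using \<epsilon> by force
    moreover have "P (insert y X)"
      using X(1) far y less_imp_le[OF far] unfolding P_def by (auto simp: norm_minus_commute)
    ultimately show False using X(2)[of "insert y X"] X(1) by (simp add: P_def)
  qed
  moreover have "X \<noteq> {}" using X(2)[OF \<open>P {0}\<close>] by auto
  ultimately show ?thesis
    using X(1) P_card[OF X(1)] by (intro exI[of _ X]) (auto simp: P_def)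
qed

section \<open>Entropy and Kolmogorov numbers from finite-rank approximation\<close>

definition finite_rank_approx ::
    "nat \<Rightarrow> real \<Rightarrow> ('a::real_normed_vector \<Rightarrow> 'b::real_normed_vector) \<Rightarrow> bool" where
  "finite_rank_approx m \<delta> T \<longleftrightarrow>
     (\<exists>g :: nat \<Rightarrow> 'b. \<forall>f. norm f \<le> 1 \<longrightarrow> (\<exists>c. norm (T f - (\<Sum>j<m. c j *\<^sub>R g j)) \<le> \<delta>))"

text \<open>The infima and suprema in the definition are those of sets of reals, so boundedness has to be checked
throughout.\<close>

lemma kolmogorov_number_le:
  fixes T :: "'a::real_normed_vector \<Rightarrow> 'b::real_normed_vector"
  assumes T: "bounded_linear T" and approx: "finite_rank_approx m \<delta> T" and m: "m < n"
  shows "kolmogorov_number n T \<le> \<delta>"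
proof -
  obtain g :: "nat \<Rightarrow> 'b" where g: "\<And>f. norm f \<le> 1 \<Longrightarrow> \<exists>c. norm (T f - (\<Sum>j<m. c j *\<^sub>R g j)) \<le> \<delta>"
    using approx by (auto simp: finite_rank_approx_def)
  define F where "F = span (g ` {..<m})"
  have F: "subspace F" "\<exists>B. finite B \<and> span B = F" "dim F < n"
  proof -
    have "dim F \<le> card (g ` {..<m})" unfolding F_def by (simp add: dim_le_card')
    also have "\<dots> \<le> m" using card_image_le[of "{..<m}" g] by simp
    finally show "dim F < n" using m by simp
    show "\<exists>B. finite B \<and> span B = F" by (intro exI[of _ "g ` {..<m}"]) (simp add: F_def)
  qed (simp add: F_def)
  have bdd: "bdd_below (norm ` quotient_map G y)" for G and y :: 'b
    by (rule bdd_belowI2[where m=0]) simp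
  have qn_nonneg: "0 \<le> quotient_norm (quotient_map G y)" if "subspace G" for G and y :: 'b
    unfolding quotient_norm_def using subspace_0[OF that] by (intro cINF_greatest) (auto simp: quotient_map_def)
  have qn_le: "quotient_norm (quotient_map G y) \<le> norm (y + z)" if "z \<in> G" for G and y z :: 'b
    unfolding quotient_norm_def using that by (intro cINF_lower bdd) (auto simp: quotient_map_def)
  have on_nonneg: "0 \<le> quotient_onorm G T" if G: "subspace G" for G
  proof -
    have "bdd_above ((\<lambda>x. quotient_norm (quotient_map G (T x))) ` cball 0 1)"
    proof (rule bdd_aboveI2)
      fix x :: 'a assume "x \<in> cball 0 1"
      then have "onorm T * norm x \<le> onorm T * 1"
        using onorm_pos_le[OF T] by (intro mult_left_mono) auto
      then have "norm (T x) \<le> onorm T * 1" using onorm[OF T, of x] by linarith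
      then show "quotient_norm (quotient_map G (T x)) \<le> onorm T"
        using qn_le[OF subspace_0[OF G], of "T x"] by simp
    qed
    then have "quotient_norm (quotient_map G (T 0)) \<le> quotient_onorm G T"
      unfolding quotient_onorm_def by (intro cSUP_upper) auto
    with qn_nonneg[OF G] show ?thesis by (metis order_trans)
  qed
  have "kolmogorov_number n T \<le> quotient_onorm F T"
    unfolding kolmogorov_number_def
  proof (rule cInf_lower)
    show "bdd_below {quotient_onorm F T |F. subspace F \<and> (\<exists>B. finite B \<and> span B = F) \<and> dim F < n}"
      using on_nonneg by (intro bdd_belowI[of _ 0]) auto
  qed (use F in blast)
  also have "\<dots> \<le> \<delta>"
    unfolding quotient_onorm_def
  proof (rule cSUP_least)
    fix f :: 'a assume "f \<in> cball 0 1"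
    then obtain c where c: "norm (T f - (\<Sum>j<m. c j *\<^sub>R g j)) \<le> \<delta>" using g by auto
    have "- (\<Sum>j<m. c j *\<^sub>R g j) \<in> F"
      unfolding F_def by (intro span_neg span_sum span_scale span_base) auto
    then show "quotient_norm (quotient_map F (T f)) \<le> \<delta>"
      using qn_le[of "- (\<Sum>j<m. c j *\<^sub>R g j)" F "T f"] c by simp
  qed auto
  finally show ?thesis .
qed

lemma dyadic_entropy_number_le:
  fixes T :: "'a::real_normed_vector \<Rightarrow> 'b::real_normed_vector"
  assumes X: "finite X" "card X \<le> 2 ^ (n - 1)" and \<epsilon>: "0 \<le> \<epsilon>"
    and cover: "\<And>f. norm f \<le> 1 \<Longrightarrow> \<exists>x\<in>X. norm (T f - x) \<le> \<epsilon>"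
  shows "dyadic_entropy_number n T \<le> \<epsilon>"
  unfolding dyadic_entropy_number_def entropy_eps_def
proof (rule cInf_lower)
  obtain h where h: "bij_betw h {1..card X} X"
    using ex_bij_betw_nat_finite_1[OF X(1)] by blast
  have "T ` cball 0 1 \<subseteq> (\<Union>i\<in>{1..2 ^ (n - 1)}. cball (h i) \<epsilon>)"
  proof (intro image_subsetI)
    fix f :: 'a assume "f \<in> cball 0 1"
    then obtain x where x: "x \<in> X" "norm (T f - x) \<le> \<epsilon>" using cover[of f] by auto
    have "x \<in> h ` {1..card X}" using x(1) bij_betw_imp_surj_on[OF h] by simp
    then obtain i where "i \<in> {1..card X}" "h i = x" by auto
    then show "T f \<in> (\<Union>i\<in>{1..2 ^ (n - 1)}. cball (h i) \<epsilon>)"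
      using x X(2) by (intro UN_I[of i]) (auto simp: dist_norm norm_minus_commute)
  qed
  with \<epsilon> show "\<epsilon> \<in> {\<epsilon>. 0 \<le> \<epsilon> \<and> (\<exists>x :: nat \<Rightarrow> 'b. T ` cball 0 1 \<subseteq> (\<Union>i\<in>{1..2 ^ (n - 1)}. cball (x i) \<epsilon>))}"
    by (intro CollectI conjI exI[of _ h])
  show "bdd_below {\<epsilon>. 0 \<le> \<epsilon> \<and> (\<exists>x :: nat \<Rightarrow> 'b. T ` cball 0 1 \<subseteq> (\<Union>i\<in>{1..2 ^ (n - 1)}. cball (x i) \<epsilon>))}"
    by (rule bdd_belowI[of _ 0]) auto
qed

lemma doubling_iterate:
  fixes R :: "nat \<Rightarrow> real"
  assumes "\<And>p. R p \<le> D * R (Suc p)" "1 \<le> D"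
  shows "R p \<le> D ^ k * R (p + k)"
proof (induction k)
  case (Suc k)
  have "D ^ k * R (p + k) \<le> D ^ k * (D * R (Suc (p + k)))"
    using assms by (intro mult_left_mono) auto
  with Suc show ?case by (simp add: algebra_simps)
qed simp

lemma sum_weighted_powers_2: "(\<Sum>p<K. (K - p + 1) * 2 ^ p) + (K + 3) = 3 * (2 :: nat) ^ K"
proof (induction K)
  case (Suc K)
  have "(\<Sum>p<K. (Suc K - p + 1) * 2 ^ p) = (\<Sum>p<K. (K - p + 1) * 2 ^ p + 2 ^ p :: nat)"
    by (intro sum.cong) (auto simp: Suc_diff_le less_imp_le)
  also have "\<dots> = (\<Sum>p<K. (K - p + 1) * 2 ^ p) + (\<Sum>p<K. 2 ^ p)" by (rule sum.distrib)
  finally have *: "(\<Sum>p<K. (Suc K - p + 1) * 2 ^ p) = (\<Sum>p<K. (K - p + 1) * 2 ^ p) + (\<Sum>p<K. 2 ^ p :: nat)" .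
  have geo: "(\<Sum>p<K. 2 ^ p :: nat) + 1 = 2 ^ K" by (induction K) auto
  have "(\<Sum>p<Suc K. (Suc K - p + 1) * 2 ^ p) = (\<Sum>p<K. (K - p + 1) * 2 ^ p) + (\<Sum>p<K. 2 ^ p :: nat) + 2 * 2 ^ K"
    unfolding sum.lessThan_Suc * by simp
  then show ?case using Suc geo by simp
qed simp

text \<open>Carl's argument. Let \<open>h p f\<close> be the approximation of \<open>T f\<close> of rank \<open>c * 2 ^ p\<close>. The difference of two
successive ones lies in a space of dimension \<open>3 * c * 2 ^ p\<close> and in a ball of radius at most
\<open>2 * D ^ (K - p) * R K\<close>. Covering it up to \<open>2 * R K / 2 ^ (K - p)\<close> costs \<open>O ((K - p + 1) * 2 ^ p)\<close> bits;
errors and bits both sum up over \<open>p < K\<close>, to \<open>2 * R K\<close> and \<open>O (2 ^ K)\<close>.\<close>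

lemma covering_from_approximation:
  fixes T :: "'a::real_normed_vector \<Rightarrow> 'b::real_normed_vector" and R :: "nat \<Rightarrow> real"
  assumes approx: "\<And>p. finite_rank_approx (c * 2 ^ p) (R p) T"
    and R0: "\<And>f. norm f \<le> 1 \<Longrightarrow> norm (T f) \<le> R 0"
    and R: "\<And>p. 0 < R p" "\<And>p. R p \<le> D * R (Suc p)" "1 \<le> D"
  shows "\<exists>E>0. \<forall>K. \<exists>X. finite X \<and> X \<noteq> {} \<and> card X \<le> 2 ^ (E * 2 ^ K) \<and>
    (\<forall>f. norm f \<le> 1 \<longrightarrow> (\<exists>x\<in>X. norm (T f - x) \<le> 3 * R K))"
proof -
  obtain b where b: "1 + 4 * D \<le> 2 ^ b"
    using real_arch_pow[of 2 "1 + 4 * D"] less_imp_le by (metis one_less_numeral_iff semiring_norm(76))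
  define g where "g p = (SOME g :: nat \<Rightarrow> 'b. \<forall>f. norm f \<le> 1 \<longrightarrow>
      (\<exists>a. norm (T f - (\<Sum>j<c * 2 ^ p. a j *\<^sub>R g j)) \<le> R p))" for p
  have g: "\<forall>f. norm f \<le> 1 \<longrightarrow> (\<exists>a. norm (T f - (\<Sum>j<c * 2 ^ p. a j *\<^sub>R g p j)) \<le> R p)" for p
    unfolding g_def by (rule someI_ex[OF approx[unfolded finite_rank_approx_def]])
  define a where "a p f = (SOME a. norm (T f - (\<Sum>j<c * 2 ^ p. a j *\<^sub>R g p j)) \<le> R p)" for p f
  have a: "norm (T f - (\<Sum>j<c * 2 ^ p. a p f j *\<^sub>R g p j)) \<le> R p" if "norm f \<le> 1" for p f
    using someI_ex[OF g[rule_format, OF that]] unfolding a_def .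
  \<comment> \<open>The telescoping sum starts at zero; rank \<open>0\<close> is good enough for \<open>p = 0\<close> since the norm of \<open>T\<close> is at most \<open>R 0\<close>.\<close>
  define a' where "a' p f j = (if p = 0 then 0 else a p f j)" for p f j
  define h where "h p f = (\<Sum>j<c * 2 ^ p. a' p f j *\<^sub>R g p j)" for p f
  have h: "norm (T f - h p f) \<le> R p" if "norm f \<le> 1" for p f
    using a[OF that, of p] R0[OF that] by (cases "p = 0") (auto simp: h_def a'_def)
  have h0: "h 0 f = 0" for f by (simp add: h_def a'_def)
  define E where "E = 9 * (b * c) + 1"
  have "\<exists>X. finite X \<and> X \<noteq> {} \<and> card X \<le> 2 ^ (E * 2 ^ K) \<and>
    (\<forall>f. norm f \<le> 1 \<longrightarrow> (\<exists>x\<in>X. norm (T f - x) \<le> 3 * R K))" for K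
  proof -
    define \<epsilon> where "\<epsilon> p = 2 * R K / 2 ^ (K - p)" for p
    define s where "s p = 2 * D ^ (K - p) * R K" for p
    define e where "e p = 3 * (b * c) * ((K - p + 1) * 2 ^ p)" for p
    have pos: "0 < \<epsilon> p" "0 < s p" for p using R by (auto simp: \<epsilon>_def s_def)
    have step: "\<exists>X. finite X \<and> X \<noteq> {} \<and> card X \<le> 2 ^ e p \<and>
        (\<forall>f. norm f \<le> 1 \<longrightarrow> (\<exists>x\<in>X. norm (h (Suc p) f - h p f - x) \<le> \<epsilon> p))" if p: "p < K" for p
    proof -
      define d where "d = c * 2 ^ p + c * 2 ^ Suc p"
      define B where "B j = (if j < c * 2 ^ p then g p j else g (Suc p) (j - c * 2 ^ p))" for j
      obtain X where X: "finite X" "X \<noteq> {}" "real (card X) \<le> (1 + 2 * s p / \<epsilon> p) ^ d"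
          "\<And>k. norm (\<Sum>j<d. k j *\<^sub>R B j) \<le> s p \<Longrightarrow> \<exists>x\<in>X. norm ((\<Sum>j<d. k j *\<^sub>R B j) - x) \<le> \<epsilon> p"
        using finite_dimensional_covering[OF pos(2) pos(1), of p p d B] by blast
      define x where "x = (1 + 4 * D) ^ (K - p)"
      define n where "n = K - p"
      have ratio: "1 + 2 * s p / \<epsilon> p = 1 + 2 * (2 * D) ^ n"
        using R(1)[of K] by (simp add: s_def \<epsilon>_def n_def power_mult_distrib field_simps)
      have x: "1 \<le> x" "(2 * D) ^ n \<le> x"
        unfolding x_def n_def using R(3) by (intro one_le_power power_mono; simp)+
      have "x \<le> D * x" using x(1) R(3) by simp
      moreover have "(1 + 4 * D) ^ Suc n = x + 4 * (D * x)" by (simp add: x_def n_def algebra_simps)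
      ultimately have "1 + 2 * (2 * D) ^ n \<le> (1 + 4 * D) ^ Suc n" using x by linarith
      moreover have "(1 + 4 * D) ^ Suc n \<le> (2 ^ b) ^ Suc n" using b R(3) by (intro power_mono) auto
      ultimately have "1 + 2 * s p / \<epsilon> p \<le> (2 ^ b) ^ Suc n" unfolding ratio by linarith
      moreover have "0 \<le> 1 + 2 * s p / \<epsilon> p" unfolding ratio using R(3) by simp
      ultimately have "(1 + 2 * s p / \<epsilon> p) ^ d \<le> ((2 ^ b) ^ Suc n) ^ d" by (rule power_mono)
      moreover have "((2 ^ b) ^ Suc n) ^ d = (2 :: real) ^ e p"
      proof -
        have "b * Suc n * d = e p" by (simp add: d_def e_def n_def algebra_simps)
        then show ?thesis by (simp only: power_mult[symmetric])
      qed
      ultimately have "real (card X) \<le> 2 ^ e p" using X(3) by linarith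
      then have card: "card X \<le> 2 ^ e p" by simp
      have "\<exists>x\<in>X. norm (h (Suc p) f - h p f - x) \<le> \<epsilon> p" if f: "norm f \<le> 1" for f
      proof -
        define k where "k j = (if j < c * 2 ^ p then - a' p f j else a' (Suc p) f (j - c * 2 ^ p))" for j
        have eq: "(\<Sum>j<d. k j *\<^sub>R B j) = h (Suc p) f - h p f"
          unfolding d_def sum_lessThan_add by (simp add: k_def B_def h_def sum_negf)
        have Kp: "R p \<le> D ^ (K - p) * R K"
          using doubling_iterate[of R D p "K - p", OF R(2,3)] p by simp
        have "R (Suc p) \<le> D ^ (K - Suc p) * R K"
          using doubling_iterate[of R D "Suc p" "K - Suc p", OF R(2,3)] p by simp
        also have "\<dots> \<le> D ^ (K - p) * R K"
          using R(1)[of K] R(3) by (intro mult_right_mono power_increasing) auto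
        finally have "norm (h (Suc p) f - h p f) \<le> s p"
          using h[OF f, of p] h[OF f, of "Suc p"] Kp norm_triangle_ineq4[of "T f - h p f" "T f - h (Suc p) f"]
          by (simp add: s_def)
        then show ?thesis using X(4)[of k] by (simp add: eq)
      qed
      then show ?thesis using X(1,2) card by blast
    qed
    have "\<exists>X. finite X \<and> X \<noteq> {} \<and> card X \<le> 2 ^ (\<Sum>p<q. e p) \<and>
        (\<forall>f. norm f \<le> 1 \<longrightarrow> (\<exists>x\<in>X. norm (h q f - x) \<le> (\<Sum>p<q. \<epsilon> p)))" if "q \<le> K" for q
      using that
    proof (induction q)
      case 0
      show ?case by (intro exI[of _ "{0}"]) (simp add: h0)
    next
      case (Suc q)
      then obtain X where X: "finite X" "X \<noteq> {}" "card X \<le> 2 ^ (\<Sum>p<q. e p)"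
          "\<And>f. norm f \<le> 1 \<Longrightarrow> \<exists>x\<in>X. norm (h q f - x) \<le> (\<Sum>p<q. \<epsilon> p)" by auto
      obtain Y where Y: "finite Y" "Y \<noteq> {}" "card Y \<le> 2 ^ e q"
          "\<And>f. norm f \<le> 1 \<Longrightarrow> \<exists>y\<in>Y. norm (h (Suc q) f - h q f - y) \<le> \<epsilon> q"
        using step[of q] Suc.prems by auto
      define Z where "Z = (\<lambda>(x, y). x + y) ` (X \<times> Y)"
      have "card Z \<le> card X * card Y"
        unfolding Z_def using card_image_le[of "X \<times> Y"] X Y by (simp add: card_cartesian_product)
      also have "\<dots> \<le> 2 ^ (\<Sum>p<q. e p) * 2 ^ e q" using X Y by (intro mult_mono) auto
      finally have "card Z \<le> 2 ^ (\<Sum>p<Suc q. e p)" by (simp add: power_add)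
      moreover have "\<exists>z\<in>Z. norm (h (Suc q) f - z) \<le> (\<Sum>p<Suc q. \<epsilon> p)" if f: "norm f \<le> 1" for f
      proof -
        obtain x y where xy: "x \<in> X" "y \<in> Y" "norm (h q f - x) \<le> (\<Sum>p<q. \<epsilon> p)"
            "norm (h (Suc q) f - h q f - y) \<le> \<epsilon> q"
          using X(4)[OF f] Y(4)[OF f] by blast
        have eq: "h (Suc q) f - (x + y) = (h q f - x) + (h (Suc q) f - h q f - y)" by simp
        have "norm (h (Suc q) f - (x + y)) \<le> norm (h q f - x) + norm (h (Suc q) f - h q f - y)"
          unfolding eq by (rule norm_triangle_ineq)
        then have "norm (h (Suc q) f - (x + y)) \<le> (\<Sum>p<Suc q. \<epsilon> p)" using xy by simp
        moreover have "x + y \<in> Z" unfolding Z_def using xy(1,2) by force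
        ultimately show ?thesis by blast
      qed
      ultimately show ?case using X Y by (intro exI[of _ Z]) (auto simp: Z_def)
    qed
    from this[of K] obtain X where X: "finite X" "X \<noteq> {}" "card X \<le> 2 ^ (\<Sum>p<K. e p)"
        "\<And>f. norm f \<le> 1 \<Longrightarrow> \<exists>x\<in>X. norm (h K f - x) \<le> (\<Sum>p<K. \<epsilon> p)" by auto
    have "(\<Sum>p<K. e p) = 3 * (b * c) * (\<Sum>p<K. (K - p + 1) * 2 ^ p)"
      by (simp only: e_def sum_distrib_left)
    also have "\<dots> \<le> 3 * (b * c) * (3 * 2 ^ K)"
      using sum_weighted_powers_2[of K] by (intro mult_left_mono) auto
    also have "\<dots> \<le> E * 2 ^ K" by (simp add: E_def algebra_simps)
    finally have "card X \<le> 2 ^ (E * 2 ^ K)"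
      using X(3) by (meson order_trans power_increasing one_le_numeral)
    moreover have "(\<Sum>p<K. \<epsilon> p) \<le> 2 * R K"
    proof -
      have "(\<Sum>p<K. \<epsilon> p) = (\<Sum>p<K. \<epsilon> (K - Suc p))" by (rule sum.nat_diff_reindex[symmetric])
      also have "\<dots> = (\<Sum>p<K. R K * (1 / 2) ^ p)"
        by (intro sum.cong) (auto simp: \<epsilon>_def power_divide)
      also have "\<dots> = R K * (\<Sum>p<K. (1 / 2) ^ p)" by (simp add: sum_distrib_left)
      also have "(\<Sum>p<K. (1 / 2 :: real) ^ p) = 2 * (1 - (1 / 2) ^ K)"
        by (simp add: sum_gp_strict)
      also have "R K * \<dots> \<le> R K * 2" using R(1)[of K] by (intro mult_left_mono) auto
      finally show ?thesis by simp
    qed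
    moreover have "\<exists>x\<in>X. norm (T f - x) \<le> 3 * R K" if f: "norm f \<le> 1" for f
    proof -
      obtain x where x: "x \<in> X" "norm (h K f - x) \<le> (\<Sum>p<K. \<epsilon> p)" using X(4)[OF f] by blast
      have "norm (T f - x) \<le> norm (T f - h K f) + norm (h K f - x)"
        using norm_triangle_ineq[of "T f - h K f" "h K f - x"] by simp
      with x h[OF f, of K] calculation(2) show ?thesis by (intro bexI[of _ x]) auto
    qed
    ultimately show ?thesis using X(1,2) by blast
  qed
  moreover have "E > 0" by (simp add: E_def)
  ultimately show ?thesis by blast
qed

lemma finite_rank_approx_mono:
  fixes T :: "'a::real_normed_vector \<Rightarrow> 'b::real_normed_vector"
  assumes "finite_rank_approx m \<delta> T" "m \<le> m'" "\<delta> \<le> \<delta>'"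
  shows "finite_rank_approx m' \<delta>' T"
proof -
  obtain g :: "nat \<Rightarrow> 'b" where g: "\<And>f. norm f \<le> 1 \<Longrightarrow> \<exists>c. norm (T f - (\<Sum>j<m. c j *\<^sub>R g j)) \<le> \<delta>"
    using assms(1) by (auto simp: finite_rank_approx_def)
  have "\<exists>c. norm (T f - (\<Sum>j<m'. c j *\<^sub>R g j)) \<le> \<delta>'" if f: "norm f \<le> 1" for f
  proof -
    obtain c where c: "norm (T f - (\<Sum>j<m. c j *\<^sub>R g j)) \<le> \<delta>" using g[OF f] by blast
    have "(\<Sum>j<m'. (if j < m then c j else 0) *\<^sub>R g j) = (\<Sum>j<m. c j *\<^sub>R g j)"
      using assms(2) by (intro sum.mono_neutral_cong_right) auto
    then show ?thesis using c assms(3) by (intro exI[of _ "\<lambda>j. if j < m then c j else 0"]) auto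
  qed
  then show ?thesis unfolding finite_rank_approx_def by blast
qed

text \<open>Approximations of rank \<open>c * 2 ^ p\<close> for large \<open>p\<close> determine both kinds of numbers: a factor in the rank is a
shift of \<open>p\<close>, which the doubling property of \<open>R\<close> absorbs, and for small \<open>p\<close> the bound by the norm of \<open>T\<close> is
used, after enlarging \<open>R\<close> by a constant factor.\<close>

lemma dominated_of_dyadic_approximation:
  fixes T :: "'a::real_normed_vector \<Rightarrow> 'b::real_normed_vector"
    and R r :: "nat \<Rightarrow> real"
  assumes T: "bounded_linear T"
    and approx: "\<And>p. p0 \<le> p \<Longrightarrow> finite_rank_approx (c * 2 ^ p) (C * R p) T"
    and R: "\<And>p. 0 < R p" "\<And>p. R p \<le> D * R (Suc p)"
    and r: "0 < \<kappa>" "\<And>n p. 2 ^ p \<le> n \<Longrightarrow> n < 2 ^ Suc p \<Longrightarrow> \<kappa> * R p \<le> r n"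
    and s: "s = kolmogorov_number \<or> s = dyadic_entropy_number"
  shows "(\<lambda>n. s n T) \<preceq>\<^sub>c r"
proof -
  define D' where "D' = max 1 D"
  have R': "R p \<le> D' * R (Suc p)" "1 \<le> D'" for p
  proof -
    have "D * R (Suc p) \<le> D' * R (Suc p)" using R(1)[of "Suc p"] by (intro mult_right_mono) (auto simp: D'_def)
    with R(2)[of p] show "R p \<le> D' * R (Suc p)" by linarith
  qed (simp add: D'_def)
  define C' where "C' = \<bar>C\<bar> + onorm T * D' ^ p0 / R 0 + 1"
  have onn: "0 \<le> onorm T" by (rule onorm_pos_le[OF T])
  have "0 \<le> onorm T * D' ^ p0 / R 0" using onn R(1)[of 0] R'(2) by simp
  then have C': "0 < C'" "C \<le> C'" by (simp_all add: C'_def)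
  define Q where "Q p = C' * R p" for p
  have Q: "0 < Q p" "Q p \<le> D' * Q (Suc p)" for p
    using C'(1) R(1)[of p] mult_left_mono[OF R'(1)[of p], of C'] by (simp_all add: Q_def mult.left_commute)
  have normT: "norm (T f) \<le> onorm T" if "norm f \<le> 1" for f
    using order_trans[OF onorm[OF T, of f] mult_left_le[OF that onn]] .
  have small: "onorm T \<le> Q p" if "p \<le> p0" for p
  proof -
    have "R 0 \<le> D' ^ p * R p" using doubling_iterate[of R D' 0 p, OF R'] by simp
    also have "\<dots> \<le> D' ^ p0 * R p" using R'(2) R(1)[of p] that by (intro mult_right_mono power_increasing) auto
    finally have "onorm T * R 0 \<le> onorm T * (D' ^ p0 * R p)" using onn by (intro mult_left_mono) auto
    then have "onorm T \<le> onorm T * D' ^ p0 / R 0 * R p" using R(1)[of 0] by (simp add: field_simps)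
    also have "\<dots> \<le> C' * R p" using R(1)[of p] by (intro mult_right_mono) (auto simp: C'_def)
    finally show ?thesis by (simp add: Q_def)
  qed
  have trivial: "finite_rank_approx m (onorm T) T" for m
    unfolding finite_rank_approx_def using normT by (intro exI[of _ "\<lambda>_. 0"]) auto
  have approxQ: "finite_rank_approx (c * 2 ^ p) (Q p) T" for p
  proof (cases "p0 \<le> p")
    case True
    then show ?thesis
      using C' R(1)[of p] by (intro finite_rank_approx_mono[OF approx[OF True]]) (auto simp: Q_def)
  next
    case False
    then show ?thesis by (intro finite_rank_approx_mono[OF trivial[of 0]] small) auto
  qed
  have iter: "Q (q - b) \<le> D' ^ b * Q q" for q b
  proof -
    have "Q (q - b) \<le> D' ^ (min q b) * Q q"
      using doubling_iterate[of Q D' "q - b" "min q b"] Q(2) R'(2) by (simp add: min_def split: if_splits)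
    also have "\<dots> \<le> D' ^ b * Q q" using R'(2) Q(1)[of q] by (intro mult_right_mono power_increasing) auto
    finally show ?thesis .
  qed
  have main: "\<exists>B. \<forall>n\<ge>1. \<forall>q. 2 ^ q \<le> n \<longrightarrow> n < 2 ^ Suc q \<longrightarrow> s n T \<le> B * Q q"
    using s
  proof
    assume s: "s = kolmogorov_number"
    obtain b where b: "c < 2 ^ b" using less_exp by blast
    have "s n T \<le> D' ^ b * Q q" if n: "1 \<le> n" "2 ^ q \<le> n" "n < 2 ^ Suc q" for n q
    proof (cases "b \<le> q")
      case True
      have "c * 2 ^ (q - b) < 2 ^ b * 2 ^ (q - b)" using b by simp
      also have "\<dots> \<le> n" using n True by (simp add: power_add[symmetric])
      finally have "s n T \<le> Q (q - b)" unfolding s by (rule kolmogorov_number_le[OF T approxQ])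
      with iter[of q b] show ?thesis by linarith
    next
      case False
      have "s n T \<le> onorm T" unfolding s using n by (intro kolmogorov_number_le[OF T trivial[of 0]]) auto
      also have "\<dots> \<le> Q (q - b)" using False by (intro small) auto
      finally show ?thesis using iter[of q b] by linarith
    qed
    then show ?thesis by blast
  next
    assume s: "s = dyadic_entropy_number"
    obtain E where E: "0 < E" "\<And>K. \<exists>X. finite X \<and> X \<noteq> {} \<and> card X \<le> 2 ^ (E * 2 ^ K) \<and>
        (\<forall>f. norm f \<le> 1 \<longrightarrow> (\<exists>x\<in>X. norm (T f - x) \<le> 3 * Q K))"
      using covering_from_approximation[of c Q T D', OF approxQ _ Q R'(2)] order_trans[OF normT small[of 0]]
      by blast
    obtain b where b: "2 * E < 2 ^ b" using less_exp by blast
    have "s n T \<le> 3 * D' ^ b * Q q" if n: "1 \<le> n" "2 ^ q \<le> n" "n < 2 ^ Suc q" for n q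
    proof (cases "b \<le> q")
      case True
      obtain X where X: "finite X" "card X \<le> 2 ^ (E * 2 ^ (q - b))"
          "\<And>f. norm f \<le> 1 \<Longrightarrow> \<exists>x\<in>X. norm (T f - x) \<le> 3 * Q (q - b)"
        using E(2)[of "q - b"] by blast
      have "2 * E * 2 ^ (q - b) \<le> 2 ^ b * 2 ^ (q - b)" using b by (intro mult_right_mono) auto
      also have "\<dots> \<le> n" using n True by (simp add: power_add[symmetric])
      finally have "2 * (E * 2 ^ (q - b)) \<le> n" by simp
      moreover have "1 \<le> E * 2 ^ (q - b)" using E(1) by simp
      ultimately have "E * 2 ^ (q - b) \<le> n - 1" by linarith
      then have "card X \<le> 2 ^ (n - 1)" using X(2) by (meson order_trans power_increasing one_le_numeral)
      then have "s n T \<le> 3 * Q (q - b)"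
        unfolding s using X Q(1)[of "q - b"] by (intro dyadic_entropy_number_le[of X]) auto
      with iter[of q b] show ?thesis by linarith
    next
      case False
      have "s n T \<le> onorm T"
        unfolding s using onn normT by (intro dyadic_entropy_number_le[of "{0}"]) auto
      also have "\<dots> \<le> Q (q - b)" using False by (intro small) auto
      finally show ?thesis using iter[of q b] Q(1)[of "q - b"] by linarith
    qed
    then show ?thesis by blast
  qed
  then obtain B where B: "\<And>n q. 1 \<le> n \<Longrightarrow> 2 ^ q \<le> n \<Longrightarrow> n < 2 ^ Suc q \<Longrightarrow> s n T \<le> B * Q q" by blast
  define A where "A = (\<bar>B\<bar> + 1) * C' / \<kappa>"
  have A: "0 < A" using C' r(1) by (simp add: A_def)
  have "s n T \<le> A * r n" if n: "1 \<le> n" for n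
  proof -
    obtain q where q: "2 ^ q \<le> n" "n < 2 ^ Suc q"
      using ex_power_ivl1[of 2 n] n by auto
    have "s n T \<le> B * Q q" by (rule B[OF n q])
    also have "\<dots> \<le> (\<bar>B\<bar> + 1) * Q q" using Q(1)[of q] by (intro mult_right_mono) auto
    also have "\<dots> = A * (\<kappa> * R q)" using r(1) by (simp add: A_def Q_def)
    also have "\<dots> \<le> A * r n" using A by (intro mult_left_mono r(2)[OF q]) auto
    finally show ?thesis .
  qed
  with A show ?thesis unfolding dominated_def by blast
qed

section \<open>From samples to continuous functions\<close>

text \<open>The hat function of the grid with \<open>M\<close> cells that is \<open>1\<close> at \<open>i / M\<close>.\<close>

definition hat :: "nat \<Rightarrow> nat \<Rightarrow> real \<Rightarrow> real" where
  "hat M i t = max 0 (1 - \<bar>M * t - i\<bar>)"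

lemma sum_hat:
  assumes t: "t \<in> {0..1}"
  shows "(\<Sum>i\<le>M. hat M i t) = 1"
proof (cases "M * t = M")
  case True
  then have "(\<Sum>i\<le>M. hat M i t) = (\<Sum>i\<le>M. if i = M then 1 else 0)"
    by (intro sum.cong) (auto simp: hat_def)
  then show ?thesis by simp
next
  case False
  define k where "k = nat \<lfloor>M * t\<rfloor>"
  have "0 \<le> M * t" "M * t \<le> M" using t by (auto intro: mult_left_le)
  then have k: "real k \<le> M * t" "M * t < k + 1" "k < M"
    using False unfolding k_def by linarith+
  have "(\<Sum>i\<le>M. hat M i t) = (\<Sum>i\<in>{k, Suc k}. hat M i t)"
  proof (rule sum.mono_neutral_right)
    show "\<forall>i\<in>{..M} - {k, Suc k}. hat M i t = 0"
    proof
      fix i assume "i \<in> {..M} - {k, Suc k}"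
      then have "i < k \<or> Suc k < i" by auto
      then have "real i + 1 \<le> k \<or> real k + 2 \<le> i" by linarith
      then show "hat M i t = 0" using k by (auto simp: hat_def)
    qed
  qed (use k in auto)
  also have "\<dots> = 1" using k by (simp add: hat_def)
  finally show ?thesis .
qed

text \<open>As the hat functions are a partition of unity, at each point the interpolant is a mean of the sampled values at
neighbouring grid points; so the error is at most the sampling error plus the modulus of \<open>\<kappa>\<close>.\<close>

lemma finite_rank_approx_of_samples:
  fixes T :: "'a::real_inner \<Rightarrow> C01" and \<kappa> :: "real \<Rightarrow> 'a" and M :: nat
  assumes T: "\<And>f t. apply_bcontfun (T f) t = inner (\<kappa> (real_of_ui t)) f"
    and M: "0 < M"
    and modulus: "\<And>s t. s \<in> {0..1} \<Longrightarrow> t \<in> {0..1} \<Longrightarrow> \<bar>s - t\<bar> \<le> 1 / M \<Longrightarrow> norm (\<kappa> s - \<kappa> t) \<le> \<epsilon>"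
    and approx: "kolmogorov_approx m \<delta> (\<lambda>i. \<kappa> (i / M)) {..M}"
  shows "finite_rank_approx m (\<delta> + \<epsilon>) T"
proof -
  obtain g where g: "\<And>f. norm f \<le> 1 \<Longrightarrow> \<exists>c. \<forall>i\<in>{..M}. \<bar>inner (\<kappa> (i / M)) f - (\<Sum>j<m. c j * g j i)\<bar> \<le> \<delta>"
    using approx by (auto simp: kolmogorov_approx_def)
  define G where "G j = Bcontfun (\<lambda>t. \<Sum>i\<le>M. g j i * hat M i (real_of_ui t))" for j
  have cont: "continuous_on UNIV (\<lambda>t. hat M i (real_of_ui t))" for i
  proof -
    have "continuous_on UNIV real_of_ui"
      by (auto simp: continuous_on_iff dist_unit_interval_def)
    then show ?thesis unfolding hat_def by (intro continuous_intros)
  qed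
  have G: "apply_bcontfun (G j) t = (\<Sum>i\<le>M. g j i * hat M i (real_of_ui t))" for j t
    unfolding G_def by (subst Bcontfun_inverse) (auto intro!: continuous_in_bcontfun continuous_intros cont)
  have app_sum: "apply_bcontfun (\<Sum>j\<in>J. c j *\<^sub>R G j) t = (\<Sum>j\<in>J. c j * apply_bcontfun (G j) t)"
    for J c t by (induction J rule: infinite_finite_induct) auto
  show ?thesis
    unfolding finite_rank_approx_def
  proof (intro exI[of _ G] allI impI)
    fix f :: 'a assume f: "norm f \<le> 1"
    then obtain c where c: "\<And>i. i \<le> M \<Longrightarrow> \<bar>inner (\<kappa> (i / M)) f - (\<Sum>j<m. c j * g j i)\<bar> \<le> \<delta>"
      using g by blast
    have "norm (T f - (\<Sum>j<m. c j *\<^sub>R G j)) \<le> \<delta> + \<epsilon>"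
    proof (rule norm_bound)
      fix t
      define u where "u = real_of_ui t"
      have u: "u \<in> {0..1}" unfolding u_def by (rule real_of_ui)
      define y where "y i = (\<Sum>j<m. c j * g j i)" for i
      have "(\<Sum>j<m. c j * (\<Sum>i\<le>M. g j i * hat M i u)) = (\<Sum>i\<le>M. y i * hat M i u)"
        unfolding y_def sum_distrib_left sum_distrib_right by (subst sum.swap) (simp add: mult.assoc)
      then have "apply_bcontfun (T f - (\<Sum>j<m. c j *\<^sub>R G j)) t = inner (\<kappa> u) f * 1 - (\<Sum>i\<le>M. y i * hat M i u)"
        by (simp add: T app_sum G u_def)
      also have "\<dots> = (\<Sum>i\<le>M. (inner (\<kappa> u) f - y i) * hat M i u)"
        unfolding sum_hat[OF u, of M, symmetric] by (simp add: sum_distrib_left sum_subtractf left_diff_distrib)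
      also have "\<bar>\<dots>\<bar> \<le> (\<Sum>i\<le>M. (\<delta> + \<epsilon>) * hat M i u)"
      proof (rule order_trans[OF sum_abs], rule sum_mono)
        fix i assume i: "i \<in> {..M}"
        show "\<bar>(inner (\<kappa> u) f - y i) * hat M i u\<bar> \<le> (\<delta> + \<epsilon>) * hat M i u"
        proof (cases "hat M i u = 0")
          case False
          then have pos: "0 < hat M i u" by (auto simp: hat_def)
          then have "\<bar>M * u - i\<bar> \<le> 1" by (auto simp: hat_def)
          moreover have "\<bar>M * u - i\<bar> = M * \<bar>u - i / M\<bar>"
          proof -
            have "M * u - i = M * (u - i / M)" using M by (simp add: field_simps)
            then show ?thesis by (simp only: abs_mult abs_of_nat)
          qed
          ultimately have "\<bar>u - i / M\<bar> \<le> 1 / M" using M by (simp add: field_simps)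
          then have "norm (\<kappa> u - \<kappa> (i / M)) \<le> \<epsilon>"
            using u i M by (intro modulus) auto
          moreover have "\<bar>inner (\<kappa> u - \<kappa> (i / M)) f\<bar> \<le> norm (\<kappa> u - \<kappa> (i / M)) * norm f"
            by (rule Cauchy_Schwarz_ineq2)
          moreover have "norm (\<kappa> u - \<kappa> (i / M)) * norm f \<le> norm (\<kappa> u - \<kappa> (i / M)) * 1"
            using f by (intro mult_left_mono) auto
          moreover have "inner (\<kappa> u - \<kappa> (i / M)) f = inner (\<kappa> u) f - inner (\<kappa> (i / M)) f"
            by (rule inner_diff_left)
          ultimately have "\<bar>inner (\<kappa> u) f - y i\<bar> \<le> \<delta> + \<epsilon>"
            using c[of i] i unfolding y_def by simp
          then show ?thesis using pos by (simp add: abs_mult)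
        qed simp
      qed
      also have "\<dots> = \<delta> + \<epsilon>" unfolding sum_distrib_left[symmetric] sum_hat[OF u] by simp
      finally show "norm (apply_bcontfun (T f - (\<Sum>j<m. c j *\<^sub>R G j)) t) \<le> \<delta> + \<epsilon>" by simp
    qed
    then show "\<exists>c. norm (T f - (\<Sum>j<m. c j *\<^sub>R G j)) \<le> \<delta> + \<epsilon>" by blast
  qed
qed

section \<open>Sampling on dyadic grids\<close>

text \<open>The point \<open>i / 2 ^ P\<close> rounded down to the grid of mesh \<open>1 / 2 ^ p\<close>.\<close>

definition grid_point :: "nat \<Rightarrow> nat \<Rightarrow> nat \<Rightarrow> real" where
  "grid_point P p i = real (i div 2 ^ (P - p)) / 2 ^ p"

lemma grid_point_bounds:
  assumes "p \<le> P"
  shows "grid_point P p i \<le> i / 2 ^ P" "i / 2 ^ P < grid_point P p i + 1 / 2 ^ p"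
proof -
  define r where "r = i div 2 ^ (P - p)"
  define n where "n = (2 :: nat) ^ (P - p)"
  have P: "(2 :: real) ^ P = 2 ^ p * real n"
    using assms by (simp add: n_def power_add[symmetric])
  have n: "0 < n" by (simp add: n_def)
  have "r * n \<le> i" by (simp add: r_def n_def)
  moreover have "i < (r + 1) * n"
    using n unfolding r_def n_def by (simp add: dividend_less_div_times)
  ultimately have "real r * n \<le> i" "real i < (real r + 1) * n"
    by (metis of_nat_le_iff of_nat_mult) (metis \<open>i < (r + 1) * n\<close> of_nat_1 of_nat_add of_nat_less_iff of_nat_mult)
  then show "grid_point P p i \<le> i / 2 ^ P" "i / 2 ^ P < grid_point P p i + 1 / 2 ^ p"
    using n by (auto simp: grid_point_def P r_def[symmetric] field_simps)
qed

lemma grid_point_in_unit: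
  assumes "p \<le> P" "i \<le> 2 ^ P"
  shows "grid_point P p i \<in> {0..1}"
proof -
  have "real i / 2 ^ P \<le> 1" using assms(2) by (simp add: divide_le_eq)
  then show ?thesis
    using grid_point_bounds(1)[OF assms(1), of i] unfolding grid_point_def atLeastAtMost_iff
    by (intro conjI) (simp, linarith)
qed

lemma grid_point_dist:
  assumes "p \<le> q" "q \<le> P"
  shows "\<bar>grid_point P q i - grid_point P p i\<bar> \<le> 1 / 2 ^ p"
proof -
  have "(1 :: real) / 2 ^ q \<le> 1 / 2 ^ p" using assms by (simp add: frac_le)
  then show ?thesis
    using grid_point_bounds[of q P i] grid_point_bounds[of p P i] assms by linarith
qed

lemma grid_point_coarsen:
  assumes "p \<le> q" "q \<le> P"
  shows "grid_point P p i = grid_point q p (i div 2 ^ (P - q))"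
proof -
  have "P - p = (P - q) + (q - p)" using assms by simp
  then show ?thesis by (simp add: grid_point_def power_add div_mult2_eq)
qed

lemma grid_point_finest [simp]: "grid_point P P i = i / 2 ^ P"
  by (simp add: grid_point_def)

lemma div_le_power:
  assumes "q \<le> P" "i \<le> 2 ^ P"
  shows "i div 2 ^ (P - q) \<le> (2 ^ q :: nat)"
proof -
  have "i div 2 ^ (P - q) \<le> 2 ^ P div 2 ^ (P - q)" using assms(2) by (rule div_le_mono)
  also have "\<dots> = 2 ^ q" using assms(1) by (simp add: power_diff[symmetric])
  finally show ?thesis .
qed

lemma kolmogorov_approx_coarse:
  fixes \<kappa> :: "real \<Rightarrow> 'a::real_inner"
  assumes "p \<le> P"
  shows "kolmogorov_approx (2 ^ p + 1) 0 (\<lambda>i. \<kappa> (grid_point P p i)) {..2 ^ P}"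
proof (rule kolmogorov_approx_reindex[OF kolmogorov_approx_finite[of "2 ^ p + 1" "\<lambda>i. \<kappa> (real i / 2 ^ p)"]])
  fix i :: nat assume "i \<in> {..2 ^ P}"
  then show "i div 2 ^ (P - p) \<in> {..<2 ^ p + 1}" using div_le_power[OF assms, of i] by auto
  show "\<kappa> (grid_point P p i) = \<kappa> (real (i div 2 ^ (P - p)) / 2 ^ p)" by (simp add: grid_point_def)
qed

section \<open>Chaining along doubly exponential grids\<close>

text \<open>The value at a grid point is its value on the grid of level \<open>j0\<close>, which is reproduced exactly at the price of
its number of points, plus the increments between the grids with \<open>2 ^ 2 ^ j\<close> and \<open>2 ^ 2 ^ Suc j\<close> cells. The latter
take about \<open>2 ^ 2 ^ Suc j\<close> values, whose logarithm is of order \<open>2 ^ j\<close>.\<close>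

lemma kolmogorov_approx_grid_chaining:
  fixes \<kappa> :: "real \<Rightarrow> 'a::real_inner" and \<omega> :: "nat \<Rightarrow> real"
  assumes j0: "j0 < J" and m: "0 < m"
    and \<omega>: "\<And>j. 0 < \<omega> j" "\<And>j s t. s \<in> {0..1} \<Longrightarrow> t \<in> {0..1} \<Longrightarrow> \<bar>s - t\<bar> \<le> 1 / 2 ^ 2 ^ j \<Longrightarrow> norm (\<kappa> s - \<kappa> t) \<le> \<omega> j"
  shows "kolmogorov_approx (2 ^ 2 ^ j0 + 1 + m) (24 / sqrt m * (\<Sum>j\<in>{j0..<J}. \<omega> j * sqrt (2 ^ j)))
    (\<lambda>i. \<kappa> (real i / 2 ^ 2 ^ J)) {..2 ^ 2 ^ J}"
proof -
  define P where "P = (2 :: nat) ^ J"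
  have le: "2 ^ j \<le> P" if "j \<le> J" for j using that by (simp add: P_def power_increasing)
  define v where "v j i = \<kappa> (grid_point P (2 ^ Suc j) i) - \<kappa> (grid_point P (2 ^ j) i)" for j i
  define I where "I = {..(2 ^ P :: nat)}"
  have "kolmogorov_approx m (8 / sqrt m * (\<Sum>j\<in>{j0..<J}. \<omega> j * sqrt (2 * ln (2 * real (2 * 2 ^ 2 ^ Suc j)))))
      (\<lambda>i. \<Sum>j\<in>{j0..<J}. v j i) I"
  proof (rule kolmogorov_approx_chaining)
    show "finite I" "I \<noteq> {}" by (auto simp: I_def)
    fix j assume "j \<in> {j0..<J}"
    then have j: "2 ^ Suc j \<le> P" "2 ^ j \<le> P" "2 ^ j \<le> (2 :: nat) ^ Suc j" using le[of j] le[of "Suc j"] by auto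
    have "v j ` I \<subseteq> (\<lambda>k. \<kappa> (grid_point (2 ^ Suc j) (2 ^ Suc j) k) - \<kappa> (grid_point (2 ^ Suc j) (2 ^ j) k)) ` {..2 ^ 2 ^ Suc j}"
    proof (intro image_subsetI)
      fix i assume "i \<in> I"
      then have "i div 2 ^ (P - 2 ^ Suc j) \<le> 2 ^ 2 ^ Suc j" using j by (intro div_le_power) (auto simp: I_def)
      then show "v j i \<in> (\<lambda>k. \<kappa> (grid_point (2 ^ Suc j) (2 ^ Suc j) k) - \<kappa> (grid_point (2 ^ Suc j) (2 ^ j) k)) ` {..2 ^ 2 ^ Suc j}"
        unfolding v_def grid_point_coarsen[OF order_refl j(1), of i] grid_point_coarsen[OF j(3,1), of i]
        by blast
    qed
    then have "card (v j ` I) \<le> card {..(2 :: nat) ^ 2 ^ Suc j}"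
      by (meson surj_card_le finite_atMost)
    also have "\<dots> = 2 ^ 2 ^ Suc j + 1" by simp
    also have "\<dots> \<le> 2 * 2 ^ 2 ^ Suc j" using one_le_power[of "2 :: nat" "2 ^ Suc j"] by linarith
    finally show "card (v j ` I) \<le> 2 * 2 ^ 2 ^ Suc j" .
    show "0 < \<omega> j" by (rule \<omega>)
    fix i assume "i \<in> I"
    then show "norm (v j i) \<le> \<omega> j"
      unfolding v_def using j grid_point_in_unit[of _ P i] grid_point_dist[OF j(3,1), of i]
      by (intro \<omega>(2)) (auto simp: I_def)
  qed (use j0 m in auto)
  then have "kolmogorov_approx (2 ^ 2 ^ j0 + 1 + m)
      (0 + 8 / sqrt m * (\<Sum>j\<in>{j0..<J}. \<omega> j * sqrt (2 * ln (2 * real (2 * 2 ^ 2 ^ Suc j)))))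
      (\<lambda>i. \<kappa> (grid_point P (2 ^ j0) i) + (\<Sum>j\<in>{j0..<J}. v j i)) I"
    unfolding I_def using le[of j0] j0 by (intro kolmogorov_approx_add kolmogorov_approx_coarse) auto
  also have "(\<lambda>i. \<kappa> (grid_point P (2 ^ j0) i) + (\<Sum>j\<in>{j0..<J}. v j i)) = (\<lambda>i. \<kappa> (real i / 2 ^ 2 ^ J))"
  proof
    fix i
    have "(\<Sum>j\<in>{j0..<J}. v j i) = \<kappa> (grid_point P (2 ^ J) i) - \<kappa> (grid_point P (2 ^ j0) i)"
      unfolding v_def using j0 by (intro sum_Suc_diff') auto
    then show "\<kappa> (grid_point P (2 ^ j0) i) + (\<Sum>j\<in>{j0..<J}. v j i) = \<kappa> (real i / 2 ^ 2 ^ J)"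
      by (simp add: P_def)
  qed
  finally have *: "kolmogorov_approx (2 ^ 2 ^ j0 + 1 + m)
      (0 + 8 / sqrt m * (\<Sum>j\<in>{j0..<J}. \<omega> j * sqrt (2 * ln (2 * real (2 * 2 ^ 2 ^ Suc j)))))
      (\<lambda>i. \<kappa> (real i / 2 ^ 2 ^ J)) I" .
  have "(\<Sum>j\<in>{j0..<J}. \<omega> j * sqrt (2 * ln (2 * real (2 * 2 ^ 2 ^ Suc j)))) \<le> (\<Sum>j\<in>{j0..<J}. \<omega> j * (3 * sqrt (2 ^ j)))"
  proof (intro sum_mono mult_left_mono)
    fix j
    have "2 * real (2 * 2 ^ 2 ^ Suc j) = 2 ^ (2 ^ Suc j + 2)" by (simp add: power_add)
    then have "ln (2 * real (2 * 2 ^ 2 ^ Suc j)) = (2 ^ Suc j + 2) * ln 2"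
      by (simp only: ln_realpow) simp
    also have "\<dots> \<le> (2 ^ Suc j + 2) * 1" using ln_2_less_1 by (intro mult_left_mono) auto
    also have "\<dots> \<le> 4 * 2 ^ j" using one_le_power[of "2 :: real" j] by simp
    finally have "ln (2 * real (2 * 2 ^ 2 ^ Suc j)) \<le> 4 * 2 ^ j" .
    moreover have "(0 :: real) \<le> 2 ^ j" by simp
    ultimately have "2 * ln (2 * real (2 * 2 ^ 2 ^ Suc j)) \<le> 9 * 2 ^ j" by linarith
    then have "sqrt (2 * ln (2 * real (2 * 2 ^ 2 ^ Suc j))) \<le> sqrt (9 * 2 ^ j)" by (rule real_sqrt_le_mono)
    also have "\<dots> = 3 * sqrt (2 ^ j)"
    proof -
      have "sqrt 9 = 3" by (rule real_sqrt_unique) auto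
      then show ?thesis by (simp add: real_sqrt_mult)
    qed
    finally show "sqrt (2 * ln (2 * real (2 * 2 ^ 2 ^ Suc j))) \<le> 3 * sqrt (2 ^ j)" .
  qed (use \<omega>(1) in \<open>auto intro: less_imp_le\<close>)
  also have "\<dots> = 3 * (\<Sum>j\<in>{j0..<J}. \<omega> j * sqrt (2 ^ j))" by (simp add: sum_distrib_left mult.left_commute)
  finally have "8 / sqrt m * (\<Sum>j\<in>{j0..<J}. \<omega> j * sqrt (2 * ln (2 * real (2 * 2 ^ 2 ^ Suc j))))
      \<le> 8 / sqrt m * (3 * (\<Sum>j\<in>{j0..<J}. \<omega> j * sqrt (2 ^ j)))"
    using m by (intro mult_left_mono) auto
  then show ?thesis
    using kolmogorov_approx_mono[OF *, of "2 ^ 2 ^ j0 + 1 + m"] by (simp add: I_def P_def)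
qed

section \<open>Summing Bessel families level by level\<close>

text \<open>Above level \<open>p0\<close> the increments from one dyadic grid to the next are approximated with rank
\<open>m j = 2 ^ p0 div (j + 1)\<^sup>2\<close>. The total rank stays of order \<open>2 ^ p0\<close>, and the loss in the error,
\<open>(j + 1)\<^sup>2\<close> after estimating the logarithm, is harmless against geometric decay of \<open>A\<close>. The bound on \<open>J\<close> keeps
all \<open>m j\<close> positive.\<close>

lemma kolmogorov_approx_grid_Bessel:
  fixes \<kappa> :: "real \<Rightarrow> 'a::real_inner" and A :: "nat \<Rightarrow> real"
  assumes J: "J\<^sup>2 \<le> 2 ^ p0" and A: "\<And>p. 0 < A p"
    and Bessel: "\<And>p f. (\<Sum>s\<in>{1..2 ^ p}. (inner (\<kappa> (real s / 2 ^ p) - \<kappa> ((real s - 1) / 2 ^ p)) f)\<^sup>2) \<le> (A p)\<^sup>2 * (norm f)\<^sup>2"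
  shows "kolmogorov_approx (4 * 2 ^ p0) (154 / sqrt (2 ^ p0) * (\<Sum>j<J. (real j + 1)\<^sup>2 * A (p0 + Suc j)))
    (\<lambda>i. \<kappa> (real i / 2 ^ (p0 + J))) {..2 ^ (p0 + J)}"
proof -
  define P where "P = p0 + J"
  define I where "I = {..(2 ^ P :: nat)}"
  \<comment> \<open>Passing to the finer grid moves only the points with odd index.\<close>
  define u where "u p s = (if odd s then \<kappa> (real s / 2 ^ p) - \<kappa> ((real s - 1) / 2 ^ p) else 0)" for p s
  define v where "v j i = \<kappa> (grid_point P (p0 + Suc j) i) - \<kappa> (grid_point P (p0 + j) i)" for j i
  define m where "m j = 2 ^ p0 div (j + 1)\<^sup>2" for j :: nat
  have level: "kolmogorov_approx (m j) (154 / sqrt (2 ^ p0) * ((real j + 1)\<^sup>2 * A (p0 + Suc j))) (v j) I"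
    if j: "j < J" for j
  proof -
    define p where "p = p0 + Suc j"
    define D where "D = {..(2 ^ p :: nat)}"
    have pP: "p \<le> P" "p0 + j \<le> p" using j by (auto simp: p_def P_def)
    have "(j + 1)\<^sup>2 \<le> J\<^sup>2" using j by (intro power_mono) auto
    then have sq: "(j + 1)\<^sup>2 \<le> 2 ^ p0" using J by linarith
    have m: "0 < m j" using sq by (simp add: m_def div_greater_zero_iff)
    have "m j \<le> 2 ^ p0" by (simp add: m_def)
    also have "\<dots> \<le> (2 ^ p :: nat)" unfolding p_def by (rule power_increasing) auto
    finally have mD: "m j \<le> card D" by (simp add: D_def)
    have "2 ^ p0 < (m j + 1) * (j + 1)\<^sup>2"
      unfolding m_def using dividend_less_div_times[of "(j + 1)\<^sup>2" "2 ^ p0"] by simp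
    also have "\<dots> \<le> (2 * m j) * (j + 1)\<^sup>2" using m by (intro mult_right_mono) auto
    finally have "(2 ^ p0 :: nat) < 2 * m j * (j + 1)\<^sup>2" .
    then have "real (2 ^ p0) < real (2 * m j * (j + 1)\<^sup>2)" by (simp only: of_nat_less_iff)
    then have m2: "2 ^ p0 < 2 * real (m j) * (real j + 1)\<^sup>2" by (simp add: add.commute)
    have "kolmogorov_approx (m j) (22 * A p * sqrt (2 * ln (128 * card D / m j) / m j)) (u p) D"
    proof (rule kolmogorov_approx_Bessel[OF _ m mD A])
      fix f :: 'a
      have "(\<Sum>s\<in>D. (inner (u p s) f)\<^sup>2) = (\<Sum>s\<in>{1..2 ^ p}. (inner (u p s) f)\<^sup>2)"
        unfolding D_def by (rule sum.mono_neutral_right) (auto simp: u_def Suc_le_eq)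
      also have "\<dots> \<le> (\<Sum>s\<in>{1..2 ^ p}. (inner (\<kappa> (real s / 2 ^ p) - \<kappa> ((real s - 1) / 2 ^ p)) f)\<^sup>2)"
        by (intro sum_mono) (auto simp: u_def)
      also have "\<dots> \<le> (A p)\<^sup>2 * (norm f)\<^sup>2" by (rule Bessel)
      finally show "(\<Sum>s\<in>D. (inner (u p s) f)\<^sup>2) \<le> (A p)\<^sup>2 * (norm f)\<^sup>2" .
    qed (simp add: D_def)
    then have "kolmogorov_approx (m j) (22 * A p * sqrt (2 * ln (128 * card D / m j) / m j)) (v j) I"
    proof (rule kolmogorov_approx_reindex)
      fix i assume i: "i \<in> I"
      define k where "k = i div 2 ^ (P - p)"
      show "i div 2 ^ (P - p) \<in> D" using div_le_power[OF pP(1), of i] i by (simp add: D_def I_def)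
      have "v j i = \<kappa> (real k / 2 ^ p) - \<kappa> (real (k div 2) / 2 ^ (p0 + j))"
        unfolding v_def p_def[symmetric] grid_point_coarsen[OF pP(2,1), of i] grid_point_coarsen[OF order_refl pP(1), of i]
        by (simp add: k_def grid_point_def p_def)
      also have "real (k div 2) / 2 ^ (p0 + j) = real (2 * (k div 2)) / 2 ^ p" by (simp add: p_def)
      also have "\<kappa> (real k / 2 ^ p) - \<kappa> (real (2 * (k div 2)) / 2 ^ p) = u p k"
      proof (cases "odd k")
        case True
        then have "2 * (k div 2) = k - 1" by simp
        moreover have "1 \<le> k" using True odd_pos by fastforce
        ultimately show ?thesis using True by (simp add: u_def of_nat_diff)
      next
        case False
        then have "2 * (k div 2) = k" by simp
        then show ?thesis using False by (simp add: u_def)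
      qed
      finally show "v j i = u p (i div 2 ^ (P - p))" by (simp add: k_def)
    qed
    then show ?thesis
    proof (rule kolmogorov_approx_mono)
      define L where "L = 128 * card D / m j"
      have "1 / m j < 2 * (real j + 1)\<^sup>2 / 2 ^ p0" using m m2 by (simp add: field_simps)
      then have "L \<le> 128 * real (card D) * (2 * (real j + 1)\<^sup>2 / 2 ^ p0)"
      proof -
        have "L = 128 * real (card D) * (1 / m j)" by (simp add: L_def)
        also have "\<dots> \<le> 128 * real (card D) * (2 * (real j + 1)\<^sup>2 / 2 ^ p0)"
          using \<open>1 / m j < 2 * (real j + 1)\<^sup>2 / 2 ^ p0\<close> by (intro mult_left_mono) auto
        finally show ?thesis .
      qed
      also have "\<dots> \<le> 128 * (2 * (2 * 2 ^ j * 2 ^ p0)) * (2 * (real j + 1)\<^sup>2 / 2 ^ p0)"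
      proof (intro mult_right_mono mult_left_mono)
        have "card D \<le> 2 * (2 * 2 ^ j * 2 ^ p0)"
          using one_le_power[of "2 :: nat" p] by (simp add: D_def p_def power_add mult_ac)
        then have "real (card D) \<le> real (2 * (2 * 2 ^ j * 2 ^ p0))" by (simp only: of_nat_le_iff)
        then show "real (card D) \<le> 2 * (2 * 2 ^ j * 2 ^ p0)" by simp
      qed auto
      also have "\<dots> = 2 ^ (10 + j) * (real j + 1)\<^sup>2" by (simp add: power_add)
      finally have L_le: "L \<le> 2 ^ (10 + j) * (real j + 1)\<^sup>2" .
      have "0 < card D" by (simp add: D_def)
      then have L0: "0 < L" using m by (simp add: L_def)
      have "ln L \<le> ln (2 ^ (10 + j) * (real j + 1)\<^sup>2)" using L_le L0 by (simp add: ln_le_cancel_iff)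
      also have "\<dots> = (10 + j) * ln 2 + 2 * ln (real j + 1)"
        by (simp add: ln_mult ln_realpow)
      also have "\<dots> \<le> (10 + j) * 1 + 2 * real j"
        using ln_2_less_1 ln_add_one_self_le_self[of "real j"]
        by (intro add_mono mult_left_mono) (auto simp: add.commute)
      also have "\<dots> \<le> 10 * (real j + 1)" by simp
      finally have lnL: "ln L \<le> 10 * (real j + 1)" .
      have "2 * ln L / m j \<le> 2 * (10 * (real j + 1)) * (1 / m j)"
        using lnL m by (simp add: divide_right_mono)
      also have "\<dots> \<le> 2 * (10 * (real j + 1)) * (2 * (real j + 1)\<^sup>2 / 2 ^ p0)"
        using \<open>1 / m j < 2 * (real j + 1)\<^sup>2 / 2 ^ p0\<close> by (intro mult_left_mono) auto
      also have "\<dots> = 40 * ((real j + 1) ^ 3 / 2 ^ p0)" by (simp add: power2_eq_square power3_eq_cube algebra_simps add_divide_distrib)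
      also have "\<dots> \<le> 7\<^sup>2 * ((real j + 1) ^ 4 / 2 ^ p0)"
      proof -
        have "(real j + 1) ^ 3 \<le> (real j + 1) ^ 4" by (rule power_increasing) auto
        then have "(real j + 1) ^ 3 / 2 ^ p0 \<le> (real j + 1) ^ 4 / 2 ^ p0" by (rule divide_right_mono) simp
        moreover have "0 \<le> (real j + 1) ^ 4 / 2 ^ p0" by simp
        ultimately have "40 * ((real j + 1) ^ 3 / 2 ^ p0) \<le> 49 * ((real j + 1) ^ 4 / 2 ^ p0)" by linarith
        then show ?thesis by simp
      qed
      finally have "sqrt (2 * ln L / m j) \<le> sqrt (7\<^sup>2 * ((real j + 1) ^ 4 / 2 ^ p0))"
        by (rule real_sqrt_le_mono)
      also have "\<dots> = 7 * ((real j + 1)\<^sup>2 / sqrt (2 ^ p0))"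
      proof -
        have "(real j + 1) ^ 4 = ((real j + 1)\<^sup>2)\<^sup>2" by (simp add: power_mult[symmetric])
        then show ?thesis by (simp only: real_sqrt_mult real_sqrt_divide real_sqrt_abs) simp
      qed
      finally have "22 * A p * sqrt (2 * ln L / m j) \<le> 22 * A p * (7 * ((real j + 1)\<^sup>2 / sqrt (2 ^ p0)))"
        using A[of p] by (intro mult_left_mono) auto
      then show "22 * A p * sqrt (2 * ln (128 * card D / m j) / m j) \<le> 154 / sqrt (2 ^ p0) * ((real j + 1)\<^sup>2 * A (p0 + Suc j))"
        by (simp add: L_def p_def mult_ac)
    qed simp
  qed
  have "kolmogorov_approx ((2 ^ p0 + 1) + (\<Sum>j<J. m j))
      (0 + (\<Sum>j<J. 154 / sqrt (2 ^ p0) * ((real j + 1)\<^sup>2 * A (p0 + Suc j))))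
      (\<lambda>i. \<kappa> (grid_point P p0 i) + (\<Sum>j<J. v j i)) I"
    unfolding I_def P_def
    by (intro kolmogorov_approx_add kolmogorov_approx_sum level[unfolded I_def P_def] kolmogorov_approx_coarse) simp_all
  also have "(\<lambda>i. \<kappa> (grid_point P p0 i) + (\<Sum>j<J. v j i)) = (\<lambda>i. \<kappa> (real i / 2 ^ (p0 + J)))"
  proof
    fix i
    have "(\<Sum>j<J. v j i) = \<kappa> (grid_point P (p0 + J) i) - \<kappa> (grid_point P (p0 + 0) i)"
      unfolding v_def by (rule sum_lessThan_telescope)
    then show "\<kappa> (grid_point P p0 i) + (\<Sum>j<J. v j i) = \<kappa> (real i / 2 ^ (p0 + J))"
      by (simp add: P_def)
  qed
  finally have approx: "kolmogorov_approx ((2 ^ p0 + 1) + (\<Sum>j<J. m j))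
      (0 + (\<Sum>j<J. 154 / sqrt (2 ^ p0) * ((real j + 1)\<^sup>2 * A (p0 + Suc j))))
      (\<lambda>i. \<kappa> (real i / 2 ^ (p0 + J))) {..2 ^ (p0 + J)}"
    unfolding I_def P_def .
  show ?thesis
  proof (rule kolmogorov_approx_mono[OF approx])
    have sum_squares: "(\<Sum>j<Suc K. 1 / (real j + 1)\<^sup>2) \<le> 2 - 1 / (real K + 1)" for K :: nat
    proof (induction K)
      case (Suc K)
      have "1 / (real K + 2)\<^sup>2 \<le> 1 / ((real K + 1) * (real K + 2))"
        by (intro divide_left_mono) (auto simp: power2_eq_square)
      also have "\<dots> = 1 / (real K + 1) - 1 / (real K + 2)" by (simp add: field_simps)
      finally show ?case using Suc by (simp add: add.commute)
    qed simp
    have "(\<Sum>j<J. 1 / (real j + 1)\<^sup>2) \<le> (\<Sum>j<Suc J. 1 / (real j + 1)\<^sup>2)" by simp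
    also have "\<dots> \<le> 2" using sum_squares[of J] by (rule order_trans) simp
    finally have two: "(\<Sum>j<J. 1 / (real j + 1)\<^sup>2) \<le> 2" .
    have "real (\<Sum>j<J. m j) \<le> (\<Sum>j<J. 2 ^ p0 * (1 / (real j + 1)\<^sup>2))"
      unfolding of_nat_sum
    proof (rule sum_mono)
      fix j
      show "real (m j) \<le> 2 ^ p0 * (1 / (real j + 1)\<^sup>2)"
      proof -
        have "m j * (j + 1)\<^sup>2 \<le> 2 ^ p0" unfolding m_def by (rule div_times_less_eq_dividend)
        then have "real (m j * (j + 1)\<^sup>2) \<le> real (2 ^ p0)" by (simp only: of_nat_le_iff)
        then have "real (m j) * (real j + 1)\<^sup>2 \<le> 2 ^ p0" by (simp add: add.commute)
        moreover have "0 < (real j + 1)\<^sup>2" by simp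
        ultimately show ?thesis by (simp add: pos_le_divide_eq)
      qed
    qed
    also have "\<dots> \<le> 2 ^ p0 * 2"
      unfolding sum_distrib_left[symmetric] by (intro mult_left_mono two) simp
    finally have "real (\<Sum>j<J. m j) \<le> real (2 ^ p0 * 2)" by simp
    then have "(\<Sum>j<J. m j) \<le> 2 ^ p0 * 2" by (simp only: of_nat_le_iff)
    then show "2 ^ p0 + 1 + (\<Sum>j<J. m j) \<le> 4 * 2 ^ p0"
      using one_le_power[of "2 :: nat" p0] by linarith
  qed (simp add: sum_distrib_left)
qed

section \<open>Translates of a decreasing kernel\<close>

lemma leb01_integral_translate:
  fixes F :: "real \<Rightarrow> real"
  assumes F: "integrable lborel F" "\<And>u. 0 \<le> F u" and c: "\<bar>c\<bar> = (1::real)"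
  shows "integrable leb01 (\<lambda>x. F (c * (s - x)))"
    and "(LINT x|leb01. F (c * (s - x))) \<le> (LINT u|lborel. F u)"
proof -
  have c0: "- c \<noteq> 0" using c by auto
  have aff: "c * (s - x) = c * s + (- c) * x" for x by (simp add: algebra_simps)
  have int: "integrable lborel (\<lambda>x. F (c * (s - x)))"
    unfolding aff by (rule lborel_integrable_real_affine[OF F(1) c0])
  have eq: "(LINT x|lborel. F (c * (s - x))) = (LINT u|lborel. F u)"
    unfolding aff using lborel_integral_real_affine[OF c0, of F "c * s"] c by simp
  have m: "(\<lambda>x. F (c * (s - x))) \<in> borel_measurable lborel" using int by auto
  have int': "integrable lebesgue (\<lambda>x. F (c * (s - x)))"
    using int m by (simp add: integrable_completion)
  then have ind: "integrable lebesgue (\<lambda>x. indicator {0..1} x *\<^sub>R F (c * (s - x)))"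
    by (rule integrable_mult_indicator[rotated]) auto
  then show "integrable leb01 (\<lambda>x. F (c * (s - x)))"
    by (subst integrable_restrict_space) auto
  have "(LINT x|leb01. F (c * (s - x))) = (LINT x|lebesgue. indicator {0..1} x *\<^sub>R F (c * (s - x)))"
    by (rule integral_restrict_space) auto
  also have "\<dots> \<le> (LINT x|lebesgue. F (c * (s - x)))"
    using ind int' by (rule integral_mono) (auto simp: indicator_def F(2))
  also have "\<dots> = (LINT x|lborel. F (c * (s - x)))"
    using m by (rule integral_completion)
  finally show "(LINT x|leb01. F (c * (s - x))) \<le> (LINT u|lborel. F u)" by (simp add: eq)
qed

lemma inner_abs_l2:
  assumes "square_integrable01 f" "square_integrable01 g"
  shows "inner (abs_l2 f) (abs_l2 g) = (LINT x|leb01. f x * g x)"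
  using assms by (intro inner_l2.abs_eq l2_eq_refl)

lemma abs_l2_rep_l2 [simp]: "abs_l2 (rep_l2 f) = f"
  using Quotient3_abs_rep[OF Quotient3_l2] .

lemma square_integrable01_rep_l2: "square_integrable01 (rep_l2 f)"
  using Quotient3_rep_reflp[OF Quotient3_l2, of f] by (simp add: l2_eq_def)

lemma abs_l2_diff:
  assumes "square_integrable01 f" "square_integrable01 g"
  shows "abs_l2 f - abs_l2 g = abs_l2 (\<lambda>x. f x - g x)"
  using assms by (intro minus_l2.abs_eq l2_eq_refl)

lemma abs_l2_add:
  assumes "square_integrable01 f" "square_integrable01 g"
  shows "abs_l2 f + abs_l2 g = abs_l2 (\<lambda>x. f x + g x)"
  using assms by (intro plus_l2.abs_eq l2_eq_refl)

text \<open>The Schur test, by the Cauchy-Schwarz inequality for \<open>p s\<close> and \<open>q s * f\<close>. It is used with \<open>q s\<close> an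
indicator, where \<open>\<beta>\<close> measures the overlap of supports, and with \<open>p s = q s\<close>.\<close>

lemma weighted_Bessel:
  fixes p q :: "'s \<Rightarrow> real \<Rightarrow> real"
  assumes S: "finite S"
    and p: "\<And>s. s \<in> S \<Longrightarrow> square_integrable01 (p s)" "\<And>s. s \<in> S \<Longrightarrow> (LINT x|leb01. (p s x)\<^sup>2) \<le> \<alpha>"
    and q: "\<And>s. s \<in> S \<Longrightarrow> q s \<in> borel_measurable leb01" "\<And>x. (\<Sum>s\<in>S. (q s x)\<^sup>2) \<le> \<beta>"
    and f: "square_integrable01 f" and \<alpha>: "0 \<le> \<alpha>"
  shows "(\<Sum>s\<in>S. (LINT x|leb01. p s x * q s x * f x)\<^sup>2) \<le> \<alpha> * \<beta> * (LINT x|leb01. (f x)\<^sup>2)"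
proof -
  have fint: "integrable leb01 (\<lambda>x. (f x)\<^sup>2)" "f \<in> borel_measurable leb01"
    using f by (auto simp: square_integrable01_def)
  have q_le: "(q s x)\<^sup>2 \<le> \<beta>" if "s \<in> S" for s x
    using member_le_sum[of s S "\<lambda>s. (q s x)\<^sup>2"] q(2)[of x] S that by auto
  have qf_int: "integrable leb01 (\<lambda>x. (q s x)\<^sup>2 * (f x)\<^sup>2)" if s: "s \<in> S" for s
  proof (rule Bochner_Integration.integrable_bound)
    show "integrable leb01 (\<lambda>x. \<beta> * (f x)\<^sup>2)" using fint by simp
    show "(\<lambda>x. (q s x)\<^sup>2 * (f x)\<^sup>2) \<in> borel_measurable leb01" using q(1)[OF s] fint by simp
    show "AE x in leb01. norm ((q s x)\<^sup>2 * (f x)\<^sup>2) \<le> norm (\<beta> * (f x)\<^sup>2)"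
    proof (rule AE_I2)
      fix x
      have "(q s x)\<^sup>2 * (f x)\<^sup>2 \<le> \<beta> * (f x)\<^sup>2" using q_le[OF s] by (intro mult_right_mono) auto
      moreover have "0 \<le> (q s x)\<^sup>2 * (f x)\<^sup>2" by simp
      ultimately show "norm ((q s x)\<^sup>2 * (f x)\<^sup>2) \<le> norm (\<beta> * (f x)\<^sup>2)"
        unfolding real_norm_def by linarith
    qed
  qed
  have qf: "square_integrable01 (\<lambda>x. q s x * f x)" if s: "s \<in> S" for s
    using q(1)[OF s] fint qf_int[OF s] by (auto simp: square_integrable01_def power_mult_distrib)
  have "(\<Sum>s\<in>S. (LINT x|leb01. p s x * q s x * f x)\<^sup>2) \<le> (\<Sum>s\<in>S. \<alpha> * (LINT x|leb01. (q s x)\<^sup>2 * (f x)\<^sup>2))"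
  proof (rule sum_mono)
    fix s assume s: "s \<in> S"
    have "(LINT x|leb01. p s x * q s x * f x)\<^sup>2 = (inner (abs_l2 (p s)) (abs_l2 (\<lambda>x. q s x * f x)))\<^sup>2"
      by (simp add: inner_abs_l2 p s qf mult.assoc)
    also have "\<dots> \<le> inner (abs_l2 (p s)) (abs_l2 (p s)) * inner (abs_l2 (\<lambda>x. q s x * f x)) (abs_l2 (\<lambda>x. q s x * f x))"
      by (rule Cauchy_Schwarz_ineq)
    also have "\<dots> = (LINT x|leb01. (p s x)\<^sup>2) * (LINT x|leb01. (q s x)\<^sup>2 * (f x)\<^sup>2)"
      unfolding inner_abs_l2[OF p(1)[OF s] p(1)[OF s]] inner_abs_l2[OF qf[OF s] qf[OF s]]
      by (simp add: power2_eq_square ac_simps)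
    also have "\<dots> \<le> \<alpha> * (LINT x|leb01. (q s x)\<^sup>2 * (f x)\<^sup>2)"
      using p(2)[OF s] by (intro mult_right_mono) (auto intro!: integral_nonneg_AE)
    finally show "(LINT x|leb01. p s x * q s x * f x)\<^sup>2 \<le> \<alpha> * (LINT x|leb01. (q s x)\<^sup>2 * (f x)\<^sup>2)" .
  qed
  also have "\<dots> = \<alpha> * (LINT x|leb01. (\<Sum>s\<in>S. (q s x)\<^sup>2) * (f x)\<^sup>2)"
    using qf_int by (simp add: sum_distrib_left[symmetric] sum_distrib_right)
  also have "\<dots> \<le> \<alpha> * (LINT x|leb01. \<beta> * (f x)\<^sup>2)"
  proof (intro mult_left_mono integral_mono \<alpha>)
    show "integrable leb01 (\<lambda>x. (\<Sum>s\<in>S. (q s x)\<^sup>2) * (f x)\<^sup>2)"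
      using qf_int by (simp add: sum_distrib_right)
    show "(\<Sum>s\<in>S. (q s x)\<^sup>2) * (f x)\<^sup>2 \<le> \<beta> * (f x)\<^sup>2" for x
      using q(2)[of x] by (intro mult_right_mono) auto
  qed (use fint in auto)
  finally show ?thesis by simp
qed

text \<open>A function dominated by a decrement of a bounded function has bounded sums over translates, by
telescoping.\<close>

lemma sum_translates_le:
  fixes G H :: "real \<Rightarrow> real"
  assumes G: "\<And>u. G u \<le> H (u - \<delta>) - H u" and H: "\<And>u. 0 \<le> H u" "\<And>u. H u \<le> B" and c: "c = 1 \<or> c = (- 1 :: real)"
  shows "(\<Sum>s\<in>{1..N}. G (y + c * (real s * \<delta>))) \<le> B"
  using c
proof
  assume c: "c = 1"
  have "(\<Sum>s\<in>{1..N}. G (y + c * (real s * \<delta>))) \<le> H y - H (y + N * \<delta>)"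
  proof (induction N)
    case (Suc N)
    then show ?case using G[of "y + real (Suc N) * \<delta>"] by (simp add: c algebra_simps)
  qed simp
  also have "\<dots> \<le> B" using H(1)[of "y + N * \<delta>"] H(2)[of y] by linarith
  finally show ?thesis .
next
  assume c: "c = - 1"
  have "(\<Sum>s\<in>{1..N}. G (y + c * (real s * \<delta>))) \<le> H (y - (N + 1) * \<delta>) - H (y - \<delta>)"
  proof (induction N)
    case (Suc N)
    then show ?case using G[of "y - real (Suc N) * \<delta>"] by (simp add: c algebra_simps)
  qed simp
  also have "\<dots> \<le> B" using H(1)[of "y - \<delta>"] H(2)[of "y - (N + 1) * \<delta>"] by linarith
  finally show ?thesis .
qed

text \<open>The kernel is extended by zero to the whole line. It stays decreasing on the positive half-line, and
all translates can be compared without boundary terms.\<close>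

locale decreasing_kernel =
  fixes h :: "real \<Rightarrow> real"
  assumes measurable_h [measurable]: "h \<in> borel_measurable borel"
    and nonneg: "0 \<le> h u"
    and support: "u \<le> 0 \<or> 1 < u \<Longrightarrow> h u = 0"
    and decreasing: "0 < u \<Longrightarrow> u \<le> v \<Longrightarrow> h v \<le> h u"
    and square_integrable: "integrable lborel (\<lambda>u. (h u)\<^sup>2)"
begin

definition energy :: "real \<Rightarrow> real" where
  "energy \<delta> = (LINT u|lborel. (if u \<le> \<delta> then (h u)\<^sup>2 else 0))"

lemma truncated_integrable: "integrable lborel (\<lambda>u. if P u then (h u)\<^sup>2 else 0)" if "Measurable.pred borel P"
proof (rule Bochner_Integration.integrable_bound[OF square_integrable])
  show "(\<lambda>u. if P u then (h u)\<^sup>2 else 0) \<in> borel_measurable lborel" using that by simp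
qed auto

lemma energy_mono: "\<delta> \<le> \<delta>' \<Longrightarrow> energy \<delta> \<le> energy \<delta>'"
  unfolding energy_def by (intro integral_mono truncated_integrable) auto

lemma energy_diff:
  assumes "\<delta> \<le> \<delta>'"
  shows "energy \<delta>' - energy \<delta> = (LINT u|lborel. indicator {\<delta><..\<delta>'} u * (h u)\<^sup>2)"
proof -
  have "energy \<delta>' - energy \<delta> = (LINT u|lborel. (if u \<le> \<delta>' then (h u)\<^sup>2 else 0) - (if u \<le> \<delta> then (h u)\<^sup>2 else 0))"
    unfolding energy_def by (intro Bochner_Integration.integral_diff[symmetric] truncated_integrable) auto
  also have "\<dots> = (LINT u|lborel. indicator {\<delta><..\<delta>'} u * (h u)\<^sup>2)"
    using assms by (intro Bochner_Integration.integral_cong) (auto simp: indicator_def)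
  finally show ?thesis .
qed

lemma indicator_energy_integrable: "integrable lborel (\<lambda>u. indicator {\<delta><..\<delta>'} u * (h u)\<^sup>2)"
  by (rule Bochner_Integration.integrable_bound[OF square_integrable]) (auto simp: indicator_def)

lemma energy_diff_le:
  assumes "0 < \<delta>" "\<delta> \<le> \<delta>'"
  shows "energy \<delta>' - energy \<delta> \<le> (\<delta>' - \<delta>) * (h \<delta>)\<^sup>2"
proof -
  have "(LINT u|lborel. indicator {\<delta><..\<delta>'} u * (h u)\<^sup>2) \<le> (LINT u|lborel. indicator {\<delta><..\<delta>'} u * (h \<delta>)\<^sup>2)"
  proof (intro integral_mono indicator_energy_integrable)
    show "integrable lborel (\<lambda>u. indicator {\<delta><..\<delta>'} u * (h \<delta>)\<^sup>2)"
      using assms by (intro integrable_mult_left) (simp add: integrable_indicator_iff)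
    fix u
    show "indicator {\<delta><..\<delta>'} u * (h u)\<^sup>2 \<le> indicator {\<delta><..\<delta>'} u * (h \<delta>)\<^sup>2"
      using assms nonneg decreasing[of \<delta> u] by (auto simp: indicator_def intro!: power_mono)
  qed
  also have "\<dots> = (\<delta>' - \<delta>) * (h \<delta>)\<^sup>2" using assms by simp
  finally show ?thesis using energy_diff[OF assms(2)] by simp
qed

lemma energy_diff_ge:
  assumes "0 \<le> \<delta>" "\<delta> \<le> \<delta>'"
  shows "(\<delta>' - \<delta>) * (h \<delta>')\<^sup>2 \<le> energy \<delta>' - energy \<delta>"
proof -
  have "(\<delta>' - \<delta>) * (h \<delta>')\<^sup>2 = (LINT u|lborel. indicator {\<delta><..\<delta>'} u * (h \<delta>')\<^sup>2)" using assms by simp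
  also have "\<dots> \<le> (LINT u|lborel. indicator {\<delta><..\<delta>'} u * (h u)\<^sup>2)"
  proof (intro integral_mono indicator_energy_integrable)
    show "integrable lborel (\<lambda>u. indicator {\<delta><..\<delta>'} u * (h \<delta>')\<^sup>2)"
      using assms by (intro integrable_mult_left) (simp add: integrable_indicator_iff)
    fix u
    show "indicator {\<delta><..\<delta>'} u * (h \<delta>')\<^sup>2 \<le> indicator {\<delta><..\<delta>'} u * (h u)\<^sup>2"
      using assms nonneg decreasing[of u \<delta>'] by (auto simp: indicator_def intro!: power_mono)
  qed
  finally show ?thesis using energy_diff[OF assms(2)] by simp
qed

lemma energy_0 [simp]: "energy 0 = 0"
proof -
  have "(\<lambda>u. if u \<le> 0 then (h u)\<^sup>2 else 0) = (\<lambda>u. 0)" using support by auto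
  then show ?thesis by (simp add: energy_def)
qed

lemma energy_ge: "0 \<le> \<delta> \<Longrightarrow> \<delta> * (h \<delta>)\<^sup>2 \<le> energy \<delta>"
  using energy_diff_ge[of 0 \<delta>] by simp

lemma energy_nonneg: "0 \<le> energy \<delta>"
  unfolding energy_def by (intro integral_nonneg_AE) auto

lemma energy_tendsto_0: "(\<lambda>p. energy (1 / 2 ^ p)) \<longlonglongrightarrow> 0"
proof -
  have "(\<lambda>p. LINT u|lborel. (if u \<le> 1 / 2 ^ p then (h u)\<^sup>2 else 0)) \<longlonglongrightarrow> integral\<^sup>L lborel (\<lambda>u :: real. 0 :: real)"
  proof (rule integral_dominated_convergence[where w="\<lambda>u. (h u)\<^sup>2" and f="\<lambda>_. 0"
        and s="\<lambda>p u. if u \<le> 1 / 2 ^ p then (h u)\<^sup>2 else 0"])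
    show "AE u in lborel. (\<lambda>p. if u \<le> 1 / 2 ^ p then (h u)\<^sup>2 else 0) \<longlonglongrightarrow> 0"
    proof (rule AE_I2)
      fix u :: real
      show "(\<lambda>p. if u \<le> 1 / 2 ^ p then (h u)\<^sup>2 else 0) \<longlonglongrightarrow> 0"
      proof (cases "u \<le> 0")
        case True
        then have "(\<lambda>p. if u \<le> 1 / 2 ^ p then (h u)\<^sup>2 else 0) = (\<lambda>p :: nat. 0)"
          using support[of u] by auto
        then show ?thesis by simp
      next
        case False
        have "(\<lambda>p. (1 / 2 :: real) ^ p) \<longlonglongrightarrow> 0" by (rule LIMSEQ_realpow_zero) auto
        then have "\<forall>\<^sub>F p in sequentially. (1 / 2 :: real) ^ p < u"
          using False by (intro order_tendstoD(2)[of _ 0]) auto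
        then have "\<forall>\<^sub>F p in sequentially. (if u \<le> 1 / 2 ^ p then (h u)\<^sup>2 else 0) = 0"
          by eventually_elim (auto simp: power_divide)
        then show ?thesis by (rule tendsto_eventually)
      qed
    qed
  qed (use square_integrable in auto)
  then show ?thesis by (simp add: energy_def)
qed

definition increment :: "real \<Rightarrow> real \<Rightarrow> real" where
  "increment \<delta> u = h u - h (u - \<delta>)"

lemma increment_measurable [measurable]: "increment \<delta> \<in> borel_measurable borel"
  unfolding increment_def[abs_def] by measurable

text \<open>Monotonicity makes the squared increment at most \<open>\<bar>(h u)\<^sup>2 - (h (u - \<delta>))\<^sup>2\<bar>\<close> with a known sign on either side of
\<open>\<delta>\<close>; the integrals of \<open>h\<^sup>2\<close> and of its translate cancel, and only the energy up to \<open>\<delta>\<close> is left.\<close>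

lemma increment_square:
  assumes \<delta>: "0 < \<delta>"
  shows "integrable lborel (\<lambda>u. (increment \<delta> u)\<^sup>2)" and "(LINT u|lborel. (increment \<delta> u)\<^sup>2) \<le> 2 * energy \<delta>"
proof -
  define F where "F u = 2 * (if u \<le> \<delta> then (h u)\<^sup>2 else 0) + ((h (u - \<delta>))\<^sup>2 - (h u)\<^sup>2)" for u
  have shift: "integrable lborel (\<lambda>u. (h (u - \<delta>))\<^sup>2)" "(LINT u|lborel. (h (u - \<delta>))\<^sup>2) = (LINT u|lborel. (h u)\<^sup>2)"
    using lborel_integrable_real_affine[OF square_integrable, of 1 "- \<delta>"]
      lborel_integral_real_affine[of 1 "\<lambda>u. (h u)\<^sup>2" "- \<delta>"] by auto
  have intF: "integrable lborel F"
    unfolding F_def[abs_def] using shift(1) square_integrable truncated_integrable[of "\<lambda>u. u \<le> \<delta>"]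
    by (intro Bochner_Integration.integrable_add Bochner_Integration.integrable_diff integrable_mult_right) auto
  have le: "(increment \<delta> u)\<^sup>2 \<le> F u" for u
  proof -
    have "(increment \<delta> u)\<^sup>2 \<le> \<bar>(h u)\<^sup>2 - (h (u - \<delta>))\<^sup>2\<bar>"
      using square_diff_le[OF nonneg nonneg, of u "u - \<delta>"] by (simp add: increment_def power2_eq_square)
    also have "\<dots> = F u"
    proof (cases "u \<le> \<delta>")
      case True
      then show ?thesis using support[of "u - \<delta>"] by (simp add: F_def)
    next
      case False
      then have "(h u)\<^sup>2 \<le> (h (u - \<delta>))\<^sup>2" using \<delta> nonneg by (intro power_mono decreasing) auto
      then show ?thesis using False by (simp add: F_def)
    qed
    finally show ?thesis .
  qed
  show int: "integrable lborel (\<lambda>u. (increment \<delta> u)\<^sup>2)"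
  proof (rule Bochner_Integration.integrable_bound[OF intF])
    show "AE u in lborel. norm ((increment \<delta> u)\<^sup>2) \<le> norm (F u)"
      using le order_trans[OF zero_le_power2 le] by (intro AE_I2) simp
  qed simp
  have "(LINT u|lborel. (increment \<delta> u)\<^sup>2) \<le> (LINT u|lborel. F u)"
    by (intro integral_mono int intF le)
  also have "\<dots> = 2 * energy \<delta> + ((LINT u|lborel. (h (u - \<delta>))\<^sup>2) - (LINT u|lborel. (h u)\<^sup>2))"
    unfolding F_def[abs_def] energy_def
    using shift(1) square_integrable truncated_integrable[of "\<lambda>u. u \<le> \<delta>"] by simp
  finally show "(LINT u|lborel. (increment \<delta> u)\<^sup>2) \<le> 2 * energy \<delta>" by (simp add: shift(2))
qed

text \<open>The increment is split at \<open>2 * \<delta>\<close>. The part near the singularity carries the energy but has little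
overlap among the translates by multiples of \<open>\<delta>\<close>; the far part overlaps, but is a decrement of a bounded
decreasing function.\<close>

definition far :: "real \<Rightarrow> real \<Rightarrow> real" where
  "far \<delta> u = (if 2 * \<delta> < u then h (u - \<delta>) - h u else 0)"

definition near :: "real \<Rightarrow> real \<Rightarrow> real" where
  "near \<delta> u = (if u \<le> 2 * \<delta> then increment \<delta> u else 0)"

lemma far_measurable [measurable]: "far \<delta> \<in> borel_measurable borel"
  unfolding far_def[abs_def] by measurable

lemma near_measurable [measurable]: "near \<delta> \<in> borel_measurable borel"
  unfolding near_def[abs_def] by measurable

lemma far_nonneg: "0 < \<delta> \<Longrightarrow> 0 \<le> far \<delta> u"
  using decreasing[of "u - \<delta>" u] by (simp add: far_def)

lemma increment_near_far: "increment \<delta> u = near \<delta> u - far \<delta> u"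
  by (simp add: near_def far_def increment_def)

lemma far_integral:
  assumes \<delta>: "0 < \<delta>"
  shows "integrable lborel (far \<delta>)" and "(LINT u|lborel. far \<delta> u) \<le> \<delta> * h \<delta>"
proof -
  define H where "H u = (if \<delta> < u then h u else 0)" for u
  have H_le: "\<bar>H u\<bar> \<le> h \<delta> * indicator {0..1} u" for u
    using decreasing[of \<delta> u] nonneg \<delta> support[of u] by (auto simp: H_def indicator_def)
  have int01: "integrable lborel (\<lambda>u. h \<delta> * indicator {0..1::real} u)"
    by (intro integrable_mult_right) (simp add: integrable_indicator_iff)
  have H_meas [measurable]: "H \<in> borel_measurable borel" unfolding H_def[abs_def] by measurable
  have intH: "integrable lborel H"
    by (rule Bochner_Integration.integrable_bound[OF int01]) (auto intro!: AE_I2 order_trans[OF H_le])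
  have shift: "integrable lborel (\<lambda>u. H (u - \<delta>))" "(LINT u|lborel. H (u - \<delta>)) = (LINT u|lborel. H u)"
    using lborel_integrable_real_affine[OF intH, of 1 "- \<delta>"]
      lborel_integral_real_affine[of 1 H "- \<delta>"] by auto
  define L where "L u = indicator {\<delta>..2 * \<delta>} u * H u" for u
  have L_meas [measurable]: "L \<in> borel_measurable borel" unfolding L_def[abs_def] by measurable
  have intL: "integrable lborel L"
    by (rule Bochner_Integration.integrable_bound[OF intH]) (auto simp: L_def indicator_def)
  have eq: "far \<delta> = (\<lambda>u. (H (u - \<delta>) - H u) + L u)"
    using \<delta> by (auto simp: fun_eq_iff far_def H_def L_def indicator_def)
  show "integrable lborel (far \<delta>)" unfolding eq using shift(1) intH intL by simp
  have "(LINT u|lborel. far \<delta> u) = (LINT u|lborel. L u)"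
    unfolding eq using shift intH intL by simp
  also have "\<dots> \<le> (LINT u|lborel. indicator {\<delta>..2 * \<delta>} u * h \<delta>)"
  proof (intro integral_mono intL)
    show "integrable lborel (\<lambda>u. indicator {\<delta>..2 * \<delta>} u * h \<delta>)"
      using \<delta> by (intro integrable_mult_left) (simp add: integrable_indicator_iff)
    show "L u \<le> indicator {\<delta>..2 * \<delta>} u * h \<delta>" for u
    proof -
      have "H u \<le> h \<delta> * 1"
        using H_le[of u] nonneg[of \<delta>] mult_left_mono[of "indicator {0..1} u" 1 "h \<delta>"]
        by (auto simp: indicator_def)
      then show ?thesis by (simp add: L_def indicator_def)
    qed
  qed
  also have "\<dots> = \<delta> * h \<delta>" using \<delta> by simp
  finally show "(LINT u|lborel. far \<delta> u) \<le> \<delta> * h \<delta>" .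
qed

lemma sum_far_le:
  assumes \<delta>: "0 < \<delta>" and c: "c = 1 \<or> c = (- 1 :: real)"
  shows "(\<Sum>s\<in>{1..N}. far \<delta> (y + c * (real s * \<delta>))) \<le> h \<delta>"
proof (rule sum_translates_le[where H="\<lambda>u. h (max u \<delta>)", OF _ _ _ c])
  show "far \<delta> u \<le> h (max (u - \<delta>) \<delta>) - h (max u \<delta>)" for u
    using decreasing[of "max (u - \<delta>) \<delta>" "max u \<delta>"] \<delta> by (auto simp: far_def max_def)
  show "h (max u \<delta>) \<le> h \<delta>" for u using \<delta> by (intro decreasing) auto
qed (rule nonneg)

text \<open>The indicator of \<open>{0<..2 * \<delta>}\<close> is dominated by a decrement of a piecewise linear function with
values in \<open>{0..3}\<close>.\<close>

lemma sum_near_overlap_le: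
  assumes \<delta>: "0 < \<delta>" and c: "c = 1 \<or> c = (- 1 :: real)"
  shows "(\<Sum>s\<in>{1..N}. indicator {0<..2 * \<delta>} (y + c * (real s * \<delta>))) \<le> (3 :: real)"
proof (rule sum_translates_le[where H="\<lambda>u. 3 - max 0 (min 3 (u / \<delta> + 1))", OF _ _ _ c])
  show "indicator {0<..2 * \<delta>} u \<le> 3 - max 0 (min 3 ((u - \<delta>) / \<delta> + 1)) - (3 - max 0 (min 3 (u / \<delta> + 1)))" for u
  proof (cases "u \<in> {0<..2 * \<delta>}")
    case True
    then have "0 < u / \<delta>" "u / \<delta> \<le> 2" using \<delta> by (auto simp: field_simps)
    then show ?thesis using True \<delta> by (simp add: diff_divide_distrib)
  next
    case False
    then show ?thesis using \<delta> by (simp add: diff_divide_distrib max_def min_def)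
  qed
qed auto

text \<open>For \<open>c = 1\<close> the section of the Volterra kernel, for \<open>c = - 1\<close> of its mirror image.\<close>

definition translate :: "real \<Rightarrow> real \<Rightarrow> l2" where
  "translate c t = abs_l2 (\<lambda>x. h (c * (t - x)))"

lemma square_integrable_translate:
  assumes "\<bar>c\<bar> = 1"
  shows "square_integrable01 (\<lambda>x. h (c * (t - x)))"
  unfolding square_integrable01_def
  using leb01_integral_translate(1)[OF square_integrable _ assms] by (auto intro!: measurable_restrict_space1 measurable_completion)

lemma translate_diff:
  assumes c: "c = 1 \<or> c = - 1"
  shows "translate c s - translate c (s - \<delta>) =
    abs_l2 (\<lambda>x. c * increment \<delta> (c * ((if c = 1 then s else s - \<delta>) - x)))"
proof -
  have "\<bar>c\<bar> = 1" using c by auto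
  then have "translate c s - translate c (s - \<delta>) = abs_l2 (\<lambda>x. h (c * (s - x)) - h (c * ((s - \<delta>) - x)))"
    unfolding translate_def by (intro abs_l2_diff square_integrable_translate)
  also have "(\<lambda>x. h (c * (s - x)) - h (c * ((s - \<delta>) - x))) = (\<lambda>x. c * increment \<delta> (c * ((if c = 1 then s else s - \<delta>) - x)))"
    using c by (auto simp: increment_def algebra_simps)
  finally show ?thesis .
qed

lemma translate_modulus:
  assumes c: "c = 1 \<or> c = - 1" and st: "\<bar>s - t\<bar> \<le> \<delta>"
  shows "(norm (translate c s - translate c t))\<^sup>2 \<le> 2 * energy \<delta>"
proof -
  have main: "(norm (translate c s - translate c t))\<^sup>2 \<le> 2 * energy \<delta>" if lt: "t < s" "\<bar>s - t\<bar> \<le> \<delta>" for s t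
  proof -
    define d where "d = s - t"
    have d: "0 < d" "d \<le> \<delta>" "t = s - d" using lt by (auto simp: d_def)
    have c1: "\<bar>c\<bar> = 1" using c by auto
    define \<sigma> where "\<sigma> = (if c = 1 then s else s - d)"
    define g where "g x = c * increment d (c * (\<sigma> - x))" for x
    have c2: "c * c = 1" using c by auto
    have g2: "(g x)\<^sup>2 = (increment d (c * (\<sigma> - x)))\<^sup>2" for x
      using c by (auto simp: g_def power_mult_distrib)
    have int: "integrable leb01 (\<lambda>x. (increment d (c * (\<sigma> - x)))\<^sup>2)"
      "(LINT x|leb01. (increment d (c * (\<sigma> - x)))\<^sup>2) \<le> (LINT u|lborel. (increment d u)\<^sup>2)"
      by (rule leb01_integral_translate[OF increment_square(1)[OF d(1)] _ c1]; simp)+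
    have sq: "square_integrable01 g"
      unfolding square_integrable01_def g2 using int(1) unfolding g_def
      by (auto intro!: measurable_restrict_space1 measurable_completion)
    have "(norm (translate c s - translate c t))\<^sup>2 = (norm (abs_l2 g))\<^sup>2"
      unfolding d(3) translate_diff[OF c] \<sigma>_def[symmetric] g_def ..
    also have "\<dots> = (LINT x|leb01. (g x)\<^sup>2)"
      unfolding power2_norm_eq_inner inner_abs_l2[OF sq sq] by (simp add: power2_eq_square)
    also have "\<dots> \<le> 2 * energy d"
      unfolding g2 using int(2) increment_square(2)[OF d(1)] by linarith
    also have "\<dots> \<le> 2 * energy \<delta>" using energy_mono[OF d(2)] by simp
    finally show ?thesis .
  qed
  consider "s = t" | "t < s" | "s < t" by linarith
  then show ?thesis
  proof cases
    case 1
    then show ?thesis using energy_nonneg by simp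
  next
    case 2
    then show ?thesis using main st by blast
  next
    case 3
    then show ?thesis using main[of s t] st by (simp add: norm_minus_commute abs_minus_commute)
  qed
qed

text \<open>Near and far parts contribute \<open>2 * energy \<delta> * 3\<close> and \<open>\<delta> * h \<delta> * h \<delta>\<close>; the latter is at most \<open>energy \<delta>\<close>
because \<open>h\<close> is decreasing.\<close>

lemma translate_Bessel:
  assumes c: "c = 1 \<or> c = - 1" and \<delta>: "0 < \<delta>"
  shows "(\<Sum>s\<in>{1..N}. (inner (translate c (real s * \<delta>) - translate c ((real s - 1) * \<delta>)) f)\<^sup>2)
    \<le> 14 * energy \<delta> * (norm f)\<^sup>2"
proof -
  define \<phi> where "\<phi> = rep_l2 f"
  have \<phi>: "square_integrable01 \<phi>" "abs_l2 \<phi> = f" by (simp_all add: \<phi>_def square_integrable01_rep_l2)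
  have c1: "\<bar>c\<bar> = 1" using c by auto
  define \<sigma> where "\<sigma> s = (if c = 1 then real s * \<delta> else real s * \<delta> - \<delta>)" for s :: nat
  define U where "U s x = c * (\<sigma> s - x)" for s x
  define y where "y x = (if c = 1 then - x else x + \<delta>)" for x
  have U: "U s x = y x + c * (real s * \<delta>)" for s x
    using c by (auto simp: U_def \<sigma>_def y_def algebra_simps)
  have U_meas: "(\<lambda>x. F (U s x)) \<in> borel_measurable leb01" if "F \<in> borel_measurable borel" for F :: "real \<Rightarrow> real" and s
  proof -
    note that [measurable]
    show ?thesis unfolding U_def by (intro measurable_restrict_space1 measurable_completion) measurable
  qed
  have tr: "integrable leb01 (\<lambda>x. F (U s x))" "(LINT x|leb01. F (U s x)) \<le> (LINT u|lborel. F u)"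
    if "integrable lborel F" "\<And>u. 0 \<le> F u" for F :: "real \<Rightarrow> real" and s
    unfolding U_def using leb01_integral_translate[OF that c1] by auto
  have near_le: "(near \<delta> u)\<^sup>2 \<le> (increment \<delta> u)\<^sup>2" for u by (simp add: near_def)
  have near_int: "integrable lborel (\<lambda>u. (near \<delta> u)\<^sup>2)"
    by (rule Bochner_Integration.integrable_bound[OF increment_square(1)[OF \<delta>]]) (auto simp: near_le)
  have "(LINT u|lborel. (near \<delta> u)\<^sup>2) \<le> (LINT u|lborel. (increment \<delta> u)\<^sup>2)"
    by (intro integral_mono near_int increment_square(1)[OF \<delta>] near_le)
  then have near_bound: "(LINT u|lborel. (near \<delta> u)\<^sup>2) \<le> 2 * energy \<delta>" using increment_square(2)[OF \<delta>] by linarith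
  have sq_near: "square_integrable01 (\<lambda>x. near \<delta> (U s x))" for s
    using tr(1)[OF near_int] U_meas[of "near \<delta>" s] by (simp add: square_integrable01_def)
  have sq_far: "square_integrable01 (\<lambda>x. sqrt (far \<delta> (U s x)))" for s
    using tr(1)[OF far_integral(1)[OF \<delta>] far_nonneg[OF \<delta>], of s] U_meas[of "\<lambda>u. sqrt (far \<delta> u)" s] far_nonneg[OF \<delta>]
    by (simp add: square_integrable01_def)
  define q where "q s x = (indicator {0<..2 * \<delta>} (U s x) :: real)" for s x
  have near_q: "near \<delta> (U s x) * q s x = near \<delta> (U s x)" for s x
    using support[of "U s x"] support[of "U s x - \<delta>"] \<delta> by (auto simp: q_def indicator_def near_def increment_def)
  have norm_f: "(LINT x|leb01. (\<phi> x)\<^sup>2) = (norm f)\<^sup>2"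
    using inner_abs_l2[OF \<phi>(1) \<phi>(1)] unfolding \<phi>(2) power2_norm_eq_inner by (simp add: power2_eq_square)
  have near_sum: "(\<Sum>s\<in>{1..N}. (LINT x|leb01. near \<delta> (U s x) * q s x * \<phi> x)\<^sup>2) \<le> (2 * energy \<delta>) * 3 * (LINT x|leb01. (\<phi> x)\<^sup>2)"
  proof (rule weighted_Bessel[OF _ _ _ _ _ \<phi>(1)])
    show "(LINT x|leb01. (near \<delta> (U s x))\<^sup>2) \<le> 2 * energy \<delta>" for s
      using tr(2)[OF near_int, of s] near_bound by simp
    show "q s \<in> borel_measurable leb01" for s
      unfolding q_def by (rule U_meas) simp
    show "(\<Sum>s\<in>{1..N}. (q s x)\<^sup>2) \<le> 3" for x
    proof -
      have "(q s x)\<^sup>2 = q s x" for s by (simp add: q_def indicator_def)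
      then show ?thesis using sum_near_overlap_le[OF \<delta> c, where N=N and y="y x"] by (simp add: q_def U)
    qed
  qed (auto simp: sq_near energy_nonneg)
  have far_sum: "(\<Sum>s\<in>{1..N}. (LINT x|leb01. sqrt (far \<delta> (U s x)) * sqrt (far \<delta> (U s x)) * \<phi> x)\<^sup>2) \<le> (\<delta> * h \<delta>) * h \<delta> * (LINT x|leb01. (\<phi> x)\<^sup>2)"
  proof (rule weighted_Bessel[OF _ _ _ _ _ \<phi>(1)])
    show "(LINT x|leb01. (sqrt (far \<delta> (U s x)))\<^sup>2) \<le> \<delta> * h \<delta>" for s
      using tr(2)[OF far_integral(1)[OF \<delta>] far_nonneg[OF \<delta>], of s] far_integral(2)[OF \<delta>] far_nonneg[OF \<delta>] by simp
    show "(\<lambda>x. sqrt (far \<delta> (U s x))) \<in> borel_measurable leb01" for s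
      by (rule U_meas) measurable
    show "(\<Sum>s\<in>{1..N}. (sqrt (far \<delta> (U s x)))\<^sup>2) \<le> h \<delta>" for x
      using sum_far_le[OF \<delta> c, where N=N and y="y x"] far_nonneg[OF \<delta>] by (simp add: U)
    show "0 \<le> \<delta> * h \<delta>" using \<delta> nonneg by simp
  qed (auto simp: sq_far)
  define a where "a s = (LINT x|leb01. near \<delta> (U s x) * \<phi> x)" for s
  define b where "b s = (LINT x|leb01. far \<delta> (U s x) * \<phi> x)" for s
  have split: "(inner (translate c (real s * \<delta>) - translate c ((real s - 1) * \<delta>)) f)\<^sup>2 \<le> 2 * (a s)\<^sup>2 + 2 * (b s)\<^sup>2" for s
  proof -
    have int: "integrable leb01 (\<lambda>x. near \<delta> (U s x) * \<phi> x)" "integrable leb01 (\<lambda>x. far \<delta> (U s x) * \<phi> x)"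
    proof -
      show "integrable leb01 (\<lambda>x. near \<delta> (U s x) * \<phi> x)" by (rule square_integrable01_mult[OF sq_near \<phi>(1)])
      have "square_integrable01 (\<lambda>x. near \<delta> (U s x) - increment \<delta> (U s x))"
      proof (rule square_integrable01_diff[OF sq_near])
        show "square_integrable01 (\<lambda>x. increment \<delta> (U s x))"
          using tr(1)[OF increment_square(1)[OF \<delta>]] U_meas[of "increment \<delta>" s] by (simp add: square_integrable01_def)
      qed
      then have "square_integrable01 (\<lambda>x. far \<delta> (U s x))" by (simp add: increment_near_far)
      then show "integrable leb01 (\<lambda>x. far \<delta> (U s x) * \<phi> x)" by (rule square_integrable01_mult[OF _ \<phi>(1)])
    qed
    have sq: "square_integrable01 (\<lambda>x. c * increment \<delta> (U s x))"
      using tr(1)[OF increment_square(1)[OF \<delta>]] U_meas[of "increment \<delta>" s]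
      by (intro square_integrable01_cmult) (simp add: square_integrable01_def)
    have "(real s - 1) * \<delta> = real s * \<delta> - \<delta>" by (simp add: algebra_simps)
    then have "translate c (real s * \<delta>) - translate c ((real s - 1) * \<delta>) = abs_l2 (\<lambda>x. c * increment \<delta> (U s x))"
      using translate_diff[OF c, of "real s * \<delta>" \<delta>] by (simp add: U_def \<sigma>_def)
    then have "inner (translate c (real s * \<delta>) - translate c ((real s - 1) * \<delta>)) f = (LINT x|leb01. c * increment \<delta> (U s x) * \<phi> x)"
      using inner_abs_l2[OF sq \<phi>(1)] by (simp add: \<phi>(2))
    also have "\<dots> = (LINT x|leb01. c * (near \<delta> (U s x) * \<phi> x - far \<delta> (U s x) * \<phi> x))"
      by (intro Bochner_Integration.integral_cong) (auto simp: increment_near_far algebra_simps)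
    also have "\<dots> = c * (a s - b s)" using int by (simp add: a_def b_def)
    finally have "(inner (translate c (real s * \<delta>) - translate c ((real s - 1) * \<delta>)) f)\<^sup>2 = (a s - b s)\<^sup>2"
      using c by (auto simp: power_mult_distrib power2_commute)
    also have "\<dots> \<le> 2 * (a s)\<^sup>2 + 2 * (b s)\<^sup>2"
      using zero_le_power2[of "a s + b s"] by (simp add: power2_eq_square algebra_simps)
    finally show ?thesis .
  qed
  have "(\<Sum>s\<in>{1..N}. (inner (translate c (real s * \<delta>) - translate c ((real s - 1) * \<delta>)) f)\<^sup>2)
      \<le> 2 * (\<Sum>s\<in>{1..N}. (a s)\<^sup>2) + 2 * (\<Sum>s\<in>{1..N}. (b s)\<^sup>2)"
    unfolding sum_distrib_left sum.distrib[symmetric] by (intro sum_mono split)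
  also have "(\<Sum>s\<in>{1..N}. (a s)\<^sup>2) \<le> 6 * energy \<delta> * (norm f)\<^sup>2"
    using near_sum by (simp add: near_q a_def norm_f)
  also have "(\<Sum>s\<in>{1..N}. (b s)\<^sup>2) \<le> energy \<delta> * (norm f)\<^sup>2"
  proof -
    have "(\<Sum>s\<in>{1..N}. (b s)\<^sup>2) \<le> \<delta> * (h \<delta>)\<^sup>2 * (norm f)\<^sup>2"
      using far_sum unfolding norm_f real_sqrt_mult_self abs_of_nonneg[OF far_nonneg[OF \<delta>]] b_def
      by (simp add: power2_eq_square[of "h \<delta>"] mult.assoc)
    also have "\<dots> \<le> energy \<delta> * (norm f)\<^sup>2" using \<delta> by (intro mult_right_mono energy_ge) auto
    finally show ?thesis .
  qed
  finally show ?thesis by (simp add: algebra_simps)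
qed

end

section \<open>Sums of powers and exponentials\<close>

text \<open>Powers of quantities that agree up to a factor \<open>D\<close> agree up to a power of \<open>D\<close>, whatever the sign of the
exponent. All asymptotic comparisons below are instances.\<close>

lemma powr_ratio_le:
  fixes x y D :: real
  assumes "0 < x" "0 < y" "1 \<le> D" "y \<le> D * x" "x \<le> D * y"
  shows "y powr a \<le> D powr \<bar>a\<bar> * x powr a"
proof (cases "0 \<le> a")
  case True
  have "y powr a \<le> (D * x) powr a" using assms True by (intro powr_mono2) auto
  then show ?thesis using assms True by (simp add: powr_mult)
next
  case False
  have "(D * y) powr a \<le> x powr a" using assms False by (intro powr_mono2') auto
  then have "D powr (- a) * (D powr a * y powr a) \<le> D powr (- a) * x powr a"
    using assms by (intro mult_left_mono) (auto simp: powr_mult)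
  moreover have "D powr (- a) * (D powr a * y powr a) = y powr a"
    using assms by (simp add: powr_minus field_simps)
  ultimately show ?thesis using False by simp
qed

definition dyadic_power :: "real \<Rightarrow> real \<Rightarrow> nat \<Rightarrow> real" where
  "dyadic_power a g j = 2 powr (a * real j) * (real j + 1) powr (- g)"

lemma dyadic_power_pos: "0 < dyadic_power a g j"
  by (simp add: dyadic_power_def)

lemma dyadic_power_shift:
  shows "dyadic_power a g (j + d) \<le> (2 powr (a * d) * (1 + real d) powr \<bar>g\<bar>) * dyadic_power a g j"
    and "dyadic_power a g j \<le> (2 powr (- a * d) * (1 + real d) powr \<bar>g\<bar>) * dyadic_power a g (j + d)"
proof -
  have ratio: "real j + d + 1 \<le> (1 + real d) * (real j + 1)" "real j + 1 \<le> (1 + real d) * (real j + d + 1)"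
    by (simp_all add: algebra_simps)
  have "(real j + d + 1) powr (- g) \<le> (1 + real d) powr \<bar>- g\<bar> * (real j + 1) powr (- g)"
    using ratio by (intro powr_ratio_le) auto
  then have "2 powr (a * (j + d)) * (real j + d + 1) powr (- g)
      \<le> 2 powr (a * (j + d)) * ((1 + real d) powr \<bar>- g\<bar> * (real j + 1) powr (- g))"
    by (intro mult_left_mono) auto
  then show "dyadic_power a g (j + d) \<le> (2 powr (a * d) * (1 + real d) powr \<bar>g\<bar>) * dyadic_power a g j"
    by (simp add: dyadic_power_def powr_add[symmetric] algebra_simps)
  have "(real j + 1) powr (- g) \<le> (1 + real d) powr \<bar>- g\<bar> * (real j + d + 1) powr (- g)"
    using ratio by (intro powr_ratio_le) auto
  then have "2 powr (a * j) * (real j + 1) powr (- g)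
      \<le> 2 powr (- a * d + a * (j + d)) * ((1 + real d) powr \<bar>- g\<bar> * (real j + d + 1) powr (- g))"
    by (intro mult_mono) (auto simp: algebra_simps)
  then show "dyadic_power a g j \<le> (2 powr (- a * d) * (1 + real d) powr \<bar>g\<bar>) * dyadic_power a g (j + d)"
    unfolding powr_add by (simp add: dyadic_power_def mult_ac)
qed

text \<open>A geometric series absorbs the polynomial factors that come from shifting the arguments of slowly varying
functions.\<close>

lemma summable_power_times_geometric:
  fixes a b :: real
  assumes "0 < a"
  shows "summable (\<lambda>i. (1 + real i) powr b * 2 powr (- a * real i))"
proof (rule summable_comparison_test_bigo)
  show "summable (\<lambda>i. norm (1 / real i ^ 2))"
    using inverse_power_summable[of 2, where ?'a = real] by (simp add: divide_inverse)
  show "(\<lambda>i. (1 + real i) powr b * 2 powr (- a * real i)) \<in> O(\<lambda>i. 1 / real i ^ 2)"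
    using assms by real_asymp
qed

definition geometric_const :: "real \<Rightarrow> real \<Rightarrow> real" where
  "geometric_const a b = (\<Sum>i. (1 + real i) powr b * 2 powr (- a * real i))"

lemma geometric_const_ge:
  assumes "0 < a" "finite I"
  shows "(\<Sum>i\<in>I. (1 + real i) powr b * 2 powr (- a * real i)) \<le> geometric_const a b"
  unfolding geometric_const_def
  by (rule sum_le_suminf[OF summable_power_times_geometric]) (use assms in auto)

lemma geometric_const_ge_1: "0 < a \<Longrightarrow> 1 \<le> geometric_const a b"
  using geometric_const_ge[of a "{0}" b] by simp

lemma sum_dyadic_power_decreasing:
  assumes "0 < a"
  shows "(\<Sum>j\<in>{i..<i + n}. dyadic_power (- a) g j) \<le> geometric_const a \<bar>g\<bar> * dyadic_power (- a) g i"
proof -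
  have "(\<Sum>j\<in>{i..<i + n}. dyadic_power (- a) g j) = (\<Sum>d<n. dyadic_power (- a) g (i + d))"
    by (rule sum.reindex_bij_witness[of _ "\<lambda>d. i + d" "\<lambda>j. j - i"]) auto
  also have "\<dots> \<le> (\<Sum>d<n. ((1 + real d) powr \<bar>g\<bar> * 2 powr (- a * d)) * dyadic_power (- a) g i)"
    using dyadic_power_shift(1)[of "- a" g i] by (intro sum_mono) (simp add: mult_ac)
  also have "\<dots> \<le> geometric_const a \<bar>g\<bar> * dyadic_power (- a) g i"
    unfolding sum_distrib_right[symmetric] using dyadic_power_pos[of "- a" g i]
    by (intro mult_right_mono geometric_const_ge assms) auto
  finally show ?thesis .
qed

lemma sum_dyadic_power_increasing:
  assumes "0 < a"
  shows "(\<Sum>j\<le>q. dyadic_power a g j) \<le> geometric_const a \<bar>g\<bar> * dyadic_power a g q"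
proof -
  have "(\<Sum>j\<le>q. dyadic_power a g j) = (\<Sum>d\<le>q. dyadic_power a g (q - d))"
    by (rule sum.reindex_bij_witness[of _ "\<lambda>d. q - d" "\<lambda>j. q - j"]) auto
  also have "\<dots> \<le> (\<Sum>d\<le>q. ((1 + real d) powr \<bar>g\<bar> * 2 powr (- a * d)) * dyadic_power a g q)"
  proof (rule sum_mono)
    fix d assume "d \<in> {..q}"
    then show "dyadic_power a g (q - d) \<le> ((1 + real d) powr \<bar>g\<bar> * 2 powr (- a * d)) * dyadic_power a g q"
      using dyadic_power_shift(2)[of a g "q - d" d] by (simp add: mult_ac)
  qed
  also have "\<dots> \<le> geometric_const a \<bar>g\<bar> * dyadic_power a g q"
    unfolding sum_distrib_right[symmetric] using dyadic_power_pos[of a g q]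
    by (intro mult_right_mono geometric_const_ge assms) auto
  finally show ?thesis .
qed

lemma powr_increment_ge:
  fixes x g :: real
  assumes x: "1 \<le> x" and g: "g \<noteq> 1"
  shows "x powr (- g) \<le> 2 powr \<bar>g\<bar> / \<bar>1 - g\<bar> * \<bar>(x + 1) powr (1 - g) - x powr (1 - g)\<bar>"
proof -
  have "\<exists>z. x < z \<and> z < x + 1 \<and> (x + 1) powr (1 - g) - x powr (1 - g) = (x + 1 - x) * ((1 - g) * z powr (1 - g - 1))"
    by (rule MVT2) (use x in \<open>auto intro!: derivative_eq_intros\<close>)
  then obtain z where z: "x < z" "z < x + 1" "(x + 1) powr (1 - g) - x powr (1 - g) = (1 - g) * z powr (- g)"
    by auto
  have "x powr (- g) \<le> 2 powr \<bar>- g\<bar> * z powr (- g)" using x z by (intro powr_ratio_le) auto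
  also have "\<dots> = 2 powr \<bar>g\<bar> / \<bar>1 - g\<bar> * \<bar>(x + 1) powr (1 - g) - x powr (1 - g)\<bar>"
    using g unfolding z(3) by (simp add: abs_mult)
  finally show ?thesis .
qed

lemma sum_powr_tail:
  assumes g: "1 < g"
  shows "(\<Sum>j\<in>{i..<i + n}. dyadic_power 0 g j) \<le> 2 powr g / (g - 1) * dyadic_power 0 (g - 1) i"
proof -
  define K where "K = 2 powr g / (g - 1)"
  have K: "0 \<le> K" using g by (simp add: K_def)
  have "(\<Sum>j\<in>{i..<i + n}. dyadic_power 0 g j) \<le> K * ((real i + 1) powr (1 - g) - (real (i + n) + 1) powr (1 - g))"
  proof (induction n)
    case (Suc n)
    have "(real (i + n) + 1) powr (- g) \<le> K * \<bar>(real (i + n) + 1 + 1) powr (1 - g) - (real (i + n) + 1) powr (1 - g)\<bar>"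
      using powr_increment_ge[of "real (i + n) + 1" g] g by (simp add: K_def)
    also have "\<bar>(real (i + n) + 1 + 1) powr (1 - g) - (real (i + n) + 1) powr (1 - g)\<bar> =
        (real (i + n) + 1) powr (1 - g) - (real (i + n) + 1 + 1) powr (1 - g)"
      using powr_mono2'[of "1 - g" "real (i + n) + 1" "real (i + n) + 1 + 1"] g by simp
    finally have "dyadic_power 0 g (i + n) \<le> K * ((real (i + n) + 1) powr (1 - g) - (real (i + n) + 1 + 1) powr (1 - g))"
      by (simp add: dyadic_power_def)
    then show ?case using Suc by (simp add: algebra_simps)
  qed simp
  also have "\<dots> \<le> K * (real i + 1) powr (1 - g)" using K by (intro mult_left_mono) auto
  finally show ?thesis by (simp add: K_def dyadic_power_def)
qed

lemma sum_powr_growing: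
  assumes g: "g < 1"
  shows "(\<Sum>j\<le>q. dyadic_power 0 g j) \<le> 2 powr \<bar>g\<bar> / (1 - g) * 2 powr (1 - g) * dyadic_power 0 (g - 1) q"
proof -
  define K where "K = 2 powr \<bar>g\<bar> / (1 - g)"
  have K: "0 \<le> K" using g by (simp add: K_def)
  have step: "dyadic_power 0 g j \<le> K * ((real j + 2) powr (1 - g) - (real j + 1) powr (1 - g))" for j
  proof -
    have "(real j + 1) powr (- g) \<le> K * \<bar>(real j + 1 + 1) powr (1 - g) - (real j + 1) powr (1 - g)\<bar>"
      using powr_increment_ge[of "real j + 1" g] g by (simp add: K_def)
    also have "\<bar>(real j + 1 + 1) powr (1 - g) - (real j + 1) powr (1 - g)\<bar> = (real j + 2) powr (1 - g) - (real j + 1) powr (1 - g)"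
      using powr_mono2[of "1 - g" "real j + 1" "real j + 1 + 1"] g by (simp add: add.assoc)
    finally show ?thesis by (simp add: dyadic_power_def)
  qed
  have "(\<Sum>j\<le>q. dyadic_power 0 g j) \<le> K * ((real q + 2) powr (1 - g) - 1)"
  proof (induction q)
    case 0
    then show ?case using step[of 0] by simp
  next
    case (Suc q)
    then show ?case using step[of "Suc q"] by (simp add: algebra_simps)
  qed
  also have "\<dots> \<le> K * (2 powr (1 - g) * (real q + 1) powr (1 - g))"
  proof (intro mult_left_mono K)
    have "(real q + 2) powr (1 - g) \<le> (2 * (real q + 1)) powr (1 - g)" using g by (intro powr_mono2) auto
    also have "\<dots> = 2 powr (1 - g) * (real q + 1) powr (1 - g)" by (rule powr_mult) 
    finally show "(real q + 2) powr (1 - g) - 1 \<le> 2 powr (1 - g) * (real q + 1) powr (1 - g)" by simp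
  qed
  finally show ?thesis by (simp add: K_def dyadic_power_def)
qed

lemma sum_harmonic_le: "(\<Sum>j\<le>q. dyadic_power 0 1 j) \<le> 1 + ln (real q + 1)"
proof (induction q)
  case 0
  show ?case by (simp add: dyadic_power_def)
next
  case (Suc q)
  have "ln ((real q + 1) / (real q + 2)) \<le> (real q + 1) / (real q + 2) - 1" by (intro ln_le_minus_one) simp
  also have "\<dots> = - (1 / (real q + 2))" by (simp add: field_simps)
  finally have "1 / (real q + 2) \<le> ln (real q + 2) - ln (real q + 1)" by (simp add: ln_div)
  then show ?case using Suc by (simp add: dyadic_power_def powr_minus divide_inverse add.commute)
qed

section \<open>Approximation rates\<close>

text \<open>The iterated logarithm of \<open>2 ^ q\<close>, normalized to be at least \<open>1\<close>.\<close>

definition log_scale :: "nat \<Rightarrow> real" where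
  "log_scale q = 1 + log 2 (real q + 1)"

text \<open>The rate \<open>n\<^sup>-\<^sup>a (log n)\<^sup>-\<^sup>b (log log n)\<^sup>-\<^sup>g\<close> at \<open>n = 2 ^ q\<close>. All cases of the theorem are of this form, and
so are, up to constants, the kernel and the square roots of its energies at the points \<open>1 / 2 ^ q\<close>.\<close>

definition dyadic_rate :: "real \<Rightarrow> real \<Rightarrow> real \<Rightarrow> nat \<Rightarrow> real" where
  "dyadic_rate a b g q = 2 powr (- a * real q) * (real q + 1) powr (- b) * log_scale q powr (- g)"

lemma log_scale_ge_1: "1 \<le> log_scale q"
  by (simp add: log_scale_def)

lemma log_scale_add: "log_scale p \<le> log_scale (p + j)" "log_scale (p + j) \<le> (1 + real j) * log_scale p"
proof -
  show "log_scale p \<le> log_scale (p + j)" by (simp add: log_scale_def)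
  have "log 2 (real (p + j) + 1) \<le> log 2 ((real p + 1) * (real j + 1))"
    by (intro log_mono) (auto simp: algebra_simps)
  also have "\<dots> = log 2 (real p + 1) + log 2 (real j + 1)" by (simp add: log_mult)
  also have "log 2 (real j + 1) \<le> real j"
  proof -
    have "real j + 1 \<le> 2 ^ j" by (metis Suc_leI add.commute less_exp of_nat_Suc of_nat_le_iff of_nat_numeral of_nat_power)
    then have "log 2 (real j + 1) \<le> log 2 (2 ^ j)" by (simp add: log_le_cancel_iff del: log_pow_cancel)
    then show ?thesis by simp
  qed
  finally have "log_scale (p + j) \<le> log_scale p + real j * 1" by (simp add: log_scale_def)
  also have "\<dots> \<le> log_scale p + real j * log_scale p"
    by (intro add_left_mono mult_left_mono log_scale_ge_1) auto
  finally show "log_scale (p + j) \<le> (1 + real j) * log_scale p" by (simp add: algebra_simps)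
qed

lemma dyadic_rate_pos: "0 < dyadic_rate a b g q"
  using log_scale_ge_1[of q] by (auto simp: dyadic_rate_def)

lemma dyadic_rate_shift:
  shows "dyadic_rate a b g (p + j) \<le> 2 powr (- a * j) * (1 + real j) powr (\<bar>b\<bar> + \<bar>g\<bar>) * dyadic_rate a b g p"
    and "dyadic_rate a b g p \<le> 2 powr (a * j) * (1 + real j) powr (\<bar>b\<bar> + \<bar>g\<bar>) * dyadic_rate a b g (p + j)"
proof -
  define D where "D = 1 + real j"
  have D: "1 \<le> D" by (simp add: D_def)
  define x where "x = real p + 1"
  define y where "y = real (p + j) + 1"
  have xy: "0 < x" "0 < y" "y \<le> D * x" "x \<le> D * y" by (simp_all add: x_def y_def D_def algebra_simps)
  define u where "u = log_scale p"
  define v where "v = log_scale (p + j)"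
  have uv: "0 < u" "0 < v" "v \<le> D * u" "u \<le> D * v"
  proof -
    show "0 < u" "0 < v" using log_scale_ge_1[of p] log_scale_ge_1[of "p + j"] by (auto simp: u_def v_def)
    show "v \<le> D * u" using log_scale_add(2)[of p j] by (simp add: u_def v_def D_def)
    have "u \<le> v" using log_scale_add(1)[of p j] by (simp add: u_def v_def)
    also have "\<dots> \<le> D * v" using D \<open>0 < v\<close> by simp
    finally show "u \<le> D * v" .
  qed
  have rate_xy: "dyadic_rate a b g p = 2 powr (- a * real p) * (x powr (- b) * u powr (- g))"
    "dyadic_rate a b g (p + j) = 2 powr (- a * real (p + j)) * (y powr (- b) * v powr (- g))"
    by (simp_all only: dyadic_rate_def x_def y_def u_def v_def mult.assoc)
  have Dp: "D powr \<bar>- b\<bar> * D powr \<bar>- g\<bar> = D powr (\<bar>b\<bar> + \<bar>g\<bar>)" by (simp add: powr_add)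
  have "y powr (- b) * v powr (- g) \<le> (D powr \<bar>- b\<bar> * x powr (- b)) * (D powr \<bar>- g\<bar> * u powr (- g))"
    using D xy uv by (intro mult_mono powr_ratio_le) auto
  also have "\<dots> = D powr (\<bar>b\<bar> + \<bar>g\<bar>) * (x powr (- b) * u powr (- g))" unfolding Dp[symmetric] by simp
  finally have "2 powr (- a * real (p + j)) * (y powr (- b) * v powr (- g))
      \<le> 2 powr (- a * real (p + j)) * (D powr (\<bar>b\<bar> + \<bar>g\<bar>) * (x powr (- b) * u powr (- g)))"
    by (intro mult_left_mono) auto
  moreover have "2 powr (- a * real (p + j)) = 2 powr (- a * j) * 2 powr (- a * p)"
    by (simp add: powr_add[symmetric] algebra_simps)
  ultimately show "dyadic_rate a b g (p + j) \<le> 2 powr (- a * j) * (1 + real j) powr (\<bar>b\<bar> + \<bar>g\<bar>) * dyadic_rate a b g p"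
    unfolding rate_xy by (simp only: D_def mult_ac)
  have "x powr (- b) * u powr (- g) \<le> (D powr \<bar>- b\<bar> * y powr (- b)) * (D powr \<bar>- g\<bar> * v powr (- g))"
    using D xy uv by (intro mult_mono powr_ratio_le) auto
  also have "\<dots> = D powr (\<bar>b\<bar> + \<bar>g\<bar>) * (y powr (- b) * v powr (- g))" unfolding Dp[symmetric] by simp
  finally have "2 powr (- a * real p) * (x powr (- b) * u powr (- g))
      \<le> 2 powr (- a * real p) * (D powr (\<bar>b\<bar> + \<bar>g\<bar>) * (y powr (- b) * v powr (- g)))"
    by (intro mult_left_mono) auto
  moreover have "2 powr (- a * real p) = 2 powr (a * j) * 2 powr (- a * real (p + j))"
    by (simp add: powr_add[symmetric] algebra_simps)
  ultimately show "dyadic_rate a b g p \<le> 2 powr (a * j) * (1 + real j) powr (\<bar>b\<bar> + \<bar>g\<bar>) * dyadic_rate a b g (p + j)"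
    unfolding rate_xy by (simp only: D_def mult_ac)
qed

lemma dyadic_rate_le_rate:
  assumes n: "2 ^ p \<le> n" "n < 2 ^ Suc p"
  shows "4 powr - (\<bar>a\<bar> + \<bar>b\<bar> + \<bar>g\<bar>) * dyadic_rate a b g p
    \<le> real n powr (- a) * log 2 (real n + 1) powr (- b) * log 2 (log 2 (real n + 3)) powr (- g)"
proof -
  define N where "N = real n"
  define L where "L = log 2 (N + 1)"
  define M where "M = log 2 (log 2 (N + 3))"
  have "real (2 ^ p) \<le> N" "N + 1 \<le> real (2 ^ Suc p)"
    unfolding N_def using n by (simp only: of_nat_le_iff, metis Suc_eq_plus1 Suc_leI of_nat_1 of_nat_add of_nat_le_iff)
  then have N: "2 ^ p \<le> N" "N + 1 \<le> 2 ^ Suc p" by simp_all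
  have p1: "(1 :: real) \<le> 2 ^ p" by simp
  have L_ge: "1 \<le> L" "p \<le> L"
  proof -
    show "1 \<le> L" using N p1 unfolding L_def by (subst le_log_iff) auto
    show "p \<le> L" using N p1 unfolding L_def by (subst le_log_iff) (auto simp: powr_realpow)
  qed
  have L_le: "L \<le> p + 1"
    unfolding L_def using N p1 by (subst log_le_iff) (auto simp: powr_add powr_realpow)
  define l where "l = log 2 (N + 3)"
  have l: "2 \<le> l" "p \<le> l" "l \<le> p + 2"
  proof -
    show "2 \<le> l" using N p1 unfolding l_def by (subst le_log_iff) auto
    show "p \<le> l" using N p1 unfolding l_def by (subst le_log_iff) (auto simp: powr_realpow)
    show "l \<le> p + 2" unfolding l_def using N p1 by (subst log_le_iff) (auto simp: powr_add powr_realpow)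
  qed
  have scale: "log_scale p = log 2 (2 * (real p + 1))" unfolding log_scale_def by (subst log_mult) auto
  have M_le: "M \<le> log_scale p"
    unfolding M_def scale l_def[symmetric] using l by (intro log_mono) auto
  have M_ge1: "1 \<le> M" unfolding M_def l_def[symmetric] using l by (subst le_log_iff) auto
  have M_ge: "log_scale p \<le> 4 * M"
  proof -
    have "2 * (real p + 1) \<le> l ^ 4"
    proof -
      have "2 * (real p + 1) \<le> 2 * (l + l)" using l by simp
      also have "\<dots> = 4 * l" by simp
      also have "\<dots> \<le> l ^ 3 * l"
      proof (intro mult_right_mono)
        have "(2 :: real) ^ 3 \<le> l ^ 3" using l by (intro power_mono) auto
        then show "4 \<le> l ^ 3" by simp
      qed (use l in auto)
      also have "\<dots> = l ^ 4" by (simp add: power4_eq_xxxx power3_eq_cube)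
      finally show ?thesis .
    qed
    then have "log 2 (2 * (real p + 1)) \<le> log 2 (l ^ 4)" using l by (intro log_mono) auto
    also have "\<dots> = 4 * M" using l by (simp add: log_nat_power M_def l_def)
    finally show ?thesis by (simp add: scale)
  qed
  have 1: "(2 ^ p) powr (- a) \<le> 4 powr \<bar>- a\<bar> * N powr (- a)"
    using N p1 by (intro powr_ratio_le) auto
  have 2: "(real p + 1) powr (- b) \<le> 4 powr \<bar>- b\<bar> * L powr (- b)"
    using L_ge L_le by (intro powr_ratio_le) auto
  have 3: "log_scale p powr (- g) \<le> 4 powr \<bar>- g\<bar> * M powr (- g)"
    using M_ge M_le M_ge1 log_scale_ge_1[of p] by (intro powr_ratio_le) auto
  have pp: "2 powr (- a * p) = (2 ^ p) powr (- a)"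
    by (simp add: powr_realpow[symmetric] powr_powr mult.commute)
  have "dyadic_rate a b g p \<le> (4 powr \<bar>- a\<bar> * N powr (- a)) * (4 powr \<bar>- b\<bar> * L powr (- b)) * (4 powr \<bar>- g\<bar> * M powr (- g))"
    unfolding dyadic_rate_def pp by (intro mult_mono 1 2 3) auto
  also have "\<dots> = 4 powr (\<bar>a\<bar> + \<bar>b\<bar> + \<bar>g\<bar>) * (N powr (- a) * L powr (- b) * M powr (- g))"
    by (simp add: powr_add mult_ac)
  finally have "4 powr - (\<bar>a\<bar> + \<bar>b\<bar> + \<bar>g\<bar>) * dyadic_rate a b g p
      \<le> 4 powr - (\<bar>a\<bar> + \<bar>b\<bar> + \<bar>g\<bar>) * (4 powr (\<bar>a\<bar> + \<bar>b\<bar> + \<bar>g\<bar>) * (N powr (- a) * L powr (- b) * M powr (- g)))"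
    by (intro mult_left_mono) auto
  also have "\<dots> = N powr (- a) * L powr (- b) * M powr (- g)"
    by (simp add: mult.assoc[symmetric] powr_add[symmetric])
  finally show ?thesis by (simp add: N_def L_def M_def)
qed

section \<open>Approximation of the operators\<close>

text \<open>Level-by-level approximation up to the level \<open>p + J\<close> with \<open>J\<close> about \<open>2 powr (p / 2)\<close>. Up to a constant factor that is the
largest number of levels with positive ranks, and it makes the modulus on the finest grid negligible.\<close>

lemma approximation_polynomial_modulus:
  fixes T :: "'a::real_inner \<Rightarrow> C01" and \<kappa> :: "real \<Rightarrow> 'a" and W :: "nat \<Rightarrow> real"
  assumes T: "\<And>f t. apply_bcontfun (T f) t = inner (\<kappa> (real_of_ui t)) f"
    and W: "\<And>p. 0 < W p"
    and modulus: "\<And>p s t. s \<in> {0..1} \<Longrightarrow> t \<in> {0..1} \<Longrightarrow> \<bar>s - t\<bar> \<le> 1 / 2 ^ p \<Longrightarrow> norm (\<kappa> s - \<kappa> t) \<le> W p"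
    and Bessel: "\<And>p f. (\<Sum>s\<in>{1..2 ^ p}. (inner (\<kappa> (real s / 2 ^ p) - \<kappa> ((real s - 1) / 2 ^ p)) f)\<^sup>2) \<le> (W p)\<^sup>2 * (norm f)\<^sup>2"
    and decay: "0 < \<theta>" "\<And>p j. p0 \<le> p \<Longrightarrow> W (p + j) \<le> 2 powr (- \<theta> * j) * (1 + real j) powr b * W p"
  shows "\<exists>C. \<forall>p\<ge>p0. finite_rank_approx (4 * 2 ^ p) (C * (W p / sqrt (2 ^ p))) T"
proof -
  define G where "G = geometric_const \<theta> (b + 2)"
  have G: "1 \<le> G" unfolding G_def by (rule geometric_const_ge_1[OF decay(1)])
  have "finite_rank_approx (4 * 2 ^ p) (156 * G * (W p / sqrt (2 ^ p))) T" if p: "p0 \<le> p" for p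
  proof -
    define J where "J = (2 :: nat) ^ (p div 2)"
    have "J\<^sup>2 = 2 ^ (2 * (p div 2))" by (simp add: J_def power_mult[symmetric] mult.commute)
    also have "\<dots> \<le> 2 ^ p" by (intro power_increasing) auto
    finally have J: "J\<^sup>2 \<le> 2 ^ p" .
    have J2: "sqrt (2 ^ p) \<le> 2 * real J"
    proof (rule real_le_lsqrt)
      have "p \<le> 2 * (p div 2) + 2" by simp
      then have "(2 :: real) ^ p \<le> 2 ^ (2 * (p div 2) + 2)" by (intro power_increasing) auto
      also have "\<dots> = (2 * real J)\<^sup>2" by (simp add: J_def power_add power_mult_distrib power_mult[symmetric] mult.commute)
      finally show "(2 :: real) ^ p \<le> (2 * real J)\<^sup>2" .
    qed simp
    have "W (p + J) \<le> 2 * G * (W p / sqrt (2 ^ p))"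
    proof -
      have "(1 + real J) powr b * 2 powr (- \<theta> * J) * sqrt (2 ^ p) \<le> (1 + real J) powr b * 2 powr (- \<theta> * J) * (2 * (1 + real J) powr 2)"
      proof (intro mult_left_mono)
        have "(1 + real J) powr 1 \<le> (1 + real J) powr 2" by (intro powr_mono) auto
        then show "sqrt (2 ^ p) \<le> 2 * (1 + real J) powr 2" using J2 by simp
      qed auto
      also have "\<dots> = 2 * ((1 + real J) powr (b + 2) * 2 powr (- \<theta> * J))" by (simp add: powr_add)
      also have "\<dots> \<le> 2 * G"
        using geometric_const_ge[OF decay(1), of "{J}" "b + 2"] by (simp add: G_def)
      finally have le: "(1 + real J) powr b * 2 powr (- \<theta> * J) \<le> 2 * G / sqrt (2 ^ p)" by (simp add: field_simps)
      have "W (p + J) \<le> 2 powr (- \<theta> * J) * (1 + real J) powr b * W p" by (rule decay(2)[OF p])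
      also have "\<dots> \<le> 2 * G / sqrt (2 ^ p) * W p"
        using le W[of p] by (intro mult_right_mono) (auto simp: mult.commute)
      finally show ?thesis by simp
    qed
    moreover have "(\<Sum>j<J. (real j + 1)\<^sup>2 * W (p + Suc j)) \<le> G * W p"
    proof -
      have "(\<Sum>j<J. (real j + 1)\<^sup>2 * W (p + Suc j)) \<le> (\<Sum>j<J. ((1 + real (Suc j)) powr (b + 2) * 2 powr (- \<theta> * Suc j)) * W p)"
      proof (rule sum_mono)
        fix j
        have "(real j + 1)\<^sup>2 \<le> (1 + real (Suc j)) powr 2" by (simp add: powr_numeral power_mono)
        then have "(real j + 1)\<^sup>2 * W (p + Suc j) \<le> (1 + real (Suc j)) powr 2 * (2 powr (- \<theta> * Suc j) * (1 + real (Suc j)) powr b * W p)"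
          using W[of "p + Suc j"] by (intro mult_mono decay(2)[OF p]) auto
        also have "\<dots> = ((1 + real (Suc j)) powr (b + 2) * 2 powr (- \<theta> * Suc j)) * W p"
          by (simp add: powr_add mult_ac)
        finally show "(real j + 1)\<^sup>2 * W (p + Suc j) \<le> ((1 + real (Suc j)) powr (b + 2) * 2 powr (- \<theta> * Suc j)) * W p" .
      qed
      also have "\<dots> = (\<Sum>i\<in>Suc ` {..<J}. (1 + real i) powr (b + 2) * 2 powr (- \<theta> * i)) * W p"
        by (simp add: sum_distrib_right sum.reindex)
      also have "\<dots> \<le> G * W p"
        unfolding G_def using W[of p] by (intro mult_right_mono geometric_const_ge decay(1)) auto
      finally show ?thesis .
    qed
    ultimately have le: "154 / sqrt (2 ^ p) * (\<Sum>j<J. (real j + 1)\<^sup>2 * W (p + Suc j)) + W (p + J) \<le> 156 * G * (W p / sqrt (2 ^ p))"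
      using mult_left_mono[of "\<Sum>j<J. (real j + 1)\<^sup>2 * W (p + Suc j)" "G * W p" "154 / sqrt (2 ^ p)"] by simp
    have "finite_rank_approx (4 * 2 ^ p) (154 / sqrt (2 ^ p) * (\<Sum>j<J. (real j + 1)\<^sup>2 * W (p + Suc j)) + W (p + J)) T"
      by (rule finite_rank_approx_of_samples[OF T, where M="2 ^ (p + J)"])
        (use kolmogorov_approx_grid_Bessel[OF J W Bessel] modulus in \<open>auto simp del: power_Suc\<close>)
    then show ?thesis by (rule finite_rank_approx_mono[OF _ order_refl le])
  qed
  then show ?thesis by blast
qed

text \<open>Sampling on the grid with \<open>2 ^ 2 ^ q\<close> cells, so that its modulus \<open>\<omega> q\<close> is a term of the same form as
those of the chaining sum. The sum starts at the largest \<open>j\<close> for which the grid of \<open>2 ^ 2 ^ j\<close> cells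
has at most \<open>2 ^ q\<close> of them.\<close>

lemma approximation_logarithmic_modulus:
  fixes T :: "'a::real_inner \<Rightarrow> C01" and \<kappa> :: "real \<Rightarrow> 'a" and \<omega> :: "nat \<Rightarrow> real"
  assumes T: "\<And>f t. apply_bcontfun (T f) t = inner (\<kappa> (real_of_ui t)) f"
    and \<omega>: "\<And>j. 0 < \<omega> j"
    and modulus: "\<And>j s t. s \<in> {0..1} \<Longrightarrow> t \<in> {0..1} \<Longrightarrow> \<bar>s - t\<bar> \<le> 1 / 2 ^ 2 ^ j \<Longrightarrow> norm (\<kappa> s - \<kappa> t) \<le> \<omega> j"
    and q: "0 < q"
  shows "finite_rank_approx (3 * 2 ^ q) (24 / sqrt (2 ^ q) * (\<Sum>j\<in>{floor_log q..q}. \<omega> j * sqrt (2 ^ j))) T"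
proof -
  define j0 where "j0 = floor_log q"
  have j0: "2 ^ j0 \<le> q" "j0 < q"
  proof -
    show "2 ^ j0 \<le> q" unfolding j0_def by (rule floor_log_exp2_le[OF q])
    then show "j0 < q" using less_exp[of j0] by linarith
  qed
  have "(2 :: nat) ^ 2 ^ j0 \<le> 2 ^ q" using j0(1) by (intro power_increasing) auto
  then have rank: "2 ^ 2 ^ j0 + 1 + 2 ^ q \<le> (3 * 2 ^ q :: nat)" using one_le_power[of "2 :: nat" q] by linarith
  have "{j0..q} = insert q {j0..<q}" using j0(2) by auto
  then have "(\<Sum>j\<in>{j0..q}. \<omega> j * sqrt (2 ^ j)) = \<omega> q * sqrt (2 ^ q) + (\<Sum>j\<in>{j0..<q}. \<omega> j * sqrt (2 ^ j))" by simp
  then have "24 / sqrt (2 ^ q) * (\<Sum>j\<in>{j0..q}. \<omega> j * sqrt (2 ^ j)) =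
      24 / sqrt (2 ^ q) * (\<Sum>j\<in>{j0..<q}. \<omega> j * sqrt (2 ^ j)) + 24 * \<omega> q"
    by (simp add: distrib_left)
  then have le: "24 / sqrt (real (2 ^ q)) * (\<Sum>j\<in>{j0..<q}. \<omega> j * sqrt (2 ^ j)) + \<omega> q
      \<le> 24 / sqrt (2 ^ q) * (\<Sum>j\<in>{j0..q}. \<omega> j * sqrt (2 ^ j))"
    using \<omega>[of q] by simp
  have "kolmogorov_approx (2 ^ 2 ^ j0 + 1 + 2 ^ q) (24 / sqrt (real (2 ^ q)) * (\<Sum>j\<in>{j0..<q}. \<omega> j * sqrt (2 ^ j)))
      (\<lambda>i. \<kappa> (real i / 2 ^ 2 ^ q)) {..2 ^ 2 ^ q}"
    by (rule kolmogorov_approx_grid_chaining[OF j0(2) _ \<omega> modulus]) auto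
  then have "finite_rank_approx (2 ^ 2 ^ j0 + 1 + 2 ^ q) (24 / sqrt (real (2 ^ q)) * (\<Sum>j\<in>{j0..<q}. \<omega> j * sqrt (2 ^ j)) + \<omega> q) T"
    using modulus by (intro finite_rank_approx_of_samples[OF T, where M="2 ^ 2 ^ q"]) auto
  then show ?thesis
    unfolding j0_def[symmetric] by (rule finite_rank_approx_mono[OF _ rank le])
qed

lemma dominated_dyadic_rate:
  fixes T :: "'a::real_normed_vector \<Rightarrow> 'b::real_normed_vector"
  assumes T: "bounded_linear T"
    and approx: "\<exists>C p0. \<forall>p\<ge>p0. finite_rank_approx (c * 2 ^ p) (C * dyadic_rate a b g p) T"
    and r: "\<And>n. 0 < n \<Longrightarrow> r n = real n powr (- a) * log 2 (real n + 1) powr (- b) * log 2 (log 2 (real n + 3)) powr (- g)"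
    and s: "s = kolmogorov_number \<or> s = dyadic_entropy_number"
  shows "(\<lambda>n. s n T) \<preceq>\<^sub>c r"
proof -
  obtain C p0 where C: "\<And>p. p0 \<le> p \<Longrightarrow> finite_rank_approx (c * 2 ^ p) (C * dyadic_rate a b g p) T"
    using approx by blast
  show ?thesis
  proof (rule dominated_of_dyadic_approximation[OF T C _ _ _ _ s])
    show "0 < dyadic_rate a b g p" for p by (rule dyadic_rate_pos)
    show "dyadic_rate a b g p \<le> 2 powr (a * real 1) * (1 + real 1) powr (\<bar>b\<bar> + \<bar>g\<bar>) * dyadic_rate a b g (Suc p)" for p
      using dyadic_rate_shift(2)[of a b g p 1] by simp
    show "4 powr - (\<bar>a\<bar> + \<bar>b\<bar> + \<bar>g\<bar>) * dyadic_rate a b g p \<le> r n" if n: "2 ^ p \<le> n" "n < 2 ^ Suc p" for n p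
    proof -
      have "0 < n" using n(1) one_le_power[of "2 :: nat" p] by linarith
      then show ?thesis unfolding r[OF \<open>0 < n\<close>] by (intro dyadic_rate_le_rate n)
    qed
  qed auto
qed

section \<open>Energies of kernels with logarithmic factors\<close>

context decreasing_kernel
begin

text \<open>Up to constants the energy of the dyadic interval with endpoint \<open>1 / 2 ^ q\<close>.\<close>

definition dyadic_energy :: "nat \<Rightarrow> real" where
  "dyadic_energy q = (1 / 2 ^ q) * (h (1 / 2 ^ q))\<^sup>2"

lemma energy_le_sum:
  assumes "\<And>n. (\<Sum>q\<in>{Suc p..<Suc p + n}. dyadic_energy q) \<le> X"
  shows "energy (1 / 2 ^ p) \<le> X"
proof -
  have le_sum: "energy (1 / 2 ^ p) \<le> (\<Sum>q\<in>{Suc p..<Suc p + n}. dyadic_energy q) + energy (1 / 2 ^ (p + n))" for n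
  proof (induction n)
    case (Suc n)
    have "energy (1 / 2 ^ (p + n)) - energy (1 / 2 ^ Suc (p + n)) \<le> (1 / 2 ^ (p + n) - 1 / 2 ^ Suc (p + n)) * (h (1 / 2 ^ Suc (p + n)))\<^sup>2"
      by (rule energy_diff_le) (auto simp: field_simps)
    also have "\<dots> = dyadic_energy (Suc (p + n))" by (simp add: dyadic_energy_def field_simps)
    finally show ?case using Suc by simp
  qed simp
  have le: "energy (1 / 2 ^ p) - X \<le> energy (1 / 2 ^ (p + n))" for n
    using assms[of n] le_sum[of n] by linarith
  have "(\<lambda>n. energy (1 / 2 ^ (p + n))) \<longlonglongrightarrow> 0"
    using LIMSEQ_ignore_initial_segment[OF energy_tendsto_0, of p] by (simp add: add.commute)
  then have "energy (1 / 2 ^ p) - X \<le> 0" by (rule LIMSEQ_le_const) (use le in blast)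
  then show ?thesis by simp
qed

lemma sum_le_energy: "(\<Sum>q\<in>{p..<p + n}. dyadic_energy q) \<le> 2 * energy 1"
proof -
  have "(\<Sum>q\<in>{p..<p + n}. dyadic_energy q) \<le> 2 * (energy (1 / 2 ^ p) - energy (1 / 2 ^ (p + n)))"
  proof (induction n)
    case (Suc n)
    have "(1 / 2 ^ (p + n) - 1 / 2 ^ Suc (p + n)) * (h (1 / 2 ^ (p + n)))\<^sup>2 \<le> energy (1 / 2 ^ (p + n)) - energy (1 / 2 ^ Suc (p + n))"
      by (rule energy_diff_ge) (auto simp: field_simps)
    also have "(1 / 2 ^ (p + n) - 1 / 2 ^ Suc (p + n)) * (h (1 / 2 ^ (p + n)))\<^sup>2 = dyadic_energy (p + n) / 2"
      by (simp add: dyadic_energy_def field_simps)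
    finally show ?case using Suc by simp
  qed simp
  also have "\<dots> \<le> 2 * energy 1"
    using energy_mono[of "1 / 2 ^ p" 1] energy_nonneg[of "1 / 2 ^ (p + n)"] by simp
  finally show ?thesis .
qed

lemma energy_pos:
  assumes "\<And>q. 0 < q \<Longrightarrow> 0 < h (1 / 2 ^ q)"
  shows "0 < energy (1 / 2 ^ p)"
proof -
  have "0 < (1 / 2 ^ Suc p) * (h (1 / 2 ^ Suc p))\<^sup>2" using assms[of "Suc p"] by simp
  also have "\<dots> \<le> energy (1 / 2 ^ Suc p)" by (rule energy_ge) simp
  also have "\<dots> \<le> energy (1 / 2 ^ p)" by (rule energy_mono) (simp add: field_simps)
  finally show ?thesis .
qed

lemma dyadic_energy_rate:
  assumes "h (1 / 2 ^ q) \<le> D * dyadic_rate (- \<tau>) \<beta> \<gamma> q"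
  shows "dyadic_energy q \<le> D\<^sup>2 * (dyadic_rate (1/2 - \<tau>) \<beta> \<gamma> q)\<^sup>2"
proof -
  have half: "(1 / 2 ^ q :: real) = (2 powr (- (1/2) * q))\<^sup>2"
    by (simp add: powr_realpow[symmetric] power2_eq_square powr_add[symmetric] powr_minus_divide)
  have "2 powr (- (1/2) * q) * h (1 / 2 ^ q) \<le> 2 powr (- (1/2) * q) * (D * dyadic_rate (- \<tau>) \<beta> \<gamma> q)"
    using assms by (intro mult_left_mono) auto
  also have "\<dots> = D * dyadic_rate (1/2 - \<tau>) \<beta> \<gamma> q"
    by (simp add: dyadic_rate_def powr_add[symmetric] algebra_simps)
  finally have "(2 powr (- (1/2) * q) * h (1 / 2 ^ q))\<^sup>2 \<le> (D * dyadic_rate (1/2 - \<tau>) \<beta> \<gamma> q)\<^sup>2"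
    using nonneg by (intro power_mono) auto
  then show ?thesis by (simp add: dyadic_energy_def half power_mult_distrib)
qed

lemma energy_polynomial:
  assumes upper: "\<And>q. q0 \<le> q \<Longrightarrow> h (1 / 2 ^ q) \<le> D * dyadic_rate (- \<tau>) \<beta> \<gamma> q" and \<tau>: "\<tau> < 1/2" and p: "q0 \<le> p"
  shows "energy (1 / 2 ^ p) \<le> D\<^sup>2 * geometric_const (1 - 2 * \<tau>) (2 * (\<bar>\<beta>\<bar> + \<bar>\<gamma>\<bar>)) * (dyadic_rate (1/2 - \<tau>) \<beta> \<gamma> p)\<^sup>2"
proof (rule energy_le_sum)
  fix n
  let ?B = "dyadic_rate (1/2 - \<tau>) \<beta> \<gamma>"
  define b where "b = \<bar>\<beta>\<bar> + \<bar>\<gamma>\<bar>"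
  have "(\<Sum>q\<in>{Suc p..<Suc p + n}. dyadic_energy q) = (\<Sum>d\<in>{Suc 0..<Suc n}. dyadic_energy (p + d))"
    by (rule sum.reindex_bij_witness[of _ "\<lambda>d. p + d" "\<lambda>q. q - p"]) auto
  also have "\<dots> \<le> (\<Sum>d\<in>{Suc 0..<Suc n}. ((1 + real d) powr (2 * b) * 2 powr (- (1 - 2 * \<tau>) * d)) * (D\<^sup>2 * (?B p)\<^sup>2))"
  proof (rule sum_mono)
    fix d
    have e1: "dyadic_energy (p + d) \<le> D\<^sup>2 * (?B (p + d))\<^sup>2" using p by (intro dyadic_energy_rate upper) auto
    have e2: "(?B (p + d))\<^sup>2 \<le> (2 powr (- (1/2 - \<tau>) * d) * (1 + real d) powr b * ?B p)\<^sup>2"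
      unfolding b_def using dyadic_rate_pos[of "1/2 - \<tau>" \<beta> \<gamma> "p + d"] by (intro power_mono dyadic_rate_shift(1)) auto
    have e3: "(2 powr (- (1/2 - \<tau>) * d) * (1 + real d) powr b * ?B p)\<^sup>2 =
        ((1 + real d) powr (2 * b) * 2 powr (- (1 - 2 * \<tau>) * d)) * (?B p)\<^sup>2"
      by (simp add: power_mult_distrib powr_power[symmetric] algebra_simps powr_numeral[symmetric] powr_powr del: powr_numeral)
    have "dyadic_energy (p + d) \<le> D\<^sup>2 * (((1 + real d) powr (2 * b) * 2 powr (- (1 - 2 * \<tau>) * d)) * (?B p)\<^sup>2)"
      using order_trans[OF e1 mult_left_mono[OF e2 zero_le_power2[of D]]] unfolding e3 .
    then show "dyadic_energy (p + d) \<le> ((1 + real d) powr (2 * b) * 2 powr (- (1 - 2 * \<tau>) * d)) * (D\<^sup>2 * (?B p)\<^sup>2)"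
      by (simp only: mult_ac)
  qed
  also have "\<dots> \<le> geometric_const (1 - 2 * \<tau>) (2 * b) * (D\<^sup>2 * (?B p)\<^sup>2)"
    unfolding sum_distrib_right[symmetric] using \<tau> by (intro mult_right_mono geometric_const_ge) auto
  finally show "(\<Sum>q\<in>{Suc p..<Suc p + n}. dyadic_energy q) \<le> D\<^sup>2 * geometric_const (1 - 2 * \<tau>) (2 * (\<bar>\<beta>\<bar> + \<bar>\<gamma>\<bar>)) * (?B p)\<^sup>2"
    by (simp add: b_def mult_ac)
qed

end

text \<open>Cauchy condensation: on the block \<open>{2 ^ i..<2 ^ Suc i}\<close> powers of \<open>q\<close> are exponential and powers of the
logarithm polynomial in \<open>i\<close>.\<close>

lemma dyadic_rate_dyadic_power:
  assumes "2 ^ i \<le> q" "q < 2 ^ Suc i"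
  shows "dyadic_rate 0 b g q \<le> 4 powr (\<bar>b\<bar> + \<bar>g\<bar>) * dyadic_power (- b) g i"
    and "dyadic_power (- b) g i \<le> 4 powr (\<bar>b\<bar> + \<bar>g\<bar>) * dyadic_rate 0 b g q"
proof -
  define x where "x = real q + 1"
  have "real (2 ^ i) \<le> real q" "real (Suc q) \<le> real (2 ^ Suc i)"
    using assms by (simp only: of_nat_le_iff, simp only: of_nat_le_iff Suc_le_eq)
  then have "2 ^ i \<le> real q" "real q + 1 \<le> 2 * 2 ^ i"
    by (simp_all only: of_nat_power of_nat_numeral of_nat_Suc power_Suc of_nat_mult)
  then have x: "2 ^ i \<le> x" "x \<le> 2 * 2 ^ i" "1 \<le> x" unfolding x_def by linarith+
  have "log 2 (2 ^ i) \<le> log 2 x" "log 2 x \<le> log 2 (2 ^ Suc i)" using x by (intro log_mono; simp)+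
  then have "real i \<le> log 2 x" "log 2 x \<le> real (Suc i)" by (simp_all del: power_Suc)
  then have l: "real i + 1 \<le> log_scale q" "log_scale q \<le> 2 * (real i + 1)"
    unfolding log_scale_def x_def[symmetric] by auto
  have e: "2 powr (- b * real i) = (2 ^ i) powr (- b)" by (simp add: powr_realpow[symmetric] powr_powr mult.commute)
  have "x powr (- b) * log_scale q powr (- g) \<le> (4 powr \<bar>- b\<bar> * (2 ^ i) powr (- b)) * (4 powr \<bar>- g\<bar> * (real i + 1) powr (- g))"
    using x l by (intro mult_mono powr_ratio_le) auto
  then show "dyadic_rate 0 b g q \<le> 4 powr (\<bar>b\<bar> + \<bar>g\<bar>) * dyadic_power (- b) g i"
    unfolding dyadic_rate_def dyadic_power_def e x_def by (simp add: powr_add mult_ac)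
  have "(2 ^ i) powr (- b) * (real i + 1) powr (- g) \<le> (4 powr \<bar>- b\<bar> * x powr (- b)) * (4 powr \<bar>- g\<bar> * log_scale q powr (- g))"
    using x l by (intro mult_mono powr_ratio_le) auto
  then show "dyadic_power (- b) g i \<le> 4 powr (\<bar>b\<bar> + \<bar>g\<bar>) * dyadic_rate 0 b g q"
    unfolding dyadic_rate_def dyadic_power_def e x_def by (simp add: powr_add mult_ac)
qed

lemma dyadic_power_block: "2 ^ i * (dyadic_power (- b) g i)\<^sup>2 = dyadic_power (1 - 2 * b) (2 * g) i"
proof -
  have "(2 powr (- b * i))\<^sup>2 = 2 powr (- 2 * b * i)" "((real i + 1) powr (- g))\<^sup>2 = (real i + 1) powr (- (2 * g))"
    by (simp_all add: power2_eq_square powr_add[symmetric] algebra_simps)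
  moreover have "(2 :: real) ^ i * 2 powr (- 2 * b * i) = 2 powr ((1 - 2 * b) * i)"
    by (simp add: powr_realpow[symmetric] powr_add[symmetric] algebra_simps)
  ultimately show ?thesis
    unfolding dyadic_power_def power_mult_distrib by (simp add: mult.assoc[symmetric])
qed

lemma sum_dyadic_blocks:
  fixes F :: "nat \<Rightarrow> real"
  shows "(\<Sum>q\<in>{2 ^ j..<2 ^ (j + n)}. F q) = (\<Sum>i\<in>{j..<j + n}. \<Sum>q\<in>{2 ^ i..<2 ^ Suc i}. F q)"
proof (induction n)
  case (Suc n)
  have "(\<Sum>q\<in>{2 ^ j..<2 ^ (j + Suc n)}. F q) = (\<Sum>q\<in>{2 ^ j..<2 ^ (j + n)}. F q) + (\<Sum>q\<in>{2 ^ (j + n)..<2 ^ Suc (j + n)}. F q)"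
    using sum.atLeastLessThan_concat[of "2 ^ j" "2 ^ (j + n)" "2 ^ Suc (j + n)" F] by (simp add: power_increasing)
  then show ?case using Suc by simp
qed simp

context decreasing_kernel
begin

text \<open>At \<open>\<tau> = 1/2\<close> the powers of two cancel in the dyadic energies, and their sums are condensed into blocks.\<close>

lemma energy_logarithmic:
  assumes upper: "\<And>q. q0 \<le> q \<Longrightarrow> h (1 / 2 ^ q) \<le> D * dyadic_rate (- (1/2)) \<beta> \<gamma> q" and j: "q0 \<le> j"
    and tail: "\<And>n. (\<Sum>i\<in>{j..<j + n}. dyadic_power (1 - 2 * \<beta>) (2 * \<gamma>) i) \<le> X"
  shows "energy (1 / 2 ^ 2 ^ j) \<le> D\<^sup>2 * (4 powr (\<bar>\<beta>\<bar> + \<bar>\<gamma>\<bar>))\<^sup>2 * X"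
proof (rule energy_le_sum)
  fix n
  define E where "E = 4 powr (\<bar>\<beta>\<bar> + \<bar>\<gamma>\<bar>)"
  have nonneg_e: "0 \<le> dyadic_energy q" for q by (simp add: dyadic_energy_def)
  have n: "2 ^ j + Suc n \<le> (2 :: nat) ^ (j + Suc n)"
  proof -
    have "1 * Suc n \<le> 2 ^ j * Suc n" by (intro mult_right_mono) auto
    then have "2 ^ j + Suc n \<le> 2 ^ j + 2 ^ j * Suc n" by (simp only: mult_1 add_le_cancel_left)
    also have "\<dots> = 2 ^ j * Suc (Suc n)" by simp
    also have "\<dots> \<le> (2 :: nat) ^ j * 2 ^ Suc n" using Suc_leI[OF less_exp[of "Suc n"]] by (intro mult_left_mono) auto
    finally show ?thesis by (simp add: power_add)
  qed
  have "(\<Sum>q\<in>{Suc (2 ^ j)..<Suc (2 ^ j) + n}. dyadic_energy q) \<le> (\<Sum>q\<in>{2 ^ j..<2 ^ (j + Suc n)}. dyadic_energy q)"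
    using n nonneg_e by (intro sum_mono2) auto
  also have "\<dots> = (\<Sum>i\<in>{j..<j + Suc n}. \<Sum>q\<in>{2 ^ i..<2 ^ Suc i}. dyadic_energy q)"
    by (rule sum_dyadic_blocks)
  also have "\<dots> \<le> (\<Sum>i\<in>{j..<j + Suc n}. \<Sum>q\<in>{2 ^ i..<2 ^ Suc i :: nat}. D\<^sup>2 * (E * dyadic_power (- \<beta>) \<gamma> i)\<^sup>2)"
  proof (intro sum_mono)
    fix i q assume iq: "i \<in> {j..<j + Suc n}" "q \<in> {2 ^ i..<2 ^ Suc i :: nat}"
    have "q0 \<le> q" using iq j less_exp[of i] unfolding atLeastLessThan_iff by linarith
    then have "dyadic_energy q \<le> D\<^sup>2 * (dyadic_rate 0 \<beta> \<gamma> q)\<^sup>2" using dyadic_energy_rate[OF upper, of q] by simp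
    also have "\<dots> \<le> D\<^sup>2 * (E * dyadic_power (- \<beta>) \<gamma> i)\<^sup>2"
      unfolding E_def using iq dyadic_rate_pos[of 0 \<beta> \<gamma> q]
      by (intro mult_left_mono power_mono dyadic_rate_dyadic_power(1)) auto
    finally show "dyadic_energy q \<le> D\<^sup>2 * (E * dyadic_power (- \<beta>) \<gamma> i)\<^sup>2" .
  qed
  also have "\<dots> = (\<Sum>i\<in>{j..<j + Suc n}. (D\<^sup>2 * E\<^sup>2) * dyadic_power (1 - 2 * \<beta>) (2 * \<gamma>) i)"
    unfolding dyadic_power_block[symmetric] by (simp add: power_mult_distrib mult_ac)
  also have "\<dots> \<le> (D\<^sup>2 * E\<^sup>2) * X"
    unfolding sum_distrib_left[symmetric] by (intro mult_left_mono tail) auto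
  finally show "(\<Sum>q\<in>{Suc (2 ^ j)..<Suc (2 ^ j) + n}. dyadic_energy q) \<le> D\<^sup>2 * (4 powr (\<bar>\<beta>\<bar> + \<bar>\<gamma>\<bar>))\<^sup>2 * X"
    by (simp add: E_def)
qed

text \<open>The converse comparison: square integrability bounds the condensed sums.\<close>

lemma block_energy_bounded:
  assumes lower: "\<And>q. q0 \<le> q \<Longrightarrow> dyadic_rate (- (1/2)) \<beta> \<gamma> q \<le> D * h (1 / 2 ^ q)"
  shows "(\<Sum>i\<in>{q0..<q0 + n}. dyadic_power (1 - 2 * \<beta>) (2 * \<gamma>) i) \<le> D\<^sup>2 * (4 powr (\<bar>\<beta>\<bar> + \<bar>\<gamma>\<bar>))\<^sup>2 * (2 * energy 1)"
proof -
  define E where "E = 4 powr (\<bar>\<beta>\<bar> + \<bar>\<gamma>\<bar>)"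
  have rate: "(dyadic_rate 0 \<beta> \<gamma> q)\<^sup>2 \<le> D\<^sup>2 * dyadic_energy q" if "q0 \<le> q" for q
  proof -
    have half: "(1 / 2 ^ q :: real) = (2 powr (- (1/2) * q))\<^sup>2"
      by (simp add: powr_realpow[symmetric] power2_eq_square powr_add[symmetric] powr_minus_divide)
    have "dyadic_rate 0 \<beta> \<gamma> q = 2 powr (- (1/2) * q) * dyadic_rate (- (1/2)) \<beta> \<gamma> q"
      by (simp add: dyadic_rate_def mult.assoc[symmetric] powr_add[symmetric])
    also have "\<dots> \<le> 2 powr (- (1/2) * q) * (D * h (1 / 2 ^ q))"
      using lower[OF that] by (intro mult_left_mono) auto
    finally have "(dyadic_rate 0 \<beta> \<gamma> q)\<^sup>2 \<le> (2 powr (- (1/2) * q) * (D * h (1 / 2 ^ q)))\<^sup>2"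
      using dyadic_rate_pos[of 0 \<beta> \<gamma> q] by (intro power_mono) auto
    then show ?thesis by (simp add: dyadic_energy_def half power_mult_distrib mult_ac)
  qed
  have "(\<Sum>i\<in>{q0..<q0 + n}. dyadic_power (1 - 2 * \<beta>) (2 * \<gamma>) i) = (\<Sum>i\<in>{q0..<q0 + n}. \<Sum>q\<in>{2 ^ i..<2 ^ Suc i :: nat}. (dyadic_power (- \<beta>) \<gamma> i)\<^sup>2)"
    unfolding dyadic_power_block[symmetric] by simp
  also have "\<dots> \<le> (\<Sum>i\<in>{q0..<q0 + n}. \<Sum>q\<in>{2 ^ i..<2 ^ Suc i :: nat}. E\<^sup>2 * D\<^sup>2 * dyadic_energy q)"
  proof (intro sum_mono)
    fix i q assume iq: "i \<in> {q0..<q0 + n}" "q \<in> {2 ^ i..<2 ^ Suc i :: nat}"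
    have q: "q0 \<le> q" using iq less_exp[of i] unfolding atLeastLessThan_iff by linarith
    have "(dyadic_power (- \<beta>) \<gamma> i)\<^sup>2 \<le> (E * dyadic_rate 0 \<beta> \<gamma> q)\<^sup>2"
      unfolding E_def using iq dyadic_power_pos[of "- \<beta>" \<gamma> i] by (intro power_mono dyadic_rate_dyadic_power(2)) auto
    also have "\<dots> \<le> E\<^sup>2 * (D\<^sup>2 * dyadic_energy q)"
      unfolding power_mult_distrib using rate[OF q] by (intro mult_left_mono) auto
    finally show "(dyadic_power (- \<beta>) \<gamma> i)\<^sup>2 \<le> E\<^sup>2 * D\<^sup>2 * dyadic_energy q" by simp
  qed
  also have "\<dots> = E\<^sup>2 * D\<^sup>2 * (\<Sum>q\<in>{2 ^ q0..<2 ^ (q0 + n)}. dyadic_energy q)"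
    unfolding sum_dyadic_blocks sum_distrib_left ..
  also have "\<dots> \<le> E\<^sup>2 * D\<^sup>2 * (2 * energy 1)"
    using sum_le_energy[of "2 ^ q0" "2 ^ (q0 + n) - 2 ^ q0"] by (intro mult_left_mono) (auto simp: power_increasing)
  finally show ?thesis by (simp add: E_def mult_ac)
qed

end

section \<open>The weakly singular and Volterra operators\<close>

text \<open>Both logarithmic factors of \<open>kfun\<close> at \<open>1 / 2 ^ q\<close> are asymptotically \<open>ln 2\<close> times \<open>real q + 1\<close> and
\<open>log_scale q\<close>; for large \<open>q\<close> they are positive, so that \<open>rpow\<close> is the usual power.\<close>

lemma kfun_dyadic_rate:
  assumes c: "0 < c\<^sub>0"
  shows "\<exists>q0. \<forall>q\<ge>q0. kfun \<tau> \<beta> \<gamma> c\<^sub>0 (1 / 2 ^ q) \<le> 4 powr (\<bar>\<beta>\<bar> + \<bar>\<gamma>\<bar>) * dyadic_rate (- \<tau>) \<beta> \<gamma> q \<and>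
    dyadic_rate (- \<tau>) \<beta> \<gamma> q \<le> 4 powr (\<bar>\<beta>\<bar> + \<bar>\<gamma>\<bar>) * kfun \<tau> \<beta> \<gamma> c\<^sub>0 (1 / 2 ^ q)"
proof -
  define u where "u q = c\<^sub>0 + real q * ln 2" for q
  define v where "v q = c\<^sub>0 + ln (u q)" for q
  have ln2: "1 / 4 < ln (2 :: real)" "ln (2 :: real) < 4"
    using ln_le_minus_one[of "1 / 2 :: real"] ln_2_less_1 by (auto simp: ln_div)
  have "((\<lambda>q. u q / (real q + 1)) \<longlongrightarrow> ln 2) sequentially"
    unfolding u_def by real_asymp
  then have ev_u: "\<forall>\<^sub>F q in sequentially. 1 / 4 < u q / (real q + 1)" "\<forall>\<^sub>F q in sequentially. u q / (real q + 1) < 4"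
    using order_tendstoD ln2 by blast+
  have "((\<lambda>q. v q / log_scale q) \<longlongrightarrow> ln 2) sequentially"
    unfolding v_def u_def log_scale_def by real_asymp
  then have ev_v: "\<forall>\<^sub>F q in sequentially. 1 / 4 < v q / log_scale q" "\<forall>\<^sub>F q in sequentially. v q / log_scale q < 4"
    using order_tendstoD ln2 by blast+
  obtain q0 where q0: "\<And>q. q0 \<le> q \<Longrightarrow> 1 / 4 < u q / (real q + 1) \<and> u q / (real q + 1) < 4 \<and>
      1 / 4 < v q / log_scale q \<and> v q / log_scale q < 4"
    using eventually_conj[OF ev_u(1) eventually_conj[OF ev_u(2) eventually_conj[OF ev_v]]]
    unfolding eventually_sequentially by blast
  have "kfun \<tau> \<beta> \<gamma> c\<^sub>0 (1 / 2 ^ q) \<le> 4 powr (\<bar>\<beta>\<bar> + \<bar>\<gamma>\<bar>) * dyadic_rate (- \<tau>) \<beta> \<gamma> q \<and>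
    dyadic_rate (- \<tau>) \<beta> \<gamma> q \<le> 4 powr (\<bar>\<beta>\<bar> + \<bar>\<gamma>\<bar>) * kfun \<tau> \<beta> \<gamma> c\<^sub>0 (1 / 2 ^ q)" if q: "q0 \<le> q" for q
  proof -
    define x where "x = real q + 1"
    define l where "l = log_scale q"
    have x: "0 < x" by (simp add: x_def)
    have l: "0 < l" using log_scale_ge_1[of q] by (simp add: l_def)
    have U: "0 < u q" "u q \<le> 4 * x" "x \<le> 4 * u q"
      using q0[OF q] x unfolding x_def[symmetric] by (auto simp: field_simps)
    have V: "0 < v q" "v q \<le> 4 * l" "l \<le> 4 * v q"
      using q0[OF q] l unfolding l_def[symmetric] by (auto simp: field_simps)
    have "c\<^sub>0 - ln (1 / 2 ^ q) = u q" by (simp add: u_def ln_div ln_realpow)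
    moreover have "rpow (1 / 2 ^ q) (- \<tau>) = 2 powr (\<tau> * q)"
    proof -
      have "(1 / 2 ^ q :: real) = 2 powr (- real q)" by (simp add: powr_minus_divide powr_realpow)
      then show ?thesis by (simp add: rpow_def powr_powr mult.commute)
    qed
    moreover have "rpow y a = y powr a" if "0 < y" for y a using that by (simp add: rpow_def)
    ultimately have k: "kfun \<tau> \<beta> \<gamma> c\<^sub>0 (1 / 2 ^ q) = 2 powr (\<tau> * q) * (u q powr (- \<beta>) * v q powr (- \<gamma>))"
      using U(1) V(1) by (simp add: kfun_def v_def)
    have r: "dyadic_rate (- \<tau>) \<beta> \<gamma> q = 2 powr (\<tau> * q) * (x powr (- \<beta>) * l powr (- \<gamma>))"
      by (simp add: dyadic_rate_def x_def l_def)
    have "u q powr (- \<beta>) * v q powr (- \<gamma>) \<le> (4 powr \<bar>- \<beta>\<bar> * x powr (- \<beta>)) * (4 powr \<bar>- \<gamma>\<bar> * l powr (- \<gamma>))"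
      using x l U V by (intro mult_mono powr_ratio_le) auto
    then have 1: "u q powr (- \<beta>) * v q powr (- \<gamma>) \<le> 4 powr (\<bar>\<beta>\<bar> + \<bar>\<gamma>\<bar>) * (x powr (- \<beta>) * l powr (- \<gamma>))"
      by (simp add: powr_add mult_ac)
    have "x powr (- \<beta>) * l powr (- \<gamma>) \<le> (4 powr \<bar>- \<beta>\<bar> * u q powr (- \<beta>)) * (4 powr \<bar>- \<gamma>\<bar> * v q powr (- \<gamma>))"
      using x l U V by (intro mult_mono powr_ratio_le) auto
    then have 2: "x powr (- \<beta>) * l powr (- \<gamma>) \<le> 4 powr (\<bar>\<beta>\<bar> + \<bar>\<gamma>\<bar>) * (u q powr (- \<beta>) * v q powr (- \<gamma>))"
      by (simp add: powr_add mult_ac)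
    show ?thesis
      using mult_left_mono[OF 1, of "2 powr (\<tau> * q)"] mult_left_mono[OF 2, of "2 powr (\<tau> * q)"]
      unfolding k r by (simp add: mult.left_commute)
  qed
  then show ?thesis by blast
qed

lemma decreasing_kernel_extension:
  assumes cont: "continuous_on {0<..1} k" and nonneg: "\<forall>x\<in>{0<..1}. 0 \<le> k x"
    and anti: "strict_antimono_on {0<..1} k" and sq: "square_integrable01 k"
  shows "decreasing_kernel (\<lambda>u. if u \<in> {0<..1} then k u else 0)"
proof
  let ?h = "\<lambda>u :: real. if u \<in> {0<..1} then k u else 0"
  show meas: "?h \<in> borel_measurable borel"
    using borel_measurable_continuous_on_if[of "{0<..1}" k "\<lambda>_. 0"] cont by simp
  show "0 \<le> ?h u" for u using nonneg by simp
  show "?h u = 0" if "u \<le> 0 \<or> 1 < u" for u using that by auto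
  show "?h v \<le> ?h u" if "0 < u" "u \<le> v" for u v
  proof (cases "u = v \<or> 1 < v")
    case True
    then show ?thesis using that nonneg by auto
  next
    case False
    then have "k v < k u" using that anti by (auto simp: monotone_on_def)
    then show ?thesis using False that by auto
  qed
  have "integrable lebesgue (\<lambda>u. indicator {0..1} u *\<^sub>R (k u)\<^sup>2)"
    using sq by (simp add: square_integrable01_def integrable_restrict_space)
  then have "integrable lebesgue (\<lambda>u. indicator {0<..1} u *\<^sub>R (indicator {0..1} u *\<^sub>R (k u)\<^sup>2))"
    by (rule integrable_mult_indicator[rotated]) auto
  also have "(\<lambda>u. indicator {0<..1} u *\<^sub>R (indicator {0..1} u *\<^sub>R (k u)\<^sup>2)) = (\<lambda>u. (?h u)\<^sup>2)"
    by (auto simp: indicator_def)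
  finally show "integrable lborel (\<lambda>u. (?h u)\<^sup>2)"
    using meas by (subst (asm) integrable_completion) auto
qed

context decreasing_kernel
begin

definition kernel_section :: "(real \<Rightarrow> l2) \<Rightarrow> bool" where
  "kernel_section \<kappa> \<longleftrightarrow> \<kappa> = translate 1 \<or> \<kappa> = (\<lambda>t. translate 1 t + translate (- 1) t)"

lemma kernel_section_modulus:
  assumes \<kappa>: "kernel_section \<kappa>" and st: "\<bar>s - t\<bar> \<le> \<delta>"
  shows "norm (\<kappa> s - \<kappa> t) \<le> 8 * sqrt (energy \<delta>)"
proof -
  have tr: "norm (translate c s - translate c t) \<le> 4 * sqrt (energy \<delta>)" if "c = 1 \<or> c = - 1" for c
  proof -
    have "(norm (translate c s - translate c t))\<^sup>2 \<le> 2 * energy \<delta>" by (rule translate_modulus[OF that st])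
    also have "\<dots> \<le> (4 * sqrt (energy \<delta>))\<^sup>2" using energy_nonneg[of \<delta>] by (simp add: power_mult_distrib)
    finally show ?thesis by (rule power2_le_imp_le) (simp add: energy_nonneg)
  qed
  from \<kappa> consider "\<kappa> = translate 1" | "\<kappa> = (\<lambda>t. translate 1 t + translate (- 1) t)"
    unfolding kernel_section_def by blast
  then show ?thesis
  proof cases
    case 1
    show ?thesis
      unfolding 1 using tr[OF disjI1[OF refl]] real_sqrt_ge_zero[OF energy_nonneg, of \<delta>] by linarith
  next
    case 2
    have "norm (\<kappa> s - \<kappa> t) \<le> norm (translate 1 s - translate 1 t) + norm (translate (- 1) s - translate (- 1) t)"
      unfolding 2 using norm_triangle_ineq[of "translate 1 s - translate 1 t" "translate (- 1) s - translate (- 1) t"]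
      by (simp add: algebra_simps)
    then show ?thesis using tr[of 1] tr[of "- 1"] by simp
  qed
qed

lemma kernel_section_Bessel:
  assumes \<kappa>: "kernel_section \<kappa>" and \<delta>: "0 < \<delta>"
  shows "(\<Sum>s\<in>{1..N}. (inner (\<kappa> (real s * \<delta>) - \<kappa> ((real s - 1) * \<delta>)) f)\<^sup>2) \<le> (8 * sqrt (energy \<delta>))\<^sup>2 * (norm f)\<^sup>2"
proof -
  define a where "a c s = inner (translate c (real s * \<delta>) - translate c ((real s - 1) * \<delta>)) f" for c s
  have tr: "(\<Sum>s\<in>{1..N}. (a c s)\<^sup>2) \<le> 14 * energy \<delta> * (norm f)\<^sup>2" if "c = 1 \<or> c = - 1" for c
    unfolding a_def by (rule translate_Bessel[OF that \<delta>])
  have e: "(8 * sqrt (energy \<delta>))\<^sup>2 = 64 * energy \<delta>" using energy_nonneg[of \<delta>] by (simp add: power_mult_distrib)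
  have pos: "0 \<le> energy \<delta> * (norm f)\<^sup>2" using energy_nonneg[of \<delta>] by simp
  from \<kappa> consider "\<kappa> = translate 1" | "\<kappa> = (\<lambda>t. translate 1 t + translate (- 1) t)"
    unfolding kernel_section_def by blast
  then show ?thesis
  proof cases
    case 1
    then show ?thesis using tr[of 1] pos unfolding e a_def by simp
  next
    case 2
    have "(\<Sum>s\<in>{1..N}. (inner (\<kappa> (real s * \<delta>) - \<kappa> ((real s - 1) * \<delta>)) f)\<^sup>2) = (\<Sum>s\<in>{1..N}. (a 1 s + a (- 1) s)\<^sup>2)"
      unfolding 2 a_def by (simp add: inner_diff_left inner_add_left algebra_simps)
    also have "\<dots> \<le> (\<Sum>s\<in>{1..N}. 2 * (a 1 s)\<^sup>2 + 2 * (a (- 1) s)\<^sup>2)"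
    proof (rule sum_mono)
      fix s
      show "(a 1 s + a (- 1) s)\<^sup>2 \<le> 2 * (a 1 s)\<^sup>2 + 2 * (a (- 1) s)\<^sup>2"
        using zero_le_power2[of "a 1 s - a (- 1) s"] by (simp add: power2_eq_square algebra_simps)
    qed
    also have "\<dots> = 2 * (\<Sum>s\<in>{1..N}. (a 1 s)\<^sup>2) + 2 * (\<Sum>s\<in>{1..N}. (a (- 1) s)\<^sup>2)"
      by (simp add: sum.distrib sum_distrib_left)
    finally show ?thesis using tr[of 1] tr[of "- 1"] pos unfolding e by simp
  qed
qed

text \<open>The sequence \<open>W\<close> replaces the square root of the energy by its upper bound, for which the geometric decay is
explicit; the first terms, where the bound is not available, are kept as they are.\<close>

lemma polynomial_singularity:
  fixes T :: "l2 \<Rightarrow> C01"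
  assumes \<kappa>: "kernel_section \<kappa>" and T: "\<And>f t. apply_bcontfun (T f) t = inner (\<kappa> (real_of_ui t)) f"
    and pos: "\<And>q. 0 < q \<Longrightarrow> 0 < h (1 / 2 ^ q)" and D: "0 < D"
    and upper: "\<And>q. q0 \<le> q \<Longrightarrow> h (1 / 2 ^ q) \<le> D * dyadic_rate (- \<tau>) \<beta> \<gamma> q" and \<tau>: "\<tau> < 1/2"
  shows "\<exists>C p0. \<forall>p\<ge>p0. finite_rank_approx (4 * 2 ^ p) (C * dyadic_rate (1 - \<tau>) \<beta> \<gamma> p) T"
proof -
  define B where "B = dyadic_rate (1/2 - \<tau>) \<beta> \<gamma>"
  define b where "b = \<bar>\<beta>\<bar> + \<bar>\<gamma>\<bar>"
  define G where "G = geometric_const (1 - 2 * \<tau>) (2 * b)"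
  have G: "1 \<le> G" unfolding G_def using \<tau> by (intro geometric_const_ge_1) simp
  define A where "A = 8 * (D * sqrt G)"
  have A: "0 < A" using D G by (simp add: A_def)
  define W where "W p = (if q0 \<le> p then A * B p else 8 * sqrt (energy (1 / 2 ^ p)))" for p
  have W_pos: "0 < W p" for p
    using A dyadic_rate_pos energy_pos[OF pos, of p] by (auto simp: W_def B_def)
  have W_ge: "8 * sqrt (energy (1 / 2 ^ p)) \<le> W p" for p
  proof (cases "q0 \<le> p")
    case True
    have "energy (1 / 2 ^ p) \<le> D\<^sup>2 * G * (B p)\<^sup>2"
      unfolding G_def b_def B_def by (rule energy_polynomial[OF upper \<tau> True])
    also have "\<dots> = (D * sqrt G * B p)\<^sup>2" using G by (simp add: power_mult_distrib)
    finally have "sqrt (energy (1 / 2 ^ p)) \<le> D * sqrt G * B p"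
      using D G dyadic_rate_pos[of "1/2 - \<tau>" \<beta> \<gamma> p] by (intro real_le_lsqrt) (auto simp: B_def energy_nonneg)
    then show ?thesis using True by (simp add: W_def A_def)
  qed (simp add: W_def)
  have "\<exists>C. \<forall>p\<ge>q0. finite_rank_approx (4 * 2 ^ p) (C * (W p / sqrt (2 ^ p))) T"
  proof (rule approximation_polynomial_modulus[OF T W_pos])
    show "norm (\<kappa> s - \<kappa> t) \<le> W p" if "\<bar>s - t\<bar> \<le> 1 / 2 ^ p" for s t p
      using kernel_section_modulus[OF \<kappa> that] W_ge[of p] by linarith
    show "(\<Sum>s\<in>{1..2 ^ p}. (inner (\<kappa> (real s / 2 ^ p) - \<kappa> ((real s - 1) / 2 ^ p)) f)\<^sup>2) \<le> (W p)\<^sup>2 * (norm f)\<^sup>2" for p f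
    proof -
      have "(\<Sum>s\<in>{1..2 ^ p}. (inner (\<kappa> (real s / 2 ^ p) - \<kappa> ((real s - 1) / 2 ^ p)) f)\<^sup>2) \<le> (8 * sqrt (energy (1 / 2 ^ p)))\<^sup>2 * (norm f)\<^sup>2"
        using kernel_section_Bessel[OF \<kappa>, where \<delta>="1 / 2 ^ p" and N="2 ^ p" and f=f] by simp
      also have "\<dots> \<le> (W p)\<^sup>2 * (norm f)\<^sup>2"
        using W_ge[of p] energy_nonneg by (intro mult_right_mono power_mono) auto
      finally show ?thesis .
    qed
    show "0 < 1/2 - \<tau>" using \<tau> by simp
    show "W (p + j) \<le> 2 powr (- (1/2 - \<tau>) * j) * (1 + real j) powr b * W p" if "q0 \<le> p" for p j
    proof -
      have "A * B (p + j) \<le> A * (2 powr (- (1/2 - \<tau>) * j) * (1 + real j) powr b * B p)"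
        unfolding B_def b_def using A by (intro mult_left_mono dyadic_rate_shift(1)) auto
      then show ?thesis using that by (simp add: W_def mult_ac)
    qed
  qed
  then obtain C where C: "\<And>p. q0 \<le> p \<Longrightarrow> finite_rank_approx (4 * 2 ^ p) (C * (W p / sqrt (2 ^ p))) T"
    by blast
  have "C * (W p / sqrt (2 ^ p)) = (C * A) * dyadic_rate (1 - \<tau>) \<beta> \<gamma> p" if "q0 \<le> p" for p
  proof -
    have "1 / sqrt (2 ^ p) = (2 powr (- (1/2) * p) :: real)"
      by (simp add: powr_half_sqrt[symmetric] powr_realpow[symmetric] powr_powr powr_minus_divide)
    moreover have "2 powr (- (1/2 - \<tau>) * p) * 2 powr (- (1/2) * p) = (2 powr (- (1 - \<tau>) * p) :: real)"
      by (simp add: powr_add[symmetric] algebra_simps)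
    ultimately have "B p * (1 / sqrt (2 ^ p)) = dyadic_rate (1 - \<tau>) \<beta> \<gamma> p"
      unfolding B_def dyadic_rate_def by (simp add: mult_ac)
    moreover have "C * (W p / sqrt (2 ^ p)) = (C * A) * (B p * (1 / sqrt (2 ^ p)))" using that by (simp add: W_def)
    ultimately show ?thesis by (simp only:)
  qed
  then have "\<forall>p\<ge>q0. finite_rank_approx (4 * 2 ^ p) ((C * A) * dyadic_rate (1 - \<tau>) \<beta> \<gamma> p) T"
    using C by simp
  then show ?thesis by blast
qed

text \<open>The numbers \<open>t j\<close> stand for the square roots of the energies up to \<open>1 / 2 ^ 2 ^ j\<close>.\<close>

lemma logarithmic_singularity:
  fixes T :: "l2 \<Rightarrow> C01" and t :: "nat \<Rightarrow> real"
  assumes \<kappa>: "kernel_section \<kappa>" and T: "\<And>f t. apply_bcontfun (T f) t = inner (\<kappa> (real_of_ui t)) f"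
    and pos: "\<And>q. 0 < q \<Longrightarrow> 0 < h (1 / 2 ^ q)" and D: "0 < D"
    and upper: "\<And>q. q0 \<le> q \<Longrightarrow> h (1 / 2 ^ q) \<le> D * dyadic_rate (- (1/2)) \<beta> \<gamma> q"
    and t: "\<And>j. 0 < t j" and G: "0 < G"
    and tail: "\<And>j n. (\<Sum>i\<in>{j..<j + n}. dyadic_power (1 - 2 * \<beta>) (2 * \<gamma>) i) \<le> G * (t j)\<^sup>2"
    and total: "\<And>q. 0 < q \<Longrightarrow> (\<Sum>j\<in>{floor_log q..q}. t j * sqrt (2 ^ j)) \<le> C * dyadic_rate (a - 1/2) b g q"
  shows "\<exists>C p0. \<forall>p\<ge>p0. finite_rank_approx (3 * 2 ^ p) (C * dyadic_rate a b g p) T"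
proof -
  define E where "E = 4 powr (\<bar>\<beta>\<bar> + \<bar>\<gamma>\<bar>)"
  have E: "0 < E" by (simp add: E_def)
  define A where "A = 8 * (D * E * sqrt G)"
  have A: "0 < A" using D E G by (simp add: A_def)
  define \<omega> where "\<omega> j = (if q0 \<le> j then A * t j else 8 * sqrt (energy (1 / 2 ^ 2 ^ j)))" for j
  have \<omega>_pos: "0 < \<omega> j" for j
    using A t energy_pos[OF pos, of "2 ^ j"] by (auto simp: \<omega>_def)
  have \<omega>_ge: "8 * sqrt (energy (1 / 2 ^ 2 ^ j)) \<le> \<omega> j" for j
  proof (cases "q0 \<le> j")
    case True
    have "energy (1 / 2 ^ 2 ^ j) \<le> D\<^sup>2 * E\<^sup>2 * (G * (t j)\<^sup>2)"
      unfolding E_def by (rule energy_logarithmic[OF upper True tail])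
    also have "\<dots> = (D * E * sqrt G * t j)\<^sup>2" using G by (simp add: power_mult_distrib)
    finally have "sqrt (energy (1 / 2 ^ 2 ^ j)) \<le> D * E * sqrt G * t j"
      using D E G t[of j] by (intro real_le_lsqrt) (auto simp: energy_nonneg)
    then show ?thesis using True by (simp add: \<omega>_def A_def)
  qed (simp add: \<omega>_def)
  have "finite_rank_approx (3 * 2 ^ q) ((24 * (A * C)) * dyadic_rate a b g q) T" if q: "2 ^ q0 \<le> q" for q
  proof -
    have q_pos: "0 < q" using q one_le_power[of "2 :: nat" q0] by linarith
    have "q0 \<le> floor_log q"
      using floor_log_mono[THEN monoD, OF q] by simp
    then have "(\<Sum>j\<in>{floor_log q..q}. \<omega> j * sqrt (2 ^ j)) = A * (\<Sum>j\<in>{floor_log q..q}. t j * sqrt (2 ^ j))"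
      unfolding sum_distrib_left by (intro sum.cong) (auto simp: \<omega>_def)
    also have "\<dots> \<le> A * (C * dyadic_rate (a - 1/2) b g q)"
      using A by (intro mult_left_mono total q_pos) auto
    finally have le: "24 / sqrt (2 ^ q) * (\<Sum>j\<in>{floor_log q..q}. \<omega> j * sqrt (2 ^ j))
        \<le> 24 / sqrt (2 ^ q) * (A * (C * dyadic_rate (a - 1/2) b g q))"
      by (intro mult_left_mono) auto
    have "1 / sqrt (2 ^ q) = (2 powr (- (1/2) * q) :: real)"
      by (simp add: powr_half_sqrt[symmetric] powr_realpow[symmetric] powr_powr powr_minus_divide)
    moreover have "2 powr (- (a - 1/2) * q) * 2 powr (- (1/2) * q) = (2 powr (- a * q) :: real)"
      by (simp add: powr_add[symmetric] algebra_simps)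
    ultimately have "dyadic_rate (a - 1/2) b g q * (1 / sqrt (2 ^ q)) = dyadic_rate a b g q"
      unfolding dyadic_rate_def by (simp add: mult_ac)
    then have eq: "24 / sqrt (2 ^ q) * (A * (C * dyadic_rate (a - 1/2) b g q)) = (24 * (A * C)) * dyadic_rate a b g q"
      by (simp add: field_simps)
    have "finite_rank_approx (3 * 2 ^ q) (24 / sqrt (2 ^ q) * (\<Sum>j\<in>{floor_log q..q}. \<omega> j * sqrt (2 ^ j))) T"
    proof (rule approximation_logarithmic_modulus[OF T \<omega>_pos _ q_pos])
      show "norm (\<kappa> s - \<kappa> t) \<le> \<omega> j" if "\<bar>s - t\<bar> \<le> 1 / 2 ^ 2 ^ j" for s t j
        using kernel_section_modulus[OF \<kappa> that] \<omega>_ge[of j] by linarith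
    qed
    then show ?thesis using le unfolding eq by (rule finite_rank_approx_mono[OF _ order_refl])
  qed
  then show ?thesis by blast
qed

end

lemma sqrt_power_2: "sqrt (2 ^ j) = 2 powr (1/2 * real j)"
  by (simp add: powr_half_sqrt[symmetric] powr_realpow[symmetric] powr_powr)

lemma dyadic_power_sqrt: "dyadic_power a g j * sqrt (2 ^ j) = dyadic_power (a + 1/2) g j"
  unfolding dyadic_power_def sqrt_power_2 by (simp add: powr_add[symmetric] algebra_simps)

lemma dyadic_power_squared: "(dyadic_power a g j)\<^sup>2 = dyadic_power (2 * a) (2 * g) j"
  unfolding dyadic_power_def power_mult_distrib by (simp add: power2_eq_square powr_add[symmetric] algebra_simps)

lemma floor_log_dyadic:
  assumes "0 < q"
  shows "2 ^ floor_log q \<le> q" "q < 2 ^ Suc (floor_log q)"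
  using floor_log_exp2_le[OF assms] floor_log_exp2_gt[of q] by auto

lemma sum_from_floor_log_le:
  assumes "\<And>j. 0 \<le> F j" and "\<And>q. (\<Sum>j\<le>q. F j) \<le> X q"
  shows "(\<Sum>j\<in>{floor_log q..q}. F j :: real) \<le> X q"
proof -
  have "(\<Sum>j\<in>{floor_log q..q}. F j) \<le> (\<Sum>j\<le>q. F j)" using assms(1) by (intro sum_mono2) auto
  also have "\<dots> \<le> X q" by (rule assms(2))
  finally show ?thesis .
qed

lemma sum_from_floor_log_tail_le:
  assumes q: "0 < q" and tail: "\<And>i n. (\<Sum>j\<in>{i..<i + n}. F j) \<le> X * dyadic_power (- b) g i" and X: "0 \<le> X"
  shows "(\<Sum>j\<in>{floor_log q..q}. F j :: real) \<le> X * 4 powr (\<bar>b\<bar> + \<bar>g\<bar>) * dyadic_rate 0 b g q"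
proof -
  have "floor_log q \<le> q" using floor_log_dyadic(1)[OF q] less_exp[of "floor_log q"] by linarith
  then have "{floor_log q..q} = {floor_log q..<floor_log q + (Suc q - floor_log q)}" by auto
  then have "(\<Sum>j\<in>{floor_log q..q}. F j) \<le> X * dyadic_power (- b) g (floor_log q)"
    using tail[of "floor_log q" "Suc q - floor_log q"] by simp
  also have "\<dots> \<le> X * (4 powr (\<bar>b\<bar> + \<bar>g\<bar>) * dyadic_rate 0 b g q)"
    by (intro mult_left_mono X dyadic_rate_dyadic_power(2) floor_log_dyadic q)
  finally show ?thesis by simp
qed

text \<open>The exponents of \<open>n\<close>, \<open>log n\<close> and \<open>log log n\<close>, with opposite sign, in the cases with \<open>\<tau> = 1/2\<close>.\<close>

definition critical_exponents :: "real \<Rightarrow> real \<Rightarrow> real \<times> real \<times> real" where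
  "critical_exponents \<beta> \<gamma> =
    (if 1/2 < \<beta> \<and> \<beta> < 1 then (\<beta> - 1/2, \<gamma>, 0)
     else if 1 < \<beta> then (1/2, \<beta> - 1, \<gamma>)
     else if \<beta> = 1 \<and> \<gamma> < 1 then (1/2, \<gamma> - 1, 0)
     else if \<beta> = 1 \<and> \<gamma> = 1 then (1/2, 0, - 1)
     else if \<beta> = 1 then (1/2, 0, \<gamma> - 1)
     else (0, \<gamma> - 1/2, 0))"

lemma dyadic_rate_power: "dyadic_rate (- a) b 0 q = dyadic_power a b q"
  using log_scale_ge_1[of q] by (simp add: dyadic_rate_def dyadic_power_def)

text \<open>The terms of the chaining sum are \<open>2 powr ((1 - \<beta>) * j) * (j + 1) powr (- \<gamma>)\<close>, respectively
\<open>2 powr (j / 2) * (j + 1) powr (1/2 - \<gamma>)\<close> for \<open>\<beta> = 1/2\<close>, where \<open>j\<close> runs from about \<open>log q\<close> to \<open>q\<close>. Growing terms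
sum to the last one and decreasing terms to the first one, which by condensation is a power of \<open>q\<close>. At \<open>\<beta> = 1\<close>
only the power of \<open>j\<close> is left, and the sum is dominated by its upper end, a logarithm, or its lower
end according to \<open>\<gamma>\<close>.\<close>

lemma critical_sums:
  assumes \<beta>\<gamma>: "1/2 < \<beta> \<or> (\<beta> = 1/2 \<and> 1/2 < \<gamma>)" and abg: "critical_exponents \<beta> \<gamma> = (a, b, g)"
  shows "\<exists>t G C. (\<forall>j. 0 < t j) \<and> 0 < G \<and>
    (\<forall>j n. (\<Sum>i\<in>{j..<j + n}. dyadic_power (1 - 2 * \<beta>) (2 * \<gamma>) i) \<le> G * (t j)\<^sup>2) \<and>
    (\<forall>q>0. (\<Sum>j\<in>{floor_log q..q}. t j * sqrt (2 ^ j)) \<le> C * dyadic_rate (a - 1/2) b g q)"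
proof (cases "\<beta> = 1/2")
  case True
  then have \<gamma>: "1/2 < \<gamma>" and abg: "a = 0" "b = \<gamma> - 1/2" "g = 0"
    using assms by (auto simp: critical_exponents_def)
  define t where "t = dyadic_power 0 (\<gamma> - 1/2)"
  define G where "G = 2 powr (2 * \<gamma>) / (2 * \<gamma> - 1)"
  have "(\<Sum>i\<in>{j..<j + n}. dyadic_power (1 - 2 * \<beta>) (2 * \<gamma>) i) \<le> G * (t j)\<^sup>2" for j n
    using sum_powr_tail[of "2 * \<gamma>" j n] \<gamma> by (simp add: True G_def t_def dyadic_power_squared algebra_simps)
  moreover have "(\<Sum>j\<in>{floor_log q..q}. t j * sqrt (2 ^ j)) \<le> geometric_const (1/2) \<bar>b\<bar> * dyadic_rate (a - 1/2) b g q" for q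
  proof -
    have "(\<Sum>j\<in>{floor_log q..q}. dyadic_power (1/2) b j) \<le> geometric_const (1/2) \<bar>b\<bar> * dyadic_power (1/2) b q"
      by (rule sum_from_floor_log_le[where X="\<lambda>q. geometric_const (1/2) \<bar>b\<bar> * dyadic_power (1/2) b q"])
        (use less_imp_le[OF dyadic_power_pos] sum_dyadic_power_increasing[of "1/2" b] in auto)
    then show ?thesis
      using dyadic_rate_power[of "1/2" b q] by (simp add: t_def dyadic_power_sqrt abg)
  qed
  moreover have "0 < G" using \<gamma> by (simp add: G_def)
  ultimately show ?thesis using dyadic_power_pos[of 0 "\<gamma> - 1/2"] unfolding t_def by blast
next
  case False
  then have \<beta>: "1/2 < \<beta>" using \<beta>\<gamma> by auto
  define t where "t = dyadic_power (1/2 - \<beta>) \<gamma>"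
  define G where "G = geometric_const (2 * \<beta> - 1) \<bar>2 * \<gamma>\<bar>"
  have G: "0 < G" using geometric_const_ge_1[of "2 * \<beta> - 1" "\<bar>2 * \<gamma>\<bar>"] \<beta> by (simp add: G_def)
  have tail: "(\<Sum>i\<in>{j..<j + n}. dyadic_power (1 - 2 * \<beta>) (2 * \<gamma>) i) \<le> G * (t j)\<^sup>2" for j n
    using sum_dyadic_power_decreasing[of "2 * \<beta> - 1" "2 * \<gamma>" j n] \<beta>
    by (simp add: G_def t_def dyadic_power_squared algebra_simps)
  have t: "t j * sqrt (2 ^ j) = dyadic_power (1 - \<beta>) \<gamma> j" for j
    by (simp add: t_def dyadic_power_sqrt)
  have nn: "0 \<le> dyadic_power x y j" for x y j using dyadic_power_pos[of x y j] by simp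
  have "\<exists>C. \<forall>q>0. (\<Sum>j\<in>{floor_log q..q}. dyadic_power (1 - \<beta>) \<gamma> j) \<le> C * dyadic_rate (a - 1/2) b g q"
  proof -
    consider "\<beta> < 1" | "1 < \<beta>" | "\<beta> = 1" "\<gamma> < 1" | "\<beta> = 1" "\<gamma> = 1" | "\<beta> = 1" "1 < \<gamma>" by linarith
    then show ?thesis
    proof cases
      case 1
      then have abg: "a - 1/2 = - (1 - \<beta>)" "b = \<gamma>" "g = 0" using abg \<beta> by (auto simp: critical_exponents_def)
      have "(\<Sum>j\<in>{floor_log q..q}. dyadic_power (1 - \<beta>) \<gamma> j) \<le> geometric_const (1 - \<beta>) \<bar>\<gamma>\<bar> * dyadic_power (1 - \<beta>) \<gamma> q" for q
        by (rule sum_from_floor_log_le[where X="\<lambda>q. geometric_const (1 - \<beta>) \<bar>\<gamma>\<bar> * dyadic_power (1 - \<beta>) \<gamma> q"])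
          (use nn sum_dyadic_power_increasing[of "1 - \<beta>" \<gamma>] 1 in auto)
      then show ?thesis unfolding abg dyadic_rate_power by blast
    next
      case 2
      then have abg: "a - 1/2 = 0" "b = \<beta> - 1" "g = \<gamma>" using abg by (auto simp: critical_exponents_def)
      have e: "1 - \<beta> = - b" by (simp add: abg)
      have "(\<Sum>j\<in>{floor_log q..q}. dyadic_power (1 - \<beta>) \<gamma> j)
          \<le> geometric_const b \<bar>g\<bar> * 4 powr (\<bar>b\<bar> + \<bar>g\<bar>) * dyadic_rate 0 b g q" if "0 < q" for q
        unfolding e abg(3)[symmetric] using sum_dyadic_power_decreasing[of b g] geometric_const_ge_1[of b "\<bar>g\<bar>"] 2 abg
        by (intro sum_from_floor_log_tail_le that) auto
      then show ?thesis unfolding abg(1) by blast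
    next
      case 3
      then have abg: "a - 1/2 = - 0" "b = \<gamma> - 1" "g = 0" using abg by (auto simp: critical_exponents_def)
      define X where "X = 2 powr \<bar>\<gamma>\<bar> / (1 - \<gamma>) * 2 powr (1 - \<gamma>)"
      have "(\<Sum>j\<in>{floor_log q..q}. dyadic_power 0 \<gamma> j) \<le> X * dyadic_power 0 (\<gamma> - 1) q" for q
        by (rule sum_from_floor_log_le[where X="\<lambda>q. X * dyadic_power 0 (\<gamma> - 1) q"])
          (use nn sum_powr_growing[of \<gamma>] 3 in \<open>auto simp: X_def\<close>)
      then show ?thesis unfolding abg dyadic_rate_power using 3 by auto
    next
      case 4
      then have abg: "a - 1/2 = 0" "b = 0" "g = - 1" using abg by (auto simp: critical_exponents_def)
      have "(\<Sum>j\<in>{floor_log q..q}. dyadic_power 0 1 j) \<le> 1 + ln (real q + 1)" for q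
        by (rule sum_from_floor_log_le[where X="\<lambda>q. 1 + ln (real q + 1)"]) (use nn sum_harmonic_le in auto)
      moreover have "1 + ln (real q + 1) \<le> 1 * dyadic_rate 0 0 (- 1) q" for q
      proof -
        have "ln (real q + 1) * ln 2 \<le> ln (real q + 1) * 1" using ln_2_less_1 by (intro mult_left_mono) auto
        then have "ln (real q + 1) \<le> log 2 (real q + 1)" by (simp add: log_def le_divide_eq)
        then show ?thesis using log_scale_ge_1[of q] by (simp add: dyadic_rate_def log_scale_def)
      qed
      ultimately show ?thesis unfolding abg using 4 by (intro exI[of _ 1]) (auto intro: order_trans)
    next
      case 5
      then have abg: "a - 1/2 = 0" "b = 0" "g = \<gamma> - 1" using abg by (auto simp: critical_exponents_def)
      define X where "X = 2 powr \<gamma> / (\<gamma> - 1)"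
      have "(\<Sum>j\<in>{floor_log q..q}. dyadic_power 0 \<gamma> j) \<le> X * 4 powr (\<bar>0\<bar> + \<bar>g\<bar>) * dyadic_rate 0 0 g q" if "0 < q" for q
        using sum_powr_tail[of \<gamma>] 5
        by (intro sum_from_floor_log_tail_le that) (auto simp: X_def abg)
      then show ?thesis unfolding abg(1,2) using 5 by auto
    qed
  qed
  then show ?thesis using tail G dyadic_power_pos[of "1/2 - \<beta>" \<gamma>] unfolding t[symmetric] t_def by blast
qed

text \<open>Otherwise the condensed sums, which are bounded, would eventually dominate the harmonic series.\<close>

lemma (in decreasing_kernel) critical_parameters:
  assumes lower: "\<And>q. q0 \<le> q \<Longrightarrow> dyadic_rate (- (1/2)) \<beta> \<gamma> q \<le> D * h (1 / 2 ^ q)"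
  shows "1/2 < \<beta> \<or> (\<beta> = 1/2 \<and> 1/2 < \<gamma>)"
proof (rule ccontr)
  assume neg: "\<not> ?thesis"
  define F where "F = dyadic_power (1 - 2 * \<beta>) (2 * \<gamma>)"
  define X where "X = D\<^sup>2 * (4 powr (\<bar>\<beta>\<bar> + \<bar>\<gamma>\<bar>))\<^sup>2 * (2 * energy 1)"
  have F_pos: "0 < F i" for i by (simp add: F_def dyadic_power_pos)
  have bound: "(\<Sum>i\<in>{q0..<q0 + n}. F i) \<le> X" for n
    unfolding F_def X_def by (rule block_energy_bounded[OF lower])
  have "summable (\<lambda>i. F (i + q0))"
  proof (rule summableI_nonneg_bounded)
    show "(\<Sum>i<n. F (i + q0)) \<le> X" for n
    proof -
      have "(\<Sum>i<n. F (i + q0)) = (\<Sum>i\<in>{q0..<q0 + n}. F i)"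
        by (rule sum.reindex_bij_witness[of _ "\<lambda>i. i - q0" "\<lambda>i. i + q0"]) auto
      then show ?thesis using bound by simp
    qed
  qed (simp add: less_imp_le F_pos)
  then have "summable F" by (simp add: summable_iff_shift)
  have big: "\<forall>\<^sub>F i in sequentially. 1 / real (Suc i) \<le> F i"
  proof (cases "\<beta> = 1/2")
    case True
    then have \<gamma>: "2 * \<gamma> \<le> 1" using neg by auto
    have "1 / real (Suc i) \<le> F i" for i
    proof -
      have "(real i + 1) powr (- 1) \<le> (real i + 1) powr (- (2 * \<gamma>))" using \<gamma> by (intro powr_mono) auto
      moreover have "F i = (real i + 1) powr (- (2 * \<gamma>))" by (simp add: F_def dyadic_power_def True)
      moreover have "1 / real (Suc i) = (real i + 1) powr (- 1)" by (simp add: powr_minus_divide)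
      ultimately show ?thesis by (simp only:)
    qed
    then show ?thesis by simp
  next
    case False
    then have a: "0 < 1 - 2 * \<beta>" using neg by auto
    define a where "a = 1 - 2 * \<beta>"
    have "0 < a" using a by (simp add: a_def)
    then have "\<forall>\<^sub>F i in sequentially. 1 / (real i + 1) \<le> 2 powr (a * real i) * (real i + 1) powr (- (2 * \<gamma>))"
      by real_asymp
    then show ?thesis
    proof (rule eventually_mono)
      fix i assume "1 / (real i + 1) \<le> 2 powr (a * real i) * (real i + 1) powr (- (2 * \<gamma>))"
      moreover have "F i = 2 powr (a * real i) * (real i + 1) powr (- (2 * \<gamma>))"
        by (simp add: F_def dyadic_power_def a_def)
      moreover have "real (Suc i) = real i + 1" by simp
      ultimately show "1 / real (Suc i) \<le> F i" by (simp only:)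
    qed
  qed
  have "summable (\<lambda>i. 1 / real (Suc i))"
  proof (rule summable_comparison_test_ev[OF _ \<open>summable F\<close>])
    show "\<forall>\<^sub>F i in sequentially. norm (1 / real (Suc i)) \<le> F i"
      using big by (rule eventually_mono) simp
  qed
  then have "summable (\<lambda>i. 1 / real i)" using summable_Suc_iff[of "\<lambda>i. 1 / real i"] by blast
  then show False using not_summable_harmonic[where ?'a = real] by (simp add: inverse_eq_divide)
qed

theorem theorem5p14:
  fixes \<tau> \<beta> \<gamma> c\<^sub>0 :: real
    and k :: "real \<Rightarrow> real"
    and K :: "real \<Rightarrow> real \<Rightarrow> real"
    and s :: "nat \<Rightarrow> (l2 \<Rightarrow> C01) \<Rightarrow> real"
  assumes "0 < \<tau>" and "\<tau> \<le> 1/2" and "0 < c\<^sub>0"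
    and "k = kfun \<tau> \<beta> \<gamma> c\<^sub>0"
    and "kfun_well_defined \<tau> \<beta> \<gamma> c\<^sub>0"
    and "\<forall>x\<in>{0<..1}. 0 \<le> k x"
    and "continuous_on {0<..1} k"
    and "strict_antimono_on {0<..1} k"
    and "filterlim k at_top (at_right 0)"
    and "square_integrable01 k"
    and "K = kernel_WS k \<or> K = kernel_VO k"
    and "s = kolmogorov_number \<or> s = dyadic_entropy_number"
  shows "(\<lambda>n. s n (integral_op K)) \<preceq>\<^sub>c rate \<tau> \<beta> \<gamma>"
proof -
  define h where "h u = (if u \<in> {0<..1} then k u else 0)" for u
  interpret decreasing_kernel h
    unfolding h_def[abs_def] by (rule decreasing_kernel_extension) fact+
  define T where "T = integral_op K"
  have T_linear: "bounded_linear T"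
    unfolding T_def by (rule kernels_integral_op(1)[OF assms(7,6,10,11)])
  have T_int: "apply_bcontfun (T (abs_l2 f)) t = (LINT x|leb01. K (real_of_ui t) x * f x)" if "square_integrable01 f" for f t
    unfolding T_def by (rule kernels_integral_op(2)[OF assms(7,6,10,11) that])
  define \<kappa> where "\<kappa> = (if K = kernel_VO k then translate 1 else (\<lambda>t. translate 1 t + translate (- 1) t))"
  have \<kappa>: "kernel_section \<kappa>" by (simp add: \<kappa>_def kernel_section_def)
  have T: "apply_bcontfun (T f) t = inner (\<kappa> (real_of_ui t)) f" for f t
  proof -
    define \<phi> where "\<phi> = rep_l2 f"
    define y where "y = real_of_ui t"
    have y: "0 \<le> y" "y \<le> 1" using real_of_ui[of t] by (auto simp: y_def)
    have \<phi>: "square_integrable01 \<phi>" "abs_l2 \<phi> = f" by (simp_all add: \<phi>_def square_integrable01_rep_l2)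
    define H where "H x = (if K = kernel_VO k then h (1 * (y - x)) else h (1 * (y - x)) + h (- 1 * (y - x)))" for x
    have sq: "square_integrable01 (\<lambda>x. h (1 * (y - x)))" "square_integrable01 (\<lambda>x. h (- 1 * (y - x)))"
      by (rule square_integrable_translate; simp)+
    have H: "square_integrable01 H" "\<kappa> y = abs_l2 H"
    proof -
      have "square_integrable01 H \<and> \<kappa> y = abs_l2 H"
      proof (cases "K = kernel_VO k")
        case True
        then have "H = (\<lambda>x. h (1 * (y - x)))" by (intro ext) (simp add: H_def)
        then show ?thesis using sq(1) True by (simp add: \<kappa>_def translate_def)
      next
        case False
        then have "H = (\<lambda>x. h (1 * (y - x)) + h (- 1 * (y - x)))" by (intro ext) (simp add: H_def)
        then show ?thesis
          using square_integrable01_add[OF sq] abs_l2_add[OF sq] False by (simp add: \<kappa>_def translate_def)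
      qed
      then show "square_integrable01 H" "\<kappa> y = abs_l2 H" by simp_all
    qed
    have "apply_bcontfun (T f) t = (LINT x|leb01. K y x * \<phi> x)"
      using T_int[OF \<phi>(1), of t] by (simp add: \<phi>(2) y_def)
    also have "\<dots> = (LINT x|leb01. H x * \<phi> x)"
    \<comment> \<open>The diagonal, where \<open>K\<close> and \<open>H\<close> may differ, is a null set.\<close>
    proof (rule integral_discrete_difference[where X="{y}"])
      show "K y x * \<phi> x = H x * \<phi> x" if "x \<in> space leb01" "x \<notin> {y}" for x
        using that y assms(11) by (auto simp: H_def h_def kernel_VO_def kernel_WS_def fun_eq_iff abs_if split: if_splits)
      show "emeasure leb01 {x} = 0" if "x \<in> {y}" for x
        using that y by (simp add: emeasure_restrict_space)
      show "{x} \<in> sets leb01" if "x \<in> {y}" for x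
        using that y by (auto simp: sets_restrict_space image_iff intro!: bexI[of _ "{y}"])
    qed simp
    also have "\<dots> = inner (\<kappa> y) f" using inner_abs_l2[OF H(1) \<phi>(1)] by (simp add: H(2) \<phi>(2))
    finally show ?thesis by (simp add: y_def)
  qed
  have pos: "0 < h (1 / 2 ^ q)" if "0 < q" for q
  proof -
    have "(1 / 2 ^ q :: real) < 1" using that by simp
    then have "k 1 < k (1 / 2 ^ q)" using assms(8) by (auto simp: monotone_on_def)
    moreover have "0 \<le> k 1" using assms(6) by simp
    moreover have "h (1 / 2 ^ q) = k (1 / 2 ^ q)" by (simp add: h_def)
    ultimately show ?thesis by linarith
  qed
  define D where "D = 4 powr (\<bar>\<beta>\<bar> + \<bar>\<gamma>\<bar>)"
  have D: "0 < D" by (simp add: D_def)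
  have hk: "h (1 / 2 ^ q) = kfun \<tau> \<beta> \<gamma> c\<^sub>0 (1 / 2 ^ q)" for q by (simp add: h_def assms(4))
  obtain q0 where upper: "\<And>q. q0 \<le> q \<Longrightarrow> h (1 / 2 ^ q) \<le> D * dyadic_rate (- \<tau>) \<beta> \<gamma> q"
    and lower: "\<And>q. q0 \<le> q \<Longrightarrow> dyadic_rate (- \<tau>) \<beta> \<gamma> q \<le> D * h (1 / 2 ^ q)"
    using kfun_dyadic_rate[OF assms(3), of \<tau> \<beta> \<gamma>] unfolding hk D_def by blast
  have logs: "0 < log 2 (real n + 1)" "0 < log 2 (log 2 (real n + 3))" if "0 < n" for n
  proof -
    have "2 \<le> log 2 (real n + 3)" using that by (subst le_log_iff) auto
    then show "0 < log 2 (log 2 (real n + 3))" by simp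
    show "0 < log 2 (real n + 1)" using that by simp
  qed
  show ?thesis
  proof (cases "\<tau> < 1/2")
    case True
    have "rate \<tau> \<beta> \<gamma> n = real n powr (- (1 - \<tau>)) * log 2 (real n + 1) powr (- \<beta>) * log 2 (log 2 (real n + 3)) powr (- \<gamma>)" if "0 < n" for n
      using True assms(1) by (simp add: rate_def Let_def)
    then show ?thesis
      unfolding T_def[symmetric]
      using polynomial_singularity[OF \<kappa> T pos D upper True]
      by (intro dominated_dyadic_rate[OF T_linear _ _ assms(12)]) auto
  next
    case False
    then have \<tau>: "\<tau> = 1/2" using assms(2) by simp
    have \<beta>\<gamma>: "1/2 < \<beta> \<or> (\<beta> = 1/2 \<and> 1/2 < \<gamma>)" using lower unfolding \<tau> by (rule critical_parameters)
    obtain a b g where abg: "critical_exponents \<beta> \<gamma> = (a, b, g)" by (cases "critical_exponents \<beta> \<gamma>")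
    obtain t G C where tGC: "\<And>j. 0 < t j" "0 < G"
        "\<And>j n. (\<Sum>i\<in>{j..<j + n}. dyadic_power (1 - 2 * \<beta>) (2 * \<gamma>) i) \<le> G * (t j)\<^sup>2"
        "\<And>q. 0 < q \<Longrightarrow> (\<Sum>j\<in>{floor_log q..q}. t j * sqrt (2 ^ j)) \<le> C * dyadic_rate (a - 1/2) b g q"
      using critical_sums[OF \<beta>\<gamma> abg] by blast
    have "rate \<tau> \<beta> \<gamma> n = real n powr (- a) * log 2 (real n + 1) powr (- b) * log 2 (log 2 (real n + 3)) powr (- g)" if "0 < n" for n
    proof -
      define N where "N = real n"
      define L where "L = log 2 (N + 1)"
      define M where "M = log 2 (log 2 (N + 3))"
      have pos: "0 < N" "0 < L" "0 < M" using that logs[OF that] by (auto simp: N_def L_def M_def)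
      then have ones: "N powr 0 = 1" "L powr 0 = 1" "M powr 0 = 1" "M powr 1 = M" by simp_all
      have rate: "rate \<tau> \<beta> \<gamma> n =
         (if 1/2 < \<beta> \<and> \<beta> < 1 then N powr (1/2 - \<beta>) * L powr (-\<gamma>)
          else if 1 < \<beta> then N powr (-1/2) * L powr (1 - \<beta>) * M powr (-\<gamma>)
          else if \<beta> = 1 \<and> \<gamma> < 1 then N powr (-1/2) * L powr (1 - \<gamma>)
          else if \<beta> = 1 \<and> \<gamma> = 1 then N powr (-1/2) * M
          else if \<beta> = 1 \<and> 1 < \<gamma> then N powr (-1/2) * M powr (1 - \<gamma>)
          else if \<beta> = 1/2 \<and> 1/2 < \<gamma> then L powr (1/2 - \<gamma>)
          else undefined)"
        by (simp add: rate_def Let_def \<tau> N_def L_def M_def)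
      consider "1/2 < \<beta>" "\<beta> < 1" | "1 < \<beta>" | "\<beta> = 1" "\<gamma> < 1" | "\<beta> = 1" "\<gamma> = 1"
        | "\<beta> = 1" "1 < \<gamma>" | "\<beta> = 1/2" "1/2 < \<gamma>"
        using \<beta>\<gamma> by linarith
      then have "rate \<tau> \<beta> \<gamma> n = N powr (- a) * L powr (- b) * M powr (- g)"
      proof cases
        case 1
        then have "- a = 1/2 - \<beta>" "b = \<gamma>" "- g = 0" using abg by (auto simp: critical_exponents_def)
        then show ?thesis unfolding rate using 1 ones by (simp only:) simp
      next
        case 2
        then have "- a = -1/2" "- b = 1 - \<beta>" "g = \<gamma>" using abg by (auto simp: critical_exponents_def)
        then show ?thesis unfolding rate using 2 by (simp only:) simp
      next
        case 3
        then have "- a = -1/2" "- b = 1 - \<gamma>" "- g = 0" using abg by (auto simp: critical_exponents_def)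
        then show ?thesis unfolding rate using 3 ones by (simp only:) simp
      next
        case 4
        then have "- a = -1/2" "- b = 0" "- g = 1" using abg by (auto simp: critical_exponents_def)
        then show ?thesis unfolding rate using 4 ones by (simp only:) simp
      next
        case 5
        then have "- a = -1/2" "- b = 0" "- g = 1 - \<gamma>" using abg by (auto simp: critical_exponents_def)
        then show ?thesis unfolding rate using 5 ones by (simp only:) simp
      next
        case 6
        then have "- a = 0" "- b = 1/2 - \<gamma>" "- g = 0" using abg by (auto simp: critical_exponents_def)
        then show ?thesis unfolding rate using 6 ones by (simp only:) simp
      qed
      then show ?thesis by (simp add: N_def L_def M_def)
    qed
    then show ?thesis
      unfolding T_def[symmetric]
      using logarithmic_singularity[OF \<kappa> T pos D upper[unfolded \<tau>] tGC]
      by (intro dominated_dyadic_rate[OF T_linear _ _ assms(12)]) auto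
  qed
qed

end
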